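(* The 2-category $\mathbf{Icon}$ of bicategories, functors, and icons can be given the structure of a strongly monoidal 2-category under products, i.e. with tensor product given by the cartesian product of bicategories and unit object the terminal bicategory.
   Context: "Functor" between bicategories means pseudofunctor; "2-functor" means strict 2-functor. Let $F,G:B\to C$ be functors of bicategories with constraints $\varphi_0,\varphi_2$ and $\psi_0,\psi_2$, agreeing on objects. An icon $\alpha:F\Rightarrow G$ consists of natural transformations $\alpha_{ab}:F_{ab}\Rightarrow G_{ab}:B(a,b)\to C(Fa,Fb)$, i.e. 2-cells $\alpha_f:Ff\Rightarrow Gf$, such that $\alpha_{I_a}\varphi_0=\psi_0:I_{Fa}\Rightarrow GI_a$ and $\alpha_{f*g}\varphi_2=\psi_2(\alpha_f*\alpha_g):Ff*Fg\Rightarrow G(f*g)$, where $*$ is horizontal composition. $\mathbf{Icon}$ is the 2-category with objects bicategories, 1-cells functors and 2-cells icons. A strongly monoidal 2-category is a $\mathbf{Cat}$-enriched monoidal category: a 2-category $A$ with a 2-functor $\otimes:A\times A\to A$, an object $I$, and 2-natural isomorphisms $a_{x,y,z}:(x\otimes y)\otimes z\to x\otimes(y\otimes z)$, $l_x:I\otimes x\to x$, $r_x:x\otimes I\to x$ satisfying the usual monoidal category axioms (pentagon and triangle). *)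

theory Defs
  imports Main "HOL-Library.FuncSet"
begin

section \<open>Bicategories and 2-categories\<close>

text \<open>
  Objects, 1-cells and 2-cells form three sets. Composition is written in applicative order:
  for \<open>f : b \<rightarrow> c\<close> and \<open>g : a \<rightarrow> b\<close> the composite is
  \<open>f \<star> g : a \<rightarrow> c\<close>, and \<open>\<beta> \<bullet> \<alpha>\<close> is the vertical
  composite ``\<open>\<beta>\<close> after \<open>\<alpha>\<close>''. Horizontal composition is
  \<open>\<star>\<close> on 1-cells and \<open>\<Zstar>\<close> on 2-cells.
\<close>

record ('o, 'f, 't) cells =
  Ob :: "'o set"
  Arr :: "'f set"
  Cell :: "'t set"
  src :: "'f \<Rightarrow> 'o"
  trg :: "'f \<Rightarrow> 'o"
  dm :: "'t \<Rightarrow> 'f"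
  cd :: "'t \<Rightarrow> 'f"
  id2 :: "'f \<Rightarrow> 't"
  vc :: "'t \<Rightarrow> 't \<Rightarrow> 't" (infixl "\<bullet>\<index>" 70)
  unit1 :: "'o \<Rightarrow> 'f"
  hc1 :: "'f \<Rightarrow> 'f \<Rightarrow> 'f" (infixl "\<star>\<index>" 75)
  hc2 :: "'t \<Rightarrow> 't \<Rightarrow> 't" (infixl "\<Zstar>\<index>" 75)

definition hom1 :: "('o, 'f, 't, 'm) cells_scheme \<Rightarrow> 'o \<Rightarrow> 'o \<Rightarrow> 'f set" where
  "hom1 B a b = {f \<in> Arr B. src B f = a \<and> trg B f = b}"

definition hom2 :: "('o, 'f, 't, 'm) cells_scheme \<Rightarrow> 'f \<Rightarrow> 'f \<Rightarrow> 't set" where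
  "hom2 B f g = {\<alpha> \<in> Cell B. dm B \<alpha> = f \<and> cd B \<alpha> = g}"

definition iso2 :: "('o, 'f, 't, 'm) cells_scheme \<Rightarrow> 't \<Rightarrow> bool" where
  "iso2 B \<alpha> \<longleftrightarrow> \<alpha> \<in> Cell B \<and>
    (\<exists>\<beta> \<in> hom2 B (cd B \<alpha>) (dm B \<alpha>).
      \<beta> \<bullet>\<^bsub>B\<^esub> \<alpha> = id2 B (dm B \<alpha>) \<and> \<alpha> \<bullet>\<^bsub>B\<^esub> \<beta> = id2 B (cd B \<alpha>))"

text \<open>
  What bicategories and 2-categories share: hom-categories \<open>B(a,b)\<close>, unit 1-cells, and
  composition functors \<open>B(b,c) \<times> B(a,b) \<rightarrow> B(a,c)\<close>.
\<close>

locale hom_categories =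
  fixes B :: "('o, 'f, 't, 'm) cells_scheme" (structure)
  assumes src_trg: "f \<in> Arr B \<Longrightarrow> src B f \<in> Ob B \<and> trg B f \<in> Ob B"
    and dm_cd: "\<alpha> \<in> Cell B \<Longrightarrow> dm B \<alpha> \<in> Arr B \<and> cd B \<alpha> \<in> Arr B"
    and parallel: "\<alpha> \<in> Cell B \<Longrightarrow>
      src B (dm B \<alpha>) = src B (cd B \<alpha>) \<and> trg B (dm B \<alpha>) = trg B (cd B \<alpha>)"
    and id2_hom: "f \<in> Arr B \<Longrightarrow> id2 B f \<in> hom2 B f f"
    and vc_hom: "\<lbrakk>\<alpha> \<in> hom2 B f g; \<beta> \<in> hom2 B g h\<rbrakk> \<Longrightarrow> \<beta> \<bullet> \<alpha> \<in> hom2 B f h"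
    and vc_assoc: "\<lbrakk>\<alpha> \<in> hom2 B f g; \<beta> \<in> hom2 B g h; \<gamma> \<in> hom2 B h k\<rbrakk> \<Longrightarrow>
      (\<gamma> \<bullet> \<beta>) \<bullet> \<alpha> = \<gamma> \<bullet> (\<beta> \<bullet> \<alpha>)"
    and vc_id_left: "\<alpha> \<in> hom2 B f g \<Longrightarrow> id2 B g \<bullet> \<alpha> = \<alpha>"
    and vc_id_right: "\<alpha> \<in> hom2 B f g \<Longrightarrow> \<alpha> \<bullet> id2 B f = \<alpha>"
    and unit1_hom: "a \<in> Ob B \<Longrightarrow> unit1 B a \<in> hom1 B a a"
    and hc1_hom: "\<lbrakk>f \<in> hom1 B b c; g \<in> hom1 B a b\<rbrakk> \<Longrightarrow> f \<star> g \<in> hom1 B a c"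
    and hc2_hom: "\<lbrakk>\<alpha> \<in> hom2 B f f'; \<beta> \<in> hom2 B g g'; src B f = trg B g\<rbrakk> \<Longrightarrow>
      \<alpha> \<Zstar> \<beta> \<in> hom2 B (f \<star> g) (f' \<star> g')"
    and hc2_id2: "\<lbrakk>f \<in> Arr B; g \<in> Arr B; src B f = trg B g\<rbrakk> \<Longrightarrow>
      id2 B f \<Zstar> id2 B g = id2 B (f \<star> g)"
    and interchange: "\<lbrakk>\<alpha> \<in> hom2 B f f'; \<alpha>' \<in> hom2 B f' f''; \<beta> \<in> hom2 B g g'; \<beta>' \<in> hom2 B g' g'';
        src B f = trg B g\<rbrakk> \<Longrightarrow>
      (\<alpha>' \<bullet> \<alpha>) \<Zstar> (\<beta>' \<bullet> \<beta>) = (\<alpha>' \<Zstar> \<beta>') \<bullet> (\<alpha> \<Zstar> \<beta>)"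

record ('o, 'f, 't) bicat = "('o, 'f, 't) cells" +
  assoc :: "'f \<Rightarrow> 'f \<Rightarrow> 'f \<Rightarrow> 't"
  lunit :: "'f \<Rightarrow> 't"
  runit :: "'f \<Rightarrow> 't"

locale bicategory = hom_categories B
  for B :: "('o, 'f, 't, 'm) bicat_scheme" (structure) +
  assumes assoc_hom: "\<lbrakk>f \<in> hom1 B c d; g \<in> hom1 B b c; h \<in> hom1 B a b\<rbrakk> \<Longrightarrow>
      assoc B f g h \<in> hom2 B ((f \<star> g) \<star> h) (f \<star> (g \<star> h))"
    and assoc_iso: "\<lbrakk>f \<in> hom1 B c d; g \<in> hom1 B b c; h \<in> hom1 B a b\<rbrakk> \<Longrightarrow> iso2 B (assoc B f g h)"
    and assoc_natural: "\<lbrakk>\<alpha> \<in> hom2 B f f'; \<beta> \<in> hom2 B g g'; \<gamma> \<in> hom2 B h h';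
        src B f = trg B g; src B g = trg B h\<rbrakk> \<Longrightarrow>
      assoc B f' g' h' \<bullet> ((\<alpha> \<Zstar> \<beta>) \<Zstar> \<gamma>) = (\<alpha> \<Zstar> (\<beta> \<Zstar> \<gamma>)) \<bullet> assoc B f g h"
    and lunit_hom: "f \<in> hom1 B a b \<Longrightarrow> lunit B f \<in> hom2 B (unit1 B b \<star> f) f"
    and lunit_iso: "f \<in> Arr B \<Longrightarrow> iso2 B (lunit B f)"
    and lunit_natural: "\<alpha> \<in> hom2 B f g \<Longrightarrow>
      lunit B g \<bullet> (id2 B (unit1 B (trg B f)) \<Zstar> \<alpha>) = \<alpha> \<bullet> lunit B f"
    and runit_hom: "f \<in> hom1 B a b \<Longrightarrow> runit B f \<in> hom2 B (f \<star> unit1 B a) f"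
    and runit_iso: "f \<in> Arr B \<Longrightarrow> iso2 B (runit B f)"
    and runit_natural: "\<alpha> \<in> hom2 B f g \<Longrightarrow>
      runit B g \<bullet> (\<alpha> \<Zstar> id2 B (unit1 B (src B f))) = \<alpha> \<bullet> runit B f"
    and pentagon: "\<lbrakk>f \<in> hom1 B d e; g \<in> hom1 B c d; h \<in> hom1 B b c; k \<in> hom1 B a b\<rbrakk> \<Longrightarrow>
      (id2 B f \<Zstar> assoc B g h k) \<bullet> assoc B f (g \<star> h) k \<bullet> (assoc B f g h \<Zstar> id2 B k)
        = assoc B f g (h \<star> k) \<bullet> assoc B (f \<star> g) h k"
    and triangle: "\<lbrakk>f \<in> hom1 B b c; g \<in> hom1 B a b\<rbrakk> \<Longrightarrow>
      (id2 B f \<Zstar> lunit B g) \<bullet> assoc B f (unit1 B b) g = runit B f \<Zstar> id2 B g"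

locale two_category = hom_categories A
  for A :: "('o, 'f, 't, 'm) cells_scheme" (structure) +
  assumes hc1_assoc: "\<lbrakk>f \<in> hom1 A c d; g \<in> hom1 A b c; h \<in> hom1 A a b\<rbrakk> \<Longrightarrow>
      (f \<star> g) \<star> h = f \<star> (g \<star> h)"
    and hc1_unit_left: "f \<in> hom1 A a b \<Longrightarrow> unit1 A b \<star> f = f"
    and hc1_unit_right: "f \<in> hom1 A a b \<Longrightarrow> f \<star> unit1 A a = f"
    and hc2_assoc: "\<lbrakk>\<alpha> \<in> hom2 A f f'; \<beta> \<in> hom2 A g g'; \<gamma> \<in> hom2 A h h';
        src A f = trg A g; src A g = trg A h\<rbrakk> \<Longrightarrow>
      (\<alpha> \<Zstar> \<beta>) \<Zstar> \<gamma> = \<alpha> \<Zstar> (\<beta> \<Zstar> \<gamma>)"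
    and hc2_unit_left: "\<alpha> \<in> hom2 A f g \<Longrightarrow> id2 A (unit1 A (trg A f)) \<Zstar> \<alpha> = \<alpha>"
    and hc2_unit_right: "\<alpha> \<in> hom2 A f g \<Longrightarrow> \<alpha> \<Zstar> id2 A (unit1 A (src A f)) = \<alpha>"


section \<open>Strongly monoidal 2-categories\<close>

definition prod_cells ::
  "('o, 'f, 't) cells \<Rightarrow> ('p, 'g, 's) cells \<Rightarrow> ('o \<times> 'p, 'f \<times> 'g, 't \<times> 's) cells" where
  "prod_cells A B = \<lparr>
    Ob = Ob A \<times> Ob B,
    Arr = Arr A \<times> Arr B,
    Cell = Cell A \<times> Cell B,
    src = map_prod (src A) (src B),
    trg = map_prod (trg A) (trg B),
    dm = map_prod (dm A) (dm B),
    cd = map_prod (cd A) (cd B),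
    id2 = map_prod (id2 A) (id2 B),
    vc = (\<lambda>(\<beta>, \<beta>') (\<alpha>, \<alpha>'). (vc A \<beta> \<alpha>, vc B \<beta>' \<alpha>')),
    unit1 = map_prod (unit1 A) (unit1 B),
    hc1 = (\<lambda>(f, f') (g, g'). (hc1 A f g, hc1 B f' g')),
    hc2 = (\<lambda>(\<alpha>, \<alpha>') (\<beta>, \<beta>'). (hc2 A \<alpha> \<beta>, hc2 B \<alpha>' \<beta>')) \<rparr>"

record ('o, 'f, 't, 'p, 'g, 's) two_map =
  ob_map :: "'o \<Rightarrow> 'p"
  arr_map :: "'f \<Rightarrow> 'g"
  cell_map :: "'t \<Rightarrow> 's"

locale two_functor = A: two_category A + B: two_category B
  for A :: "('o, 'f, 't) cells" and B :: "('p, 'g, 's) cells" +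
  fixes T :: "('o, 'f, 't, 'p, 'g, 's) two_map"
  assumes ob_map_in: "x \<in> Ob A \<Longrightarrow> ob_map T x \<in> Ob B"
    and arr_map_hom: "f \<in> hom1 A x y \<Longrightarrow> arr_map T f \<in> hom1 B (ob_map T x) (ob_map T y)"
    and cell_map_hom: "\<alpha> \<in> hom2 A f g \<Longrightarrow> cell_map T \<alpha> \<in> hom2 B (arr_map T f) (arr_map T g)"
    and cell_map_id2: "f \<in> Arr A \<Longrightarrow> cell_map T (id2 A f) = id2 B (arr_map T f)"
    and cell_map_vc: "\<lbrakk>\<alpha> \<in> hom2 A f g; \<beta> \<in> hom2 A g h\<rbrakk> \<Longrightarrow>
      cell_map T (\<beta> \<bullet>\<^bsub>A\<^esub> \<alpha>) = cell_map T \<beta> \<bullet>\<^bsub>B\<^esub> cell_map T \<alpha>"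
    and arr_map_unit1: "x \<in> Ob A \<Longrightarrow> arr_map T (unit1 A x) = unit1 B (ob_map T x)"
    and arr_map_hc1: "\<lbrakk>f \<in> hom1 A y z; g \<in> hom1 A x y\<rbrakk> \<Longrightarrow>
      arr_map T (f \<star>\<^bsub>A\<^esub> g) = arr_map T f \<star>\<^bsub>B\<^esub> arr_map T g"
    and cell_map_hc2: "\<lbrakk>\<alpha> \<in> hom2 A f f'; \<beta> \<in> hom2 A g g'; src A f = trg A g\<rbrakk> \<Longrightarrow>
      cell_map T (\<alpha> \<Zstar>\<^bsub>A\<^esub> \<beta>) = cell_map T \<alpha> \<Zstar>\<^bsub>B\<^esub> cell_map T \<beta>"

definition iso1 :: "('o, 'f, 't) cells \<Rightarrow> 'f \<Rightarrow> bool" where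
  "iso1 A f \<longleftrightarrow> f \<in> Arr A \<and>
    (\<exists>g \<in> hom1 A (trg A f) (src A f).
      g \<star>\<^bsub>A\<^esub> f = unit1 A (src A f) \<and> f \<star>\<^bsub>A\<^esub> g = unit1 A (trg A f))"

locale two_natural_iso = S: two_functor A B S + T: two_functor A B T
  for A :: "('o, 'f, 't) cells" and B :: "('p, 'g, 's) cells"
    and S T :: "('o, 'f, 't, 'p, 'g, 's) two_map" +
  fixes \<theta> :: "'o \<Rightarrow> 'g"
  assumes component_hom: "x \<in> Ob A \<Longrightarrow> \<theta> x \<in> hom1 B (ob_map S x) (ob_map T x)"
    and component_iso: "x \<in> Ob A \<Longrightarrow> iso1 B (\<theta> x)"
    and natural1: "f \<in> hom1 A x y \<Longrightarrow>
      arr_map T f \<star>\<^bsub>B\<^esub> \<theta> x = \<theta> y \<star>\<^bsub>B\<^esub> arr_map S f"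
    and natural2: "\<lbrakk>\<alpha> \<in> hom2 A f g; f \<in> hom1 A x y\<rbrakk> \<Longrightarrow>
      cell_map T \<alpha> \<Zstar>\<^bsub>B\<^esub> id2 B (\<theta> x) = id2 B (\<theta> y) \<Zstar>\<^bsub>B\<^esub> cell_map S \<alpha>"

definition id_map :: "('o, 'f, 't, 'o, 'f, 't) two_map" where
  "id_map = \<lparr>ob_map = (\<lambda>x. x), arr_map = (\<lambda>f. f), cell_map = (\<lambda>\<alpha>. \<alpha>)\<rparr>"

text \<open>
  The four 2-functors \<open>(x \<otimes> y) \<otimes> z\<close>, \<open>x \<otimes> (y \<otimes> z)\<close>,
  \<open>I \<otimes> x\<close> and \<open>x \<otimes> I\<close>, of three variables and one variable.
\<close>

type_synonym ('o, 'f, 't) tensor = "('o \<times> 'o, 'f \<times> 'f, 't \<times> 't, 'o, 'f, 't) two_map"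

definition tensor_left :: "('o, 'f, 't) tensor \<Rightarrow>
    (('o \<times> 'o) \<times> 'o, ('f \<times> 'f) \<times> 'f, ('t \<times> 't) \<times> 't, 'o, 'f, 't) two_map" where
  "tensor_left T = \<lparr>
    ob_map = (\<lambda>((x, y), z). ob_map T (ob_map T (x, y), z)),
    arr_map = (\<lambda>((f, g), h). arr_map T (arr_map T (f, g), h)),
    cell_map = (\<lambda>((\<alpha>, \<beta>), \<gamma>). cell_map T (cell_map T (\<alpha>, \<beta>), \<gamma>)) \<rparr>"

definition tensor_right :: "('o, 'f, 't) tensor \<Rightarrow>
    (('o \<times> 'o) \<times> 'o, ('f \<times> 'f) \<times> 'f, ('t \<times> 't) \<times> 't, 'o, 'f, 't) two_map" where
  "tensor_right T = \<lparr>
    ob_map = (\<lambda>((x, y), z). ob_map T (x, ob_map T (y, z))),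
    arr_map = (\<lambda>((f, g), h). arr_map T (f, arr_map T (g, h))),
    cell_map = (\<lambda>((\<alpha>, \<beta>), \<gamma>). cell_map T (\<alpha>, cell_map T (\<beta>, \<gamma>))) \<rparr>"

definition unit_tensor ::
  "('o, 'f, 't) cells \<Rightarrow> ('o, 'f, 't) tensor \<Rightarrow> 'o \<Rightarrow> ('o, 'f, 't, 'o, 'f, 't) two_map" where
  "unit_tensor A T I = \<lparr>
    ob_map = (\<lambda>x. ob_map T (I, x)),
    arr_map = (\<lambda>f. arr_map T (unit1 A I, f)),
    cell_map = (\<lambda>\<alpha>. cell_map T (id2 A (unit1 A I), \<alpha>)) \<rparr>"

definition tensor_unit ::
  "('o, 'f, 't) cells \<Rightarrow> ('o, 'f, 't) tensor \<Rightarrow> 'o \<Rightarrow> ('o, 'f, 't, 'o, 'f, 't) two_map" where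
  "tensor_unit A T I = \<lparr>
    ob_map = (\<lambda>x. ob_map T (x, I)),
    arr_map = (\<lambda>f. arr_map T (f, unit1 A I)),
    cell_map = (\<lambda>\<alpha>. cell_map T (\<alpha>, id2 A (unit1 A I))) \<rparr>"

locale strongly_monoidal_2category =
  two_category A + tensor: two_functor "prod_cells A A" A T
  for A :: "('o, 'f, 't) cells" (structure) and T :: "('o, 'f, 't) tensor" +
  fixes I :: 'o and a :: "'o \<Rightarrow> 'o \<Rightarrow> 'o \<Rightarrow> 'f" and l r :: "'o \<Rightarrow> 'f"
  assumes unit_object: "I \<in> Ob A"
    and associator: "two_natural_iso (prod_cells (prod_cells A A) A) A
      (tensor_left T) (tensor_right T) (\<lambda>((x, y), z). a x y z)"
    and left_unitor: "two_natural_iso A A (unit_tensor A T I) id_map l"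
    and right_unitor: "two_natural_iso A A (tensor_unit A T I) id_map r"
    and monoidal_pentagon: "\<lbrakk>w \<in> Ob A; x \<in> Ob A; y \<in> Ob A; z \<in> Ob A\<rbrakk> \<Longrightarrow>
      arr_map T (unit1 A w, a x y z) \<star> a w (ob_map T (x, y)) z \<star> arr_map T (a w x y, unit1 A z)
        = a w x (ob_map T (y, z)) \<star> a (ob_map T (w, x)) y z"
    and monoidal_triangle: "\<lbrakk>x \<in> Ob A; y \<in> Ob A\<rbrakk> \<Longrightarrow>
      arr_map T (unit1 A x, l y) \<star> a x I y = arr_map T (r x, unit1 A y)"


section \<open>Functors of bicategories and icons\<close>

text \<open>
  A functor carries its source and target. Its constraints are
  \<open>phi0 F a : I\<^bsub>Fa\<^esub> \<Rightarrow> F I\<^bsub>a\<^esub>\<close> and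
  \<open>phi2 F f g : F f \<star> F g \<Rightarrow> F (f \<star> g)\<close>.
\<close>

record ('o, 'f, 't, 'p, 'g, 's) pfun =
  Src :: "('o, 'f, 't) bicat"
  Trg :: "('p, 'g, 's) bicat"
  on0 :: "'o \<Rightarrow> 'p"
  on1 :: "'f \<Rightarrow> 'g"
  on2 :: "'t \<Rightarrow> 's"
  phi0 :: "'o \<Rightarrow> 's"
  phi2 :: "'f \<Rightarrow> 'f \<Rightarrow> 's"

locale pseudofunctor = B: bicategory B + C: bicategory C
  for B :: "('o, 'f, 't) bicat" and C :: "('p, 'g, 's) bicat" +
  fixes F :: "('o, 'f, 't, 'p, 'g, 's) pfun"
  assumes Src_Trg: "Src F = B \<and> Trg F = C"
    and on0_in: "a \<in> Ob B \<Longrightarrow> on0 F a \<in> Ob C"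
    and on1_hom: "f \<in> hom1 B a b \<Longrightarrow> on1 F f \<in> hom1 C (on0 F a) (on0 F b)"
    and on2_hom: "\<alpha> \<in> hom2 B f g \<Longrightarrow> on2 F \<alpha> \<in> hom2 C (on1 F f) (on1 F g)"
    and on2_id2: "f \<in> Arr B \<Longrightarrow> on2 F (id2 B f) = id2 C (on1 F f)"
    and on2_vc: "\<lbrakk>\<alpha> \<in> hom2 B f g; \<beta> \<in> hom2 B g h\<rbrakk> \<Longrightarrow>
      on2 F (\<beta> \<bullet>\<^bsub>B\<^esub> \<alpha>) = on2 F \<beta> \<bullet>\<^bsub>C\<^esub> on2 F \<alpha>"
    and phi0_hom: "a \<in> Ob B \<Longrightarrow>
      phi0 F a \<in> hom2 C (unit1 C (on0 F a)) (on1 F (unit1 B a))"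
    and phi0_iso: "a \<in> Ob B \<Longrightarrow> iso2 C (phi0 F a)"
    and phi2_hom: "\<lbrakk>f \<in> hom1 B b c; g \<in> hom1 B a b\<rbrakk> \<Longrightarrow>
      phi2 F f g \<in> hom2 C (on1 F f \<star>\<^bsub>C\<^esub> on1 F g) (on1 F (f \<star>\<^bsub>B\<^esub> g))"
    and phi2_iso: "\<lbrakk>f \<in> hom1 B b c; g \<in> hom1 B a b\<rbrakk> \<Longrightarrow> iso2 C (phi2 F f g)"
    and phi2_natural: "\<lbrakk>\<alpha> \<in> hom2 B f f'; \<beta> \<in> hom2 B g g'; src B f = trg B g\<rbrakk> \<Longrightarrow>
      phi2 F f' g' \<bullet>\<^bsub>C\<^esub> (on2 F \<alpha> \<Zstar>\<^bsub>C\<^esub> on2 F \<beta>)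
        = on2 F (\<alpha> \<Zstar>\<^bsub>B\<^esub> \<beta>) \<bullet>\<^bsub>C\<^esub> phi2 F f g"
    and phi2_assoc: "\<lbrakk>f \<in> hom1 B c d; g \<in> hom1 B b c; h \<in> hom1 B a b\<rbrakk> \<Longrightarrow>
      on2 F (assoc B f g h) \<bullet>\<^bsub>C\<^esub> phi2 F (f \<star>\<^bsub>B\<^esub> g) h
          \<bullet>\<^bsub>C\<^esub> (phi2 F f g \<Zstar>\<^bsub>C\<^esub> id2 C (on1 F h))
        = phi2 F f (g \<star>\<^bsub>B\<^esub> h) \<bullet>\<^bsub>C\<^esub> (id2 C (on1 F f) \<Zstar>\<^bsub>C\<^esub> phi2 F g h)
          \<bullet>\<^bsub>C\<^esub> assoc C (on1 F f) (on1 F g) (on1 F h)"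
    and phi0_left: "f \<in> hom1 B a b \<Longrightarrow>
      on2 F (lunit B f) \<bullet>\<^bsub>C\<^esub> phi2 F (unit1 B b) f
          \<bullet>\<^bsub>C\<^esub> (phi0 F b \<Zstar>\<^bsub>C\<^esub> id2 C (on1 F f))
        = lunit C (on1 F f)"
    and phi0_right: "f \<in> hom1 B a b \<Longrightarrow>
      on2 F (runit B f) \<bullet>\<^bsub>C\<^esub> phi2 F f (unit1 B a)
          \<bullet>\<^bsub>C\<^esub> (id2 C (on1 F f) \<Zstar>\<^bsub>C\<^esub> phi0 F a)
        = runit C (on1 F f)"

record ('o, 'f, 't, 'p, 'g, 's) icon =
  Dom :: "('o, 'f, 't, 'p, 'g, 's) pfun"
  Cod :: "('o, 'f, 't, 'p, 'g, 's) pfun"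
  component :: "'f \<Rightarrow> 's"

locale icon = F: pseudofunctor B C F + G: pseudofunctor B C G
  for B :: "('o, 'f, 't) bicat" and C :: "('p, 'g, 's) bicat"
    and F G :: "('o, 'f, 't, 'p, 'g, 's) pfun" +
  fixes \<alpha> :: "('o, 'f, 't, 'p, 'g, 's) icon"
  assumes Dom_Cod: "Dom \<alpha> = F \<and> Cod \<alpha> = G"
    and agree_on_objects: "a \<in> Ob B \<Longrightarrow> on0 F a = on0 G a"
    and comp_hom: "f \<in> Arr B \<Longrightarrow> component \<alpha> f \<in> hom2 C (on1 F f) (on1 G f)"
    and comp_natural: "\<sigma> \<in> hom2 B f g \<Longrightarrow>
      component \<alpha> g \<bullet>\<^bsub>C\<^esub> on2 F \<sigma> = on2 G \<sigma> \<bullet>\<^bsub>C\<^esub> component \<alpha> f"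
    and comp_phi0: "a \<in> Ob B \<Longrightarrow>
      component \<alpha> (unit1 B a) \<bullet>\<^bsub>C\<^esub> phi0 F a = phi0 G a"
    and comp_phi2: "\<lbrakk>f \<in> hom1 B b c; g \<in> hom1 B a b\<rbrakk> \<Longrightarrow>
      component \<alpha> (f \<star>\<^bsub>B\<^esub> g) \<bullet>\<^bsub>C\<^esub> phi2 F f g
        = phi2 G f g \<bullet>\<^bsub>C\<^esub> (component \<alpha> f \<Zstar>\<^bsub>C\<^esub> component \<alpha> g)"


section \<open>The 2-category of bicategories, functors and icons\<close>

text \<open>
  The operations of the records above are total functions, but only their values on the relevant
  cells and composable tuples are part of the mathematical object. The following normalisations
  set all other values to \<^const>\<open>undefined\<close>; on their fixed points, record equality is
  equality of bicategories, functors and icons.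
\<close>

definition trim_bicat :: "('o, 'f, 't) bicat \<Rightarrow> ('o, 'f, 't) bicat" where
  "trim_bicat B = \<lparr>
    Ob = Ob B,
    Arr = Arr B,
    Cell = Cell B,
    src = restrict (src B) (Arr B),
    trg = restrict (trg B) (Arr B),
    dm = restrict (dm B) (Cell B),
    cd = restrict (cd B) (Cell B),
    id2 = restrict (id2 B) (Arr B),
    vc = (\<lambda>\<beta> \<alpha>. if \<beta> \<in> Cell B \<and> \<alpha> \<in> Cell B \<and> dm B \<beta> = cd B \<alpha> then vc B \<beta> \<alpha> else undefined),
    unit1 = restrict (unit1 B) (Ob B),
    hc1 = (\<lambda>f g. if f \<in> Arr B \<and> g \<in> Arr B \<and> src B f = trg B g then hc1 B f g else undefined),
    hc2 = (\<lambda>\<alpha> \<beta>. if \<alpha> \<in> Cell B \<and> \<beta> \<in> Cell B \<and> src B (dm B \<alpha>) = trg B (dm B \<beta>)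
      then hc2 B \<alpha> \<beta> else undefined),
    assoc = (\<lambda>f g h. if f \<in> Arr B \<and> g \<in> Arr B \<and> h \<in> Arr B \<and> src B f = trg B g \<and> src B g = trg B h
      then assoc B f g h else undefined),
    lunit = restrict (lunit B) (Arr B),
    runit = restrict (runit B) (Arr B) \<rparr>"

definition trim_pfun ::
  "('o, 'f, 't, 'p, 'g, 's) pfun \<Rightarrow> ('o, 'f, 't, 'p, 'g, 's) pfun" where
  "trim_pfun F = \<lparr>
    Src = Src F,
    Trg = Trg F,
    on0 = restrict (on0 F) (Ob (Src F)),
    on1 = restrict (on1 F) (Arr (Src F)),
    on2 = restrict (on2 F) (Cell (Src F)),
    phi0 = restrict (phi0 F) (Ob (Src F)),
    phi2 = (\<lambda>f g. if f \<in> Arr (Src F) \<and> g \<in> Arr (Src F) \<and> src (Src F) f = trg (Src F) g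
      then phi2 F f g else undefined) \<rparr>"

definition trim_icon ::
  "('o, 'f, 't, 'p, 'g, 's) icon \<Rightarrow> ('o, 'f, 't, 'p, 'g, 's) icon" where
  "trim_icon \<alpha> = \<lparr>
    Dom = Dom \<alpha>,
    Cod = Cod \<alpha>,
    component = restrict (component \<alpha>) (Arr (Src (Dom \<alpha>))) \<rparr>"

definition id_pfun :: "('o, 'f, 't) bicat \<Rightarrow> ('o, 'f, 't, 'o, 'f, 't) pfun" where
  "id_pfun B = trim_pfun \<lparr>
    Src = B,
    Trg = B,
    on0 = (\<lambda>a. a),
    on1 = (\<lambda>f. f),
    on2 = (\<lambda>\<alpha>. \<alpha>),
    phi0 = (\<lambda>a. id2 B (unit1 B a)),
    phi2 = (\<lambda>f g. id2 B (hc1 B f g)) \<rparr>"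

definition comp_pfun ::
  "('p, 'g, 's, 'q, 'h, 'r) pfun \<Rightarrow> ('o, 'f, 't, 'p, 'g, 's) pfun \<Rightarrow> ('o, 'f, 't, 'q, 'h, 'r) pfun" where
  "comp_pfun G F = trim_pfun \<lparr>
    Src = Src F,
    Trg = Trg G,
    on0 = (\<lambda>a. on0 G (on0 F a)),
    on1 = (\<lambda>f. on1 G (on1 F f)),
    on2 = (\<lambda>\<alpha>. on2 G (on2 F \<alpha>)),
    phi0 = (\<lambda>a. on2 G (phi0 F a) \<bullet>\<^bsub>Trg G\<^esub> phi0 G (on0 F a)),
    phi2 = (\<lambda>f g. on2 G (phi2 F f g) \<bullet>\<^bsub>Trg G\<^esub> phi2 G (on1 F f) (on1 F g)) \<rparr>"

definition id_icon ::
  "('o, 'f, 't, 'p, 'g, 's) pfun \<Rightarrow> ('o, 'f, 't, 'p, 'g, 's) icon" where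
  "id_icon F = trim_icon \<lparr> Dom = F, Cod = F, component = (\<lambda>f. id2 (Trg F) (on1 F f)) \<rparr>"

definition vcomp_icon :: "('o, 'f, 't, 'p, 'g, 's) icon \<Rightarrow> ('o, 'f, 't, 'p, 'g, 's) icon \<Rightarrow>
    ('o, 'f, 't, 'p, 'g, 's) icon" where
  "vcomp_icon \<beta> \<alpha> = trim_icon \<lparr>
    Dom = Dom \<alpha>,
    Cod = Cod \<beta>,
    component = (\<lambda>f. component \<beta> f \<bullet>\<^bsub>Trg (Dom \<alpha>)\<^esub> component \<alpha> f) \<rparr>"

text \<open>
  For \<open>\<alpha> : F \<Rightarrow> G : B \<rightarrow> C\<close> and
  \<open>\<beta> : H \<Rightarrow> K : C \<rightarrow> D\<close>, the component at \<open>f\<close> of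
  \<open>\<beta> \<Zstar> \<alpha> : HF \<Rightarrow> KG\<close> is
  \<open>\<beta>\<^bsub>Gf\<^esub> \<bullet> H\<alpha>\<^bsub>f\<^esub>\<close>, the horizontal composite of
  natural transformations.
\<close>

definition hcomp_icon :: "('p, 'g, 's, 'q, 'h, 'r) icon \<Rightarrow> ('o, 'f, 't, 'p, 'g, 's) icon \<Rightarrow>
    ('o, 'f, 't, 'q, 'h, 'r) icon" where
  "hcomp_icon \<beta> \<alpha> = trim_icon \<lparr>
    Dom = comp_pfun (Dom \<beta>) (Dom \<alpha>),
    Cod = comp_pfun (Cod \<beta>) (Cod \<alpha>),
    component = (\<lambda>f. component \<beta> (on1 (Cod \<alpha>) f) \<bullet>\<^bsub>Trg (Dom \<beta>)\<^esub> on2 (Dom \<beta>) (component \<alpha> f)) \<rparr>"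

text \<open>
  The type \<open>'u\<close> plays the role of the universe of small sets: the objects of \<open>Icon\<close> are
  the bicategories whose cells are elements of \<open>'u\<close>.
\<close>

type_synonym 'u small_bicat = "('u, 'u, 'u) bicat"
type_synonym 'u small_pfun = "('u, 'u, 'u, 'u, 'u, 'u) pfun"
type_synonym 'u small_icon = "('u, 'u, 'u, 'u, 'u, 'u) icon"

definition bicategories :: "'u small_bicat set" where
  "bicategories = {B. bicategory B \<and> trim_bicat B = B}"

definition functors :: "'u small_pfun set" where
  "functors = {F. Src F \<in> bicategories \<and> Trg F \<in> bicategories \<and>
    pseudofunctor (Src F) (Trg F) F \<and> trim_pfun F = F}"

definition icons :: "'u small_icon set" where
  "icons = {\<alpha>. Dom \<alpha> \<in> functors \<and> Cod \<alpha> \<in> functors \<and>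
    icon (Src (Dom \<alpha>)) (Trg (Dom \<alpha>)) (Dom \<alpha>) (Cod \<alpha>) \<alpha> \<and> trim_icon \<alpha> = \<alpha>}"

definition Icon :: "('u small_bicat, 'u small_pfun, 'u small_icon) cells" where
  "Icon = \<lparr>
    Ob = bicategories,
    Arr = functors,
    Cell = icons,
    src = Src,
    trg = Trg,
    dm = Dom,
    cd = Cod,
    id2 = id_icon,
    vc = vcomp_icon,
    unit1 = id_pfun,
    hc1 = comp_pfun,
    hc2 = hcomp_icon \<rparr>"


section \<open>Cartesian products and the terminal bicategory\<close>

text \<open>
  Products must have their cells in \<open>'u\<close> again, so ordered pairs are coded by an injection
  \<open>pr : 'u \<times> 'u \<rightarrow> 'u\<close>. Such an injection exists on every infinite type.
\<close>

lemma ex_pairing: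
  assumes "infinite (UNIV :: 'u set)"
  shows "\<exists>pr :: 'u \<times> 'u \<Rightarrow> 'u. inj pr"
proof -
  have "(card_of ((UNIV :: 'u set) \<times> (UNIV :: 'u set)), card_of (UNIV :: 'u set)) \<in> ordLeq"
    using card_of_Times_same_infinite[OF assms] by (rule ordIso_imp_ordLeq)
  then show ?thesis
    unfolding card_of_ordLeq[symmetric] by auto
qed

definition pair1 :: "('u \<times> 'u \<Rightarrow> 'u) \<Rightarrow> ('u \<Rightarrow> 'u) \<Rightarrow> ('u \<Rightarrow> 'u) \<Rightarrow> 'u \<Rightarrow> 'u" where
  "pair1 pr p q x = (case inv pr x of (x1, x2) \<Rightarrow> pr (p x1, q x2))"

definition pair2 :: "('u \<times> 'u \<Rightarrow> 'u) \<Rightarrow> ('u \<Rightarrow> 'u \<Rightarrow> 'u) \<Rightarrow> ('u \<Rightarrow> 'u \<Rightarrow> 'u) \<Rightarrow>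
    'u \<Rightarrow> 'u \<Rightarrow> 'u" where
  "pair2 pr p q x y = (case (inv pr x, inv pr y) of ((x1, x2), (y1, y2)) \<Rightarrow> pr (p x1 y1, q x2 y2))"

definition pair3 :: "('u \<times> 'u \<Rightarrow> 'u) \<Rightarrow> ('u \<Rightarrow> 'u \<Rightarrow> 'u \<Rightarrow> 'u) \<Rightarrow>
    ('u \<Rightarrow> 'u \<Rightarrow> 'u \<Rightarrow> 'u) \<Rightarrow> 'u \<Rightarrow> 'u \<Rightarrow> 'u \<Rightarrow> 'u" where
  "pair3 pr p q x y z = (case (inv pr x, inv pr y, inv pr z) of
    ((x1, x2), (y1, y2), (z1, z2)) \<Rightarrow> pr (p x1 y1 z1, q x2 y2 z2))"

definition prod_bicat ::
  "('u \<times> 'u \<Rightarrow> 'u) \<Rightarrow> 'u small_bicat \<Rightarrow> 'u small_bicat \<Rightarrow> 'u small_bicat" where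
  "prod_bicat pr B C = trim_bicat \<lparr>
    Ob = pr ` (Ob B \<times> Ob C),
    Arr = pr ` (Arr B \<times> Arr C),
    Cell = pr ` (Cell B \<times> Cell C),
    src = pair1 pr (src B) (src C),
    trg = pair1 pr (trg B) (trg C),
    dm = pair1 pr (dm B) (dm C),
    cd = pair1 pr (cd B) (cd C),
    id2 = pair1 pr (id2 B) (id2 C),
    vc = pair2 pr (vc B) (vc C),
    unit1 = pair1 pr (unit1 B) (unit1 C),
    hc1 = pair2 pr (hc1 B) (hc1 C),
    hc2 = pair2 pr (hc2 B) (hc2 C),
    assoc = pair3 pr (assoc B) (assoc C),
    lunit = pair1 pr (lunit B) (lunit C),
    runit = pair1 pr (runit B) (runit C) \<rparr>"

definition prod_pfun ::
  "('u \<times> 'u \<Rightarrow> 'u) \<Rightarrow> 'u small_pfun \<Rightarrow> 'u small_pfun \<Rightarrow> 'u small_pfun" where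
  "prod_pfun pr F G = trim_pfun \<lparr>
    Src = prod_bicat pr (Src F) (Src G),
    Trg = prod_bicat pr (Trg F) (Trg G),
    on0 = pair1 pr (on0 F) (on0 G),
    on1 = pair1 pr (on1 F) (on1 G),
    on2 = pair1 pr (on2 F) (on2 G),
    phi0 = pair1 pr (phi0 F) (phi0 G),
    phi2 = pair2 pr (phi2 F) (phi2 G) \<rparr>"

definition prod_icon ::
  "('u \<times> 'u \<Rightarrow> 'u) \<Rightarrow> 'u small_icon \<Rightarrow> 'u small_icon \<Rightarrow> 'u small_icon" where
  "prod_icon pr \<alpha> \<beta> = trim_icon \<lparr>
    Dom = prod_pfun pr (Dom \<alpha>) (Dom \<beta>),
    Cod = prod_pfun pr (Cod \<alpha>) (Cod \<beta>),
    component = pair1 pr (component \<alpha>) (component \<beta>) \<rparr>"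

definition cartesian_product :: "('u \<times> 'u \<Rightarrow> 'u) \<Rightarrow>
    ('u small_bicat, 'u small_pfun, 'u small_icon) tensor" where
  "cartesian_product pr = \<lparr>
    ob_map = (\<lambda>(B, C). prod_bicat pr B C),
    arr_map = (\<lambda>(F, G). prod_pfun pr F G),
    cell_map = (\<lambda>(\<alpha>, \<beta>). prod_icon pr \<alpha> \<beta>) \<rparr>"

definition terminal_bicat :: "'u \<Rightarrow> 'u small_bicat" where
  "terminal_bicat pt = trim_bicat \<lparr>
    Ob = {pt},
    Arr = {pt},
    Cell = {pt},
    src = (\<lambda>_. pt),
    trg = (\<lambda>_. pt),
    dm = (\<lambda>_. pt),
    cd = (\<lambda>_. pt),
    id2 = (\<lambda>_. pt),
    vc = (\<lambda>_ _. pt),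
    unit1 = (\<lambda>_. pt),
    hc1 = (\<lambda>_ _. pt),
    hc2 = (\<lambda>_ _. pt),
    assoc = (\<lambda>_ _ _. pt),
    lunit = (\<lambda>_. pt),
    runit = (\<lambda>_. pt) \<rparr>"

end

theory Submission
  imports Defs
begin

text \<open>
  The coherence 1-cells \<open>(B \<times> C) \<times> D \<rightarrow> B \<times> (C \<times> D)\<close>,
  \<open>1 \<times> B \<rightarrow> B\<close> and \<open>B \<times> 1 \<rightarrow> B\<close> are rearrangements of
  tuples. They preserve the bicategory structure on the nose and have inverses of the same kind, so they
  are isomorphisms in the underlying category of \<open>Icon\<close>, not merely biequivalences. This is
  why the monoidal structure is strong.

  Three things have to be shown. First, \<open>Icon\<close> is a 2-category (\<open>two_category_Icon\<close>):
  composites of functors are functors, and since an icon has 2-cells as its components, icons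
  compose strictly; the interchange law is naturality of the components.
  Associativity of composition of functors is an honest equality because the constraints of a
  composite are \<open>G\<phi> \<bullet> \<psi>\<close> and 2-cells compose strictly associatively. Secondly,
  \<open>\<times>\<close> is a 2-functor (\<open>two_functor_cartesian_product\<close>): everything in a product is
  computed in each factor. Thirdly, the coherence 1-cells are 2-natural and satisfy the pentagon and the
  triangle. Functors with identity constraints that preserve all structure (\<open>strict_morphism\<close>)
  reduce this to equations between maps of cells: a composite or product of such functors is
  again one (\<open>comp_pfun_strict_pfun\<close>, \<open>prod_pfun_strict_pfun\<close>), and pasting one to a
  functor or an icon just relabels cells (\<open>strict_pfun_natural\<close>, \<open>strict_icon_natural\<close>).
  The equations then hold on each tuple of cells.
\<close>


section \<open>Calculating with cells by domain and codomain\<close>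

text \<open>
  The laws of the locales are indexed by hom-sets. Here they are restated with the domain and codomain
  of a cell as functions of the cell, so that the composability conditions can be
  discharged by rewriting. The rules \<open>hom_categoriesI\<close>, \<open>bicategoryI\<close> and
  \<open>two_categoryI\<close> go back, from laws of this form to the locales.
\<close>

context hom_categories
begin

lemma Ob_src [simp]: "f \<in> Arr B \<Longrightarrow> src B f \<in> Ob B"
  and Ob_trg [simp]: "f \<in> Arr B \<Longrightarrow> trg B f \<in> Ob B"
  using src_trg by auto

lemma Arr_dm [simp]: "\<alpha> \<in> Cell B \<Longrightarrow> dm B \<alpha> \<in> Arr B"
  and Arr_cd [simp]: "\<alpha> \<in> Cell B \<Longrightarrow> cd B \<alpha> \<in> Arr B"
  using dm_cd by auto

lemma src_cd [simp]: "\<alpha> \<in> Cell B \<Longrightarrow> src B (cd B \<alpha>) = src B (dm B \<alpha>)"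
  and trg_cd [simp]: "\<alpha> \<in> Cell B \<Longrightarrow> trg B (cd B \<alpha>) = trg B (dm B \<alpha>)"
  using parallel by auto

lemma Cell_id2 [simp]: "f \<in> Arr B \<Longrightarrow> id2 B f \<in> Cell B"
  and dm_id2 [simp]: "f \<in> Arr B \<Longrightarrow> dm B (id2 B f) = f"
  and cd_id2 [simp]: "f \<in> Arr B \<Longrightarrow> cd B (id2 B f) = f"
  using id2_hom by (auto simp: hom2_def)

lemma Cell_vc [simp]:
    "\<lbrakk>\<beta> \<in> Cell B; \<alpha> \<in> Cell B; dm B \<beta> = cd B \<alpha>\<rbrakk> \<Longrightarrow> \<beta> \<bullet> \<alpha> \<in> Cell B"
  and dm_vc [simp]:
    "\<lbrakk>\<beta> \<in> Cell B; \<alpha> \<in> Cell B; dm B \<beta> = cd B \<alpha>\<rbrakk> \<Longrightarrow> dm B (\<beta> \<bullet> \<alpha>) = dm B \<alpha>"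
  and cd_vc [simp]:
    "\<lbrakk>\<beta> \<in> Cell B; \<alpha> \<in> Cell B; dm B \<beta> = cd B \<alpha>\<rbrakk> \<Longrightarrow> cd B (\<beta> \<bullet> \<alpha>) = cd B \<beta>"
  using vc_hom[of \<alpha> "dm B \<alpha>" "cd B \<alpha>" \<beta> "cd B \<beta>"] by (auto simp: hom2_def)

lemma vc_vc:
  "\<lbrakk>\<gamma> \<in> Cell B; \<beta> \<in> Cell B; \<alpha> \<in> Cell B; dm B \<gamma> = cd B \<beta>; dm B \<beta> = cd B \<alpha>\<rbrakk> \<Longrightarrow>
    \<gamma> \<bullet> \<beta> \<bullet> \<alpha> = \<gamma> \<bullet> (\<beta> \<bullet> \<alpha>)"
  using vc_assoc by (auto simp: hom2_def)

lemma id2_vc [simp]: "\<lbrakk>\<alpha> \<in> Cell B; cd B \<alpha> = f\<rbrakk> \<Longrightarrow> id2 B f \<bullet> \<alpha> = \<alpha>"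
  and vc_id2 [simp]: "\<lbrakk>\<alpha> \<in> Cell B; dm B \<alpha> = f\<rbrakk> \<Longrightarrow> \<alpha> \<bullet> id2 B f = \<alpha>"
  using vc_id_left[of \<alpha> "dm B \<alpha>" f] vc_id_right[of \<alpha> f "cd B \<alpha>"] by (auto simp: hom2_def)

lemma Arr_unit1 [simp]: "a \<in> Ob B \<Longrightarrow> unit1 B a \<in> Arr B"
  and src_unit1 [simp]: "a \<in> Ob B \<Longrightarrow> src B (unit1 B a) = a"
  and trg_unit1 [simp]: "a \<in> Ob B \<Longrightarrow> trg B (unit1 B a) = a"
  using unit1_hom by (auto simp: hom1_def)

lemma Arr_hc1 [simp]:
    "\<lbrakk>f \<in> Arr B; g \<in> Arr B; src B f = trg B g\<rbrakk> \<Longrightarrow> f \<star> g \<in> Arr B"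
  and src_hc1 [simp]:
    "\<lbrakk>f \<in> Arr B; g \<in> Arr B; src B f = trg B g\<rbrakk> \<Longrightarrow> src B (f \<star> g) = src B g"
  and trg_hc1 [simp]:
    "\<lbrakk>f \<in> Arr B; g \<in> Arr B; src B f = trg B g\<rbrakk> \<Longrightarrow> trg B (f \<star> g) = trg B f"
  using hc1_hom[of f "trg B g" "trg B f" g "src B g"] by (auto simp: hom1_def)

lemma Cell_hc2 [simp]:
    "\<lbrakk>\<alpha> \<in> Cell B; \<beta> \<in> Cell B; src B (dm B \<alpha>) = trg B (dm B \<beta>)\<rbrakk> \<Longrightarrow> \<alpha> \<Zstar> \<beta> \<in> Cell B"
  and dm_hc2 [simp]:
    "\<lbrakk>\<alpha> \<in> Cell B; \<beta> \<in> Cell B; src B (dm B \<alpha>) = trg B (dm B \<beta>)\<rbrakk> \<Longrightarrow>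
      dm B (\<alpha> \<Zstar> \<beta>) = dm B \<alpha> \<star> dm B \<beta>"
  and cd_hc2 [simp]:
    "\<lbrakk>\<alpha> \<in> Cell B; \<beta> \<in> Cell B; src B (dm B \<alpha>) = trg B (dm B \<beta>)\<rbrakk> \<Longrightarrow>
      cd B (\<alpha> \<Zstar> \<beta>) = cd B \<alpha> \<star> cd B \<beta>"
  using hc2_hom[of \<alpha> "dm B \<alpha>" "cd B \<alpha>" \<beta> "dm B \<beta>" "cd B \<beta>"] by (auto simp: hom2_def)

lemma hc2_vc:
  "\<lbrakk>\<alpha>' \<in> Cell B; \<alpha> \<in> Cell B; \<beta>' \<in> Cell B; \<beta> \<in> Cell B; dm B \<alpha>' = cd B \<alpha>; dm B \<beta>' = cd B \<beta>;
     src B (dm B \<alpha>) = trg B (dm B \<beta>)\<rbrakk> \<Longrightarrow>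
   (\<alpha>' \<bullet> \<alpha>) \<Zstar> (\<beta>' \<bullet> \<beta>) = (\<alpha>' \<Zstar> \<beta>') \<bullet> (\<alpha> \<Zstar> \<beta>)"
  using interchange by (auto simp: hom2_def)

lemma iso2_Cell: "iso2 B \<alpha> \<Longrightarrow> \<alpha> \<in> Cell B"
  by (simp add: iso2_def)

lemma iso2I:
  "\<lbrakk>\<alpha> \<in> Cell B; \<beta> \<in> Cell B; dm B \<beta> = cd B \<alpha>; cd B \<beta> = dm B \<alpha>;
    \<beta> \<bullet> \<alpha> = id2 B (dm B \<alpha>); \<alpha> \<bullet> \<beta> = id2 B (cd B \<alpha>)\<rbrakk> \<Longrightarrow> iso2 B \<alpha>"
  by (auto simp: iso2_def hom2_def)

lemma iso2E:
  assumes "iso2 B \<alpha>"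
  obtains \<beta> where "\<alpha> \<in> Cell B" "\<beta> \<in> Cell B" "dm B \<beta> = cd B \<alpha>" "cd B \<beta> = dm B \<alpha>"
    "\<beta> \<bullet> \<alpha> = id2 B (dm B \<alpha>)" "\<alpha> \<bullet> \<beta> = id2 B (cd B \<alpha>)"
  using assms by (auto simp: iso2_def hom2_def)

lemma iso2_id2 [simp]: "f \<in> Arr B \<Longrightarrow> iso2 B (id2 B f)"
  by (rule iso2I[of _ "id2 B f"]) simp_all

lemma iso2_vc:
  assumes "iso2 B \<beta>" "iso2 B \<alpha>" "dm B \<beta> = cd B \<alpha>"
  shows "iso2 B (\<beta> \<bullet> \<alpha>)"
proof -
  obtain \<beta>' where \<beta>: "\<beta> \<in> Cell B" "\<beta>' \<in> Cell B" "dm B \<beta>' = cd B \<beta>" "cd B \<beta>' = dm B \<beta>"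
    "\<beta>' \<bullet> \<beta> = id2 B (dm B \<beta>)" "\<beta> \<bullet> \<beta>' = id2 B (cd B \<beta>)"
    using assms(1) by (rule iso2E)
  obtain \<alpha>' where \<alpha>: "\<alpha> \<in> Cell B" "\<alpha>' \<in> Cell B" "dm B \<alpha>' = cd B \<alpha>" "cd B \<alpha>' = dm B \<alpha>"
    "\<alpha>' \<bullet> \<alpha> = id2 B (dm B \<alpha>)" "\<alpha> \<bullet> \<alpha>' = id2 B (cd B \<alpha>)"
    using assms(2) by (rule iso2E)
  have "(\<alpha>' \<bullet> \<beta>') \<bullet> (\<beta> \<bullet> \<alpha>) = \<alpha>' \<bullet> ((\<beta>' \<bullet> \<beta>) \<bullet> \<alpha>)"
    using \<alpha>(1-4) \<beta>(1-4) assms(3) by (simp add: vc_vc)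
  also have "\<dots> = id2 B (dm B \<alpha>)"
    using \<alpha> \<beta>(5) assms(3) by simp
  finally have 1: "(\<alpha>' \<bullet> \<beta>') \<bullet> (\<beta> \<bullet> \<alpha>) = id2 B (dm B \<alpha>)" .
  have "(\<beta> \<bullet> \<alpha>) \<bullet> (\<alpha>' \<bullet> \<beta>') = \<beta> \<bullet> ((\<alpha> \<bullet> \<alpha>') \<bullet> \<beta>')"
    using \<alpha>(1-4) \<beta>(1-4) assms(3) by (simp add: vc_vc)
  also have "\<dots> = id2 B (cd B \<beta>)"
    using \<beta> \<alpha>(6) assms(3) by simp
  finally show ?thesis
    using 1 \<alpha>(1-4) \<beta>(1-4) assms(3) by (intro iso2I[of _ "\<alpha>' \<bullet> \<beta>'"]) simp_all
qed

end

lemma hom_categoriesI: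
  fixes B :: "('o, 'f, 't, 'm) cells_scheme" (structure)
  assumes "\<And>f. f \<in> Arr B \<Longrightarrow> src B f \<in> Ob B"
    and "\<And>f. f \<in> Arr B \<Longrightarrow> trg B f \<in> Ob B"
    and "\<And>\<alpha>. \<alpha> \<in> Cell B \<Longrightarrow> dm B \<alpha> \<in> Arr B"
    and "\<And>\<alpha>. \<alpha> \<in> Cell B \<Longrightarrow> cd B \<alpha> \<in> Arr B"
    and "\<And>\<alpha>. \<alpha> \<in> Cell B \<Longrightarrow> src B (cd B \<alpha>) = src B (dm B \<alpha>)"
    and "\<And>\<alpha>. \<alpha> \<in> Cell B \<Longrightarrow> trg B (cd B \<alpha>) = trg B (dm B \<alpha>)"
    and "\<And>f. f \<in> Arr B \<Longrightarrow> id2 B f \<in> Cell B \<and> dm B (id2 B f) = f \<and> cd B (id2 B f) = f"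
    and "\<And>\<beta> \<alpha>. \<lbrakk>\<beta> \<in> Cell B; \<alpha> \<in> Cell B; dm B \<beta> = cd B \<alpha>\<rbrakk> \<Longrightarrow>
      \<beta> \<bullet> \<alpha> \<in> Cell B \<and> dm B (\<beta> \<bullet> \<alpha>) = dm B \<alpha> \<and> cd B (\<beta> \<bullet> \<alpha>) = cd B \<beta>"
    and "\<And>\<gamma> \<beta> \<alpha>. \<lbrakk>\<gamma> \<in> Cell B; \<beta> \<in> Cell B; \<alpha> \<in> Cell B; dm B \<gamma> = cd B \<beta>; dm B \<beta> = cd B \<alpha>\<rbrakk> \<Longrightarrow>
      \<gamma> \<bullet> \<beta> \<bullet> \<alpha> = \<gamma> \<bullet> (\<beta> \<bullet> \<alpha>)"
    and "\<And>\<alpha>. \<alpha> \<in> Cell B \<Longrightarrow> id2 B (cd B \<alpha>) \<bullet> \<alpha> = \<alpha>"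
    and "\<And>\<alpha>. \<alpha> \<in> Cell B \<Longrightarrow> \<alpha> \<bullet> id2 B (dm B \<alpha>) = \<alpha>"
    and "\<And>a. a \<in> Ob B \<Longrightarrow>
      unit1 B a \<in> Arr B \<and> src B (unit1 B a) = a \<and> trg B (unit1 B a) = a"
    and "\<And>f g. \<lbrakk>f \<in> Arr B; g \<in> Arr B; src B f = trg B g\<rbrakk> \<Longrightarrow>
      f \<star> g \<in> Arr B \<and> src B (f \<star> g) = src B g \<and> trg B (f \<star> g) = trg B f"
    and "\<And>\<alpha> \<beta>. \<lbrakk>\<alpha> \<in> Cell B; \<beta> \<in> Cell B; src B (dm B \<alpha>) = trg B (dm B \<beta>)\<rbrakk> \<Longrightarrow>
      \<alpha> \<Zstar> \<beta> \<in> Cell B \<and> dm B (\<alpha> \<Zstar> \<beta>) = dm B \<alpha> \<star> dm B \<beta>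
        \<and> cd B (\<alpha> \<Zstar> \<beta>) = cd B \<alpha> \<star> cd B \<beta>"
    and "\<And>f g. \<lbrakk>f \<in> Arr B; g \<in> Arr B; src B f = trg B g\<rbrakk> \<Longrightarrow>
      id2 B f \<Zstar> id2 B g = id2 B (f \<star> g)"
    and "\<And>\<alpha>' \<alpha> \<beta>' \<beta>. \<lbrakk>\<alpha>' \<in> Cell B; \<alpha> \<in> Cell B; \<beta>' \<in> Cell B; \<beta> \<in> Cell B;
        dm B \<alpha>' = cd B \<alpha>; dm B \<beta>' = cd B \<beta>; src B (dm B \<alpha>) = trg B (dm B \<beta>)\<rbrakk> \<Longrightarrow>
      (\<alpha>' \<bullet> \<alpha>) \<Zstar> (\<beta>' \<bullet> \<beta>) = (\<alpha>' \<Zstar> \<beta>') \<bullet> (\<alpha> \<Zstar> \<beta>)"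
  shows "hom_categories B"
  by unfold_locales (use assms in \<open>auto simp: hom1_def hom2_def\<close>)

context bicategory
begin

lemma Cell_assoc [simp]:
    "\<lbrakk>f \<in> Arr B; g \<in> Arr B; h \<in> Arr B; src B f = trg B g; src B g = trg B h\<rbrakk> \<Longrightarrow>
      assoc B f g h \<in> Cell B"
  and dm_assoc [simp]:
    "\<lbrakk>f \<in> Arr B; g \<in> Arr B; h \<in> Arr B; src B f = trg B g; src B g = trg B h\<rbrakk> \<Longrightarrow>
      dm B (assoc B f g h) = f \<star> g \<star> h"
  and cd_assoc [simp]:
    "\<lbrakk>f \<in> Arr B; g \<in> Arr B; h \<in> Arr B; src B f = trg B g; src B g = trg B h\<rbrakk> \<Longrightarrow>
      cd B (assoc B f g h) = f \<star> (g \<star> h)"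
  and iso2_assoc:
    "\<lbrakk>f \<in> Arr B; g \<in> Arr B; h \<in> Arr B; src B f = trg B g; src B g = trg B h\<rbrakk> \<Longrightarrow>
      iso2 B (assoc B f g h)"
  using assoc_hom[of f "trg B g" "trg B f" g "trg B h" h "src B h"]
    assoc_iso[of f "trg B g" "trg B f" g "trg B h" h "src B h"]
  by (auto simp: hom1_def hom2_def)

lemma assoc_naturality:
  "\<lbrakk>\<alpha> \<in> Cell B; \<beta> \<in> Cell B; \<gamma> \<in> Cell B; src B (dm B \<alpha>) = trg B (dm B \<beta>);
      src B (dm B \<beta>) = trg B (dm B \<gamma>)\<rbrakk> \<Longrightarrow>
    assoc B (cd B \<alpha>) (cd B \<beta>) (cd B \<gamma>) \<bullet> (\<alpha> \<Zstar> \<beta> \<Zstar> \<gamma>)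
      = (\<alpha> \<Zstar> (\<beta> \<Zstar> \<gamma>)) \<bullet> assoc B (dm B \<alpha>) (dm B \<beta>) (dm B \<gamma>)"
  by (rule assoc_natural) (auto simp: hom2_def)

lemma Cell_lunit [simp]: "f \<in> Arr B \<Longrightarrow> lunit B f \<in> Cell B"
  and dm_lunit [simp]: "f \<in> Arr B \<Longrightarrow> dm B (lunit B f) = unit1 B (trg B f) \<star> f"
  and cd_lunit [simp]: "f \<in> Arr B \<Longrightarrow> cd B (lunit B f) = f"
  using lunit_hom[of f "src B f" "trg B f"] by (auto simp: hom1_def hom2_def)

lemma Cell_runit [simp]: "f \<in> Arr B \<Longrightarrow> runit B f \<in> Cell B"
  and dm_runit [simp]: "f \<in> Arr B \<Longrightarrow> dm B (runit B f) = f \<star> unit1 B (src B f)"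
  and cd_runit [simp]: "f \<in> Arr B \<Longrightarrow> cd B (runit B f) = f"
  using runit_hom[of f "src B f" "trg B f"] by (auto simp: hom1_def hom2_def)

lemma lunit_naturality:
  "\<alpha> \<in> Cell B \<Longrightarrow>
    lunit B (cd B \<alpha>) \<bullet> (id2 B (unit1 B (trg B (dm B \<alpha>))) \<Zstar> \<alpha>) = \<alpha> \<bullet> lunit B (dm B \<alpha>)"
  by (rule lunit_natural) (auto simp: hom2_def)

lemma runit_naturality:
  "\<alpha> \<in> Cell B \<Longrightarrow>
    runit B (cd B \<alpha>) \<bullet> (\<alpha> \<Zstar> id2 B (unit1 B (src B (dm B \<alpha>)))) = \<alpha> \<bullet> runit B (dm B \<alpha>)"
  by (rule runit_natural) (auto simp: hom2_def)

lemma pentagon':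
  "\<lbrakk>f \<in> Arr B; g \<in> Arr B; h \<in> Arr B; k \<in> Arr B; src B f = trg B g; src B g = trg B h;
      src B h = trg B k\<rbrakk> \<Longrightarrow>
    (id2 B f \<Zstar> assoc B g h k) \<bullet> assoc B f (g \<star> h) k \<bullet> (assoc B f g h \<Zstar> id2 B k)
      = assoc B f g (h \<star> k) \<bullet> assoc B (f \<star> g) h k"
  by (rule pentagon) (auto simp: hom1_def)

lemma triangle':
  "\<lbrakk>f \<in> Arr B; g \<in> Arr B; src B f = trg B g\<rbrakk> \<Longrightarrow>
    (id2 B f \<Zstar> lunit B g) \<bullet> assoc B f (unit1 B (src B f)) g = runit B f \<Zstar> id2 B g"
  by (rule triangle) (auto simp: hom1_def)

end

lemma bicategoryI:
  fixes B :: "('o, 'f, 't, 'm) bicat_scheme" (structure)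
  assumes "hom_categories B"
    and "\<And>f g h. \<lbrakk>f \<in> Arr B; g \<in> Arr B; h \<in> Arr B; src B f = trg B g; src B g = trg B h\<rbrakk> \<Longrightarrow>
      assoc B f g h \<in> Cell B \<and> dm B (assoc B f g h) = f \<star> g \<star> h
        \<and> cd B (assoc B f g h) = f \<star> (g \<star> h) \<and> iso2 B (assoc B f g h)"
    and "\<And>\<alpha> \<beta> \<gamma>. \<lbrakk>\<alpha> \<in> Cell B; \<beta> \<in> Cell B; \<gamma> \<in> Cell B; src B (dm B \<alpha>) = trg B (dm B \<beta>);
        src B (dm B \<beta>) = trg B (dm B \<gamma>)\<rbrakk> \<Longrightarrow>
      assoc B (cd B \<alpha>) (cd B \<beta>) (cd B \<gamma>) \<bullet> (\<alpha> \<Zstar> \<beta> \<Zstar> \<gamma>)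
        = (\<alpha> \<Zstar> (\<beta> \<Zstar> \<gamma>)) \<bullet> assoc B (dm B \<alpha>) (dm B \<beta>) (dm B \<gamma>)"
    and "\<And>f. f \<in> Arr B \<Longrightarrow> lunit B f \<in> Cell B \<and> dm B (lunit B f) = unit1 B (trg B f) \<star> f
      \<and> cd B (lunit B f) = f \<and> iso2 B (lunit B f)"
    and "\<And>\<alpha>. \<alpha> \<in> Cell B \<Longrightarrow>
      lunit B (cd B \<alpha>) \<bullet> (id2 B (unit1 B (trg B (dm B \<alpha>))) \<Zstar> \<alpha>) = \<alpha> \<bullet> lunit B (dm B \<alpha>)"
    and "\<And>f. f \<in> Arr B \<Longrightarrow> runit B f \<in> Cell B \<and> dm B (runit B f) = f \<star> unit1 B (src B f)
      \<and> cd B (runit B f) = f \<and> iso2 B (runit B f)"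
    and "\<And>\<alpha>. \<alpha> \<in> Cell B \<Longrightarrow>
      runit B (cd B \<alpha>) \<bullet> (\<alpha> \<Zstar> id2 B (unit1 B (src B (dm B \<alpha>)))) = \<alpha> \<bullet> runit B (dm B \<alpha>)"
    and "\<And>f g h k. \<lbrakk>f \<in> Arr B; g \<in> Arr B; h \<in> Arr B; k \<in> Arr B; src B f = trg B g;
        src B g = trg B h; src B h = trg B k\<rbrakk> \<Longrightarrow>
      (id2 B f \<Zstar> assoc B g h k) \<bullet> assoc B f (g \<star> h) k \<bullet> (assoc B f g h \<Zstar> id2 B k)
        = assoc B f g (h \<star> k) \<bullet> assoc B (f \<star> g) h k"
    and "\<And>f g b. \<lbrakk>f \<in> Arr B; g \<in> Arr B; src B f = b; trg B g = b\<rbrakk> \<Longrightarrow>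
      (id2 B f \<Zstar> lunit B g) \<bullet> assoc B f (unit1 B b) g = runit B f \<Zstar> id2 B g"
  shows "bicategory B"
proof -
  interpret hom_categories B by fact
  show ?thesis
    by unfold_locales (use assms in \<open>auto simp: hom1_def hom2_def\<close>)
qed

context two_category
begin

lemma hc1_hc1:
    "\<lbrakk>f \<in> Arr A; g \<in> Arr A; h \<in> Arr A; src A f = trg A g; src A g = trg A h\<rbrakk> \<Longrightarrow>
      f \<star> g \<star> h = f \<star> (g \<star> h)"
  and unit1_hc1 [simp]: "\<lbrakk>f \<in> Arr A; trg A f = b\<rbrakk> \<Longrightarrow> unit1 A b \<star> f = f"
  and hc1_unit1 [simp]: "\<lbrakk>f \<in> Arr A; src A f = b\<rbrakk> \<Longrightarrow> f \<star> unit1 A b = f"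
  using hc1_assoc[of f "trg A g" "trg A f" g "trg A h" h "src A h"]
    hc1_unit_left[of f "src A f" "trg A f"] hc1_unit_right[of f "src A f" "trg A f"]
  by (auto simp: hom1_def)

lemma hc2_hc2:
    "\<lbrakk>\<alpha> \<in> Cell A; \<beta> \<in> Cell A; \<gamma> \<in> Cell A; src A (dm A \<alpha>) = trg A (dm A \<beta>);
        src A (dm A \<beta>) = trg A (dm A \<gamma>)\<rbrakk> \<Longrightarrow>
      \<alpha> \<Zstar> \<beta> \<Zstar> \<gamma> = \<alpha> \<Zstar> (\<beta> \<Zstar> \<gamma>)"
  and unit1_hc2 [simp]:
    "\<lbrakk>\<alpha> \<in> Cell A; trg A (dm A \<alpha>) = b\<rbrakk> \<Longrightarrow> id2 A (unit1 A b) \<Zstar> \<alpha> = \<alpha>"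
  and hc2_unit1 [simp]:
    "\<lbrakk>\<alpha> \<in> Cell A; src A (dm A \<alpha>) = b\<rbrakk> \<Longrightarrow> \<alpha> \<Zstar> id2 A (unit1 A b) = \<alpha>"
  using hc2_assoc[of \<alpha> "dm A \<alpha>" "cd A \<alpha>" \<beta> "dm A \<beta>" "cd A \<beta>" \<gamma> "dm A \<gamma>" "cd A \<gamma>"]
    hc2_unit_left[of \<alpha> "dm A \<alpha>" "cd A \<alpha>"] hc2_unit_right[of \<alpha> "dm A \<alpha>" "cd A \<alpha>"]
  by (auto simp: hom2_def)

end

lemma two_categoryI:
  fixes A :: "('o, 'f, 't, 'm) cells_scheme" (structure)
  assumes "hom_categories A"
    and "\<And>f g h. \<lbrakk>f \<in> Arr A; g \<in> Arr A; h \<in> Arr A; src A f = trg A g; src A g = trg A h\<rbrakk> \<Longrightarrow>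
      f \<star> g \<star> h = f \<star> (g \<star> h)"
    and "\<And>f. f \<in> Arr A \<Longrightarrow> unit1 A (trg A f) \<star> f = f"
    and "\<And>f. f \<in> Arr A \<Longrightarrow> f \<star> unit1 A (src A f) = f"
    and "\<And>\<alpha> \<beta> \<gamma>. \<lbrakk>\<alpha> \<in> Cell A; \<beta> \<in> Cell A; \<gamma> \<in> Cell A; src A (dm A \<alpha>) = trg A (dm A \<beta>);
        src A (dm A \<beta>) = trg A (dm A \<gamma>)\<rbrakk> \<Longrightarrow>
      \<alpha> \<Zstar> \<beta> \<Zstar> \<gamma> = \<alpha> \<Zstar> (\<beta> \<Zstar> \<gamma>)"
    and "\<And>\<alpha>. \<alpha> \<in> Cell A \<Longrightarrow> id2 A (unit1 A (trg A (dm A \<alpha>))) \<Zstar> \<alpha> = \<alpha>"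
    and "\<And>\<alpha>. \<alpha> \<in> Cell A \<Longrightarrow> \<alpha> \<Zstar> id2 A (unit1 A (src A (dm A \<alpha>))) = \<alpha>"
  shows "two_category A"
proof -
  interpret hom_categories A by fact
  show ?thesis
    by unfold_locales (use assms in \<open>auto simp: hom1_def hom2_def\<close>)
qed


section \<open>Composition of functors and icons\<close>

context pseudofunctor
begin

lemma Src [simp]: "Src F = B"
  and Trg [simp]: "Trg F = C"
  using Src_Trg by auto

declare on0_in [simp] on2_id2 [simp]

lemma Arr_on1 [simp]: "f \<in> Arr B \<Longrightarrow> on1 F f \<in> Arr C"
  and src_on1 [simp]: "f \<in> Arr B \<Longrightarrow> src C (on1 F f) = on0 F (src B f)"
  and trg_on1 [simp]: "f \<in> Arr B \<Longrightarrow> trg C (on1 F f) = on0 F (trg B f)"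
  using on1_hom[of f "src B f" "trg B f"] by (auto simp: hom1_def)

lemma Cell_on2 [simp]: "\<alpha> \<in> Cell B \<Longrightarrow> on2 F \<alpha> \<in> Cell C"
  and dm_on2 [simp]: "\<alpha> \<in> Cell B \<Longrightarrow> dm C (on2 F \<alpha>) = on1 F (dm B \<alpha>)"
  and cd_on2 [simp]: "\<alpha> \<in> Cell B \<Longrightarrow> cd C (on2 F \<alpha>) = on1 F (cd B \<alpha>)"
  using on2_hom[of \<alpha> "dm B \<alpha>" "cd B \<alpha>"] by (auto simp: hom2_def)

lemma on2_vc_eq:
  "\<lbrakk>\<beta> \<in> Cell B; \<alpha> \<in> Cell B; dm B \<beta> = cd B \<alpha>\<rbrakk> \<Longrightarrow>
    on2 F (\<beta> \<bullet>\<^bsub>B\<^esub> \<alpha>) = on2 F \<beta> \<bullet>\<^bsub>C\<^esub> on2 F \<alpha>"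
  by (rule on2_vc) (auto simp: hom2_def)

lemma Cell_phi0 [simp]: "a \<in> Ob B \<Longrightarrow> phi0 F a \<in> Cell C"
  and dm_phi0 [simp]: "a \<in> Ob B \<Longrightarrow> dm C (phi0 F a) = unit1 C (on0 F a)"
  and cd_phi0 [simp]: "a \<in> Ob B \<Longrightarrow> cd C (phi0 F a) = on1 F (unit1 B a)"
  using phi0_hom[of a] by (auto simp: hom2_def)

lemma Cell_phi2 [simp]:
    "\<lbrakk>f \<in> Arr B; g \<in> Arr B; src B f = trg B g\<rbrakk> \<Longrightarrow> phi2 F f g \<in> Cell C"
  and dm_phi2 [simp]:
    "\<lbrakk>f \<in> Arr B; g \<in> Arr B; src B f = trg B g\<rbrakk> \<Longrightarrow>
      dm C (phi2 F f g) = on1 F f \<star>\<^bsub>C\<^esub> on1 F g"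
  and cd_phi2 [simp]:
    "\<lbrakk>f \<in> Arr B; g \<in> Arr B; src B f = trg B g\<rbrakk> \<Longrightarrow>
      cd C (phi2 F f g) = on1 F (f \<star>\<^bsub>B\<^esub> g)"
  and iso2_phi2: "\<lbrakk>f \<in> Arr B; g \<in> Arr B; src B f = trg B g\<rbrakk> \<Longrightarrow> iso2 C (phi2 F f g)"
  using phi2_hom[of f "trg B g" "trg B f" g "src B g"]
    phi2_iso[of f "trg B g" "trg B f" g "src B g"] by (auto simp: hom1_def hom2_def)

lemma phi2_naturality:
  "\<lbrakk>\<alpha> \<in> Cell B; \<beta> \<in> Cell B; src B (dm B \<alpha>) = trg B (dm B \<beta>)\<rbrakk> \<Longrightarrow>
    phi2 F (cd B \<alpha>) (cd B \<beta>) \<bullet>\<^bsub>C\<^esub> (on2 F \<alpha> \<Zstar>\<^bsub>C\<^esub> on2 F \<beta>)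
      = on2 F (\<alpha> \<Zstar>\<^bsub>B\<^esub> \<beta>) \<bullet>\<^bsub>C\<^esub> phi2 F (dm B \<alpha>) (dm B \<beta>)"
  by (rule phi2_natural) (auto simp: hom2_def)

lemma phi2_associativity:
  "\<lbrakk>f \<in> Arr B; g \<in> Arr B; h \<in> Arr B; src B f = trg B g; src B g = trg B h\<rbrakk> \<Longrightarrow>
    on2 F (assoc B f g h) \<bullet>\<^bsub>C\<^esub> (phi2 F (f \<star>\<^bsub>B\<^esub> g) h
        \<bullet>\<^bsub>C\<^esub> (phi2 F f g \<Zstar>\<^bsub>C\<^esub> id2 C (on1 F h)))
      = phi2 F f (g \<star>\<^bsub>B\<^esub> h) \<bullet>\<^bsub>C\<^esub> ((id2 C (on1 F f) \<Zstar>\<^bsub>C\<^esub> phi2 F g h)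
        \<bullet>\<^bsub>C\<^esub> assoc C (on1 F f) (on1 F g) (on1 F h))"
  using phi2_assoc[of f "trg B g" "trg B f" g "trg B h" h "src B h"]
  by (simp add: hom1_def C.vc_vc)

lemma phi0_lunit:
  "f \<in> Arr B \<Longrightarrow>
    on2 F (lunit B f) \<bullet>\<^bsub>C\<^esub> (phi2 F (unit1 B (trg B f)) f
        \<bullet>\<^bsub>C\<^esub> (phi0 F (trg B f) \<Zstar>\<^bsub>C\<^esub> id2 C (on1 F f)))
      = lunit C (on1 F f)"
  using phi0_left[of f "src B f" "trg B f"]
  by (simp add: hom1_def C.vc_vc)

lemma phi0_runit:
  "f \<in> Arr B \<Longrightarrow>
    on2 F (runit B f) \<bullet>\<^bsub>C\<^esub> (phi2 F f (unit1 B (src B f))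
        \<bullet>\<^bsub>C\<^esub> (id2 C (on1 F f) \<Zstar>\<^bsub>C\<^esub> phi0 F (src B f)))
      = runit C (on1 F f)"
  using phi0_right[of f "src B f" "trg B f"]
  by (simp add: hom1_def C.vc_vc)

lemma iso2_on2:
  assumes "iso2 B \<alpha>"
  shows "iso2 C (on2 F \<alpha>)"
proof -
  obtain \<beta> where \<beta>: "\<alpha> \<in> Cell B" "\<beta> \<in> Cell B" "dm B \<beta> = cd B \<alpha>" "cd B \<beta> = dm B \<alpha>"
    "\<beta> \<bullet>\<^bsub>B\<^esub> \<alpha> = id2 B (dm B \<alpha>)" "\<alpha> \<bullet>\<^bsub>B\<^esub> \<beta> = id2 B (cd B \<alpha>)"
    using assms by (rule B.iso2E)
  then show ?thesis
    by (intro C.iso2I[of _ "on2 F \<beta>"]) (simp_all flip: on2_vc_eq)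
qed

end

lemma pseudofunctorI:
  assumes "bicategory B" "bicategory C" "Src F = B" "Trg F = C"
    and "\<And>a. a \<in> Ob B \<Longrightarrow> on0 F a \<in> Ob C"
    and "\<And>f. f \<in> Arr B \<Longrightarrow> on1 F f \<in> Arr C \<and> src C (on1 F f) = on0 F (src B f)
      \<and> trg C (on1 F f) = on0 F (trg B f)"
    and "\<And>\<alpha>. \<alpha> \<in> Cell B \<Longrightarrow> on2 F \<alpha> \<in> Cell C \<and> dm C (on2 F \<alpha>) = on1 F (dm B \<alpha>)
      \<and> cd C (on2 F \<alpha>) = on1 F (cd B \<alpha>)"
    and "\<And>f. f \<in> Arr B \<Longrightarrow> on2 F (id2 B f) = id2 C (on1 F f)"
    and "\<And>\<beta> \<alpha>. \<lbrakk>\<beta> \<in> Cell B; \<alpha> \<in> Cell B; dm B \<beta> = cd B \<alpha>\<rbrakk> \<Longrightarrow>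
      on2 F (\<beta> \<bullet>\<^bsub>B\<^esub> \<alpha>) = on2 F \<beta> \<bullet>\<^bsub>C\<^esub> on2 F \<alpha>"
    and "\<And>a. a \<in> Ob B \<Longrightarrow> dm C (phi0 F a) = unit1 C (on0 F a)
      \<and> cd C (phi0 F a) = on1 F (unit1 B a) \<and> iso2 C (phi0 F a)"
    and "\<And>f g. \<lbrakk>f \<in> Arr B; g \<in> Arr B; src B f = trg B g\<rbrakk> \<Longrightarrow>
      dm C (phi2 F f g) = on1 F f \<star>\<^bsub>C\<^esub> on1 F g
      \<and> cd C (phi2 F f g) = on1 F (f \<star>\<^bsub>B\<^esub> g) \<and> iso2 C (phi2 F f g)"
    and "\<And>\<alpha> \<beta>. \<lbrakk>\<alpha> \<in> Cell B; \<beta> \<in> Cell B; src B (dm B \<alpha>) = trg B (dm B \<beta>)\<rbrakk> \<Longrightarrow>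
      phi2 F (cd B \<alpha>) (cd B \<beta>) \<bullet>\<^bsub>C\<^esub> (on2 F \<alpha> \<Zstar>\<^bsub>C\<^esub> on2 F \<beta>)
        = on2 F (\<alpha> \<Zstar>\<^bsub>B\<^esub> \<beta>) \<bullet>\<^bsub>C\<^esub> phi2 F (dm B \<alpha>) (dm B \<beta>)"
    and "\<And>f g h. \<lbrakk>f \<in> Arr B; g \<in> Arr B; h \<in> Arr B; src B f = trg B g; src B g = trg B h\<rbrakk> \<Longrightarrow>
      on2 F (assoc B f g h) \<bullet>\<^bsub>C\<^esub> (phi2 F (f \<star>\<^bsub>B\<^esub> g) h
          \<bullet>\<^bsub>C\<^esub> (phi2 F f g \<Zstar>\<^bsub>C\<^esub> id2 C (on1 F h)))
        = phi2 F f (g \<star>\<^bsub>B\<^esub> h) \<bullet>\<^bsub>C\<^esub> ((id2 C (on1 F f) \<Zstar>\<^bsub>C\<^esub> phi2 F g h)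
          \<bullet>\<^bsub>C\<^esub> assoc C (on1 F f) (on1 F g) (on1 F h))"
    and "\<And>f. f \<in> Arr B \<Longrightarrow>
      on2 F (lunit B f) \<bullet>\<^bsub>C\<^esub> (phi2 F (unit1 B (trg B f)) f
          \<bullet>\<^bsub>C\<^esub> (phi0 F (trg B f) \<Zstar>\<^bsub>C\<^esub> id2 C (on1 F f)))
        = lunit C (on1 F f)"
    and "\<And>f. f \<in> Arr B \<Longrightarrow>
      on2 F (runit B f) \<bullet>\<^bsub>C\<^esub> (phi2 F f (unit1 B (src B f))
          \<bullet>\<^bsub>C\<^esub> (id2 C (on1 F f) \<Zstar>\<^bsub>C\<^esub> phi0 F (src B f)))
        = runit C (on1 F f)"
  shows "pseudofunctor B C F"
proof -
  interpret B: bicategory B by fact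
  interpret C: bicategory C by fact
  have [simp]: "a \<in> Ob B \<Longrightarrow> phi0 F a \<in> Cell C"
    "\<lbrakk>f \<in> Arr B; g \<in> Arr B; src B f = trg B g\<rbrakk> \<Longrightarrow> phi2 F f g \<in> Cell C" for a f g
    using assms(10,11) C.iso2_Cell by blast+
  show ?thesis
    by unfold_locales (use assms(3-) in \<open>auto simp: hom1_def hom2_def C.vc_vc\<close>)
qed

text \<open>
  Outside the cells of the source a functor fixed by \<^const>\<open>trim_pfun\<close> carries no information,
  so its equality can be tested on cells. Similarly for icons.
\<close>

lemma pfun_eqI:
  assumes "trim_pfun F = F" "trim_pfun G = G" "Src F = Src G" "Trg F = Trg G"
    and "\<And>a. a \<in> Ob (Src G) \<Longrightarrow> on0 F a = on0 G a"
    and "\<And>f. f \<in> Arr (Src G) \<Longrightarrow> on1 F f = on1 G f"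
    and "\<And>\<alpha>. \<alpha> \<in> Cell (Src G) \<Longrightarrow> on2 F \<alpha> = on2 G \<alpha>"
    and "\<And>a. a \<in> Ob (Src G) \<Longrightarrow> phi0 F a = phi0 G a"
    and "\<And>f g. \<lbrakk>f \<in> Arr (Src G); g \<in> Arr (Src G); src (Src G) f = trg (Src G) g\<rbrakk> \<Longrightarrow>
      phi2 F f g = phi2 G f g"
  shows "F = G"
proof -
  have "trim_pfun F = trim_pfun G"
    using assms(3-) by (auto simp: trim_pfun_def fun_eq_iff restrict_def)
  then show ?thesis
    using assms(1,2) by simp
qed

lemma icon_eqI:
  assumes "trim_icon \<alpha> = \<alpha>" "trim_icon \<beta> = \<beta>" "Dom \<alpha> = Dom \<beta>" "Cod \<alpha> = Cod \<beta>"
    and "\<And>f. f \<in> Arr (Src (Dom \<beta>)) \<Longrightarrow> component \<alpha> f = component \<beta> f"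
  shows "\<alpha> = \<beta>"
proof -
  have "trim_icon \<alpha> = trim_icon \<beta>"
    using assms(3-) by (auto simp: trim_icon_def fun_eq_iff restrict_def)
  then show ?thesis
    using assms(1,2) by simp
qed

lemma trim_pfun_idem [simp]: "trim_pfun (trim_pfun F) = trim_pfun F"
  by (simp add: trim_pfun_def fun_eq_iff restrict_def)

lemma trim_icon_idem [simp]: "trim_icon (trim_icon \<alpha>) = trim_icon \<alpha>"
  by (simp add: trim_icon_def)

text \<open>
  The functor with identity constraints given by maps of objects, 1-cells and 2-cells. The constraints
  have the right codomain only if the maps preserve units and composition, as in the locale below.
  Identity functors and all the coherence 1-cells are of this form.
\<close>

definition strict_pfun :: "('o, 'f, 't) bicat \<Rightarrow> ('p, 'g, 's) bicat \<Rightarrow>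
    ('o \<Rightarrow> 'p) \<Rightarrow> ('f \<Rightarrow> 'g) \<Rightarrow> ('t \<Rightarrow> 's) \<Rightarrow> ('o, 'f, 't, 'p, 'g, 's) pfun" where
  "strict_pfun B C p q r = trim_pfun \<lparr>
    Src = B,
    Trg = C,
    on0 = p,
    on1 = q,
    on2 = r,
    phi0 = (\<lambda>a. id2 C (unit1 C (p a))),
    phi2 = (\<lambda>f g. id2 C (hc1 C (q f) (q g))) \<rparr>"

lemma strict_pfun_simps [simp]:
  "Src (strict_pfun B C p q r) = B"
  "Trg (strict_pfun B C p q r) = C"
  "trim_pfun (strict_pfun B C p q r) = strict_pfun B C p q r"
  "a \<in> Ob B \<Longrightarrow> on0 (strict_pfun B C p q r) a = p a"
  "f \<in> Arr B \<Longrightarrow> on1 (strict_pfun B C p q r) f = q f"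
  "\<alpha> \<in> Cell B \<Longrightarrow> on2 (strict_pfun B C p q r) \<alpha> = r \<alpha>"
  "a \<in> Ob B \<Longrightarrow> phi0 (strict_pfun B C p q r) a = id2 C (unit1 C (p a))"
  "\<lbrakk>f \<in> Arr B; g \<in> Arr B; src B f = trg B g\<rbrakk> \<Longrightarrow>
    phi2 (strict_pfun B C p q r) f g = id2 C (q f \<star>\<^bsub>C\<^esub> q g)"
  by (simp_all add: strict_pfun_def) (simp_all add: trim_pfun_def)

text \<open>
  Maps of objects, 1-cells and 2-cells that preserve the whole structure of a bicategory, including
  units, composition, associators and unitors, on the nose.
\<close>

locale strict_morphism = B: bicategory B + C: bicategory C
  for B :: "('o, 'f, 't) bicat" and C :: "('p, 'g, 's) bicat" +
  fixes p :: "'o \<Rightarrow> 'p" and q :: "'f \<Rightarrow> 'g" and r :: "'t \<Rightarrow> 's"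
  assumes Ob_p [simp]: "a \<in> Ob B \<Longrightarrow> p a \<in> Ob C"
    and Arr_q [simp]: "f \<in> Arr B \<Longrightarrow> q f \<in> Arr C"
    and src_q [simp]: "f \<in> Arr B \<Longrightarrow> src C (q f) = p (src B f)"
    and trg_q [simp]: "f \<in> Arr B \<Longrightarrow> trg C (q f) = p (trg B f)"
    and Cell_r [simp]: "\<alpha> \<in> Cell B \<Longrightarrow> r \<alpha> \<in> Cell C"
    and dm_r [simp]: "\<alpha> \<in> Cell B \<Longrightarrow> dm C (r \<alpha>) = q (dm B \<alpha>)"
    and cd_r [simp]: "\<alpha> \<in> Cell B \<Longrightarrow> cd C (r \<alpha>) = q (cd B \<alpha>)"
    and r_id2 [simp]: "f \<in> Arr B \<Longrightarrow> r (id2 B f) = id2 C (q f)"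
    and r_vc [simp]: "\<lbrakk>\<beta> \<in> Cell B; \<alpha> \<in> Cell B; dm B \<beta> = cd B \<alpha>\<rbrakk> \<Longrightarrow>
      r (\<beta> \<bullet>\<^bsub>B\<^esub> \<alpha>) = r \<beta> \<bullet>\<^bsub>C\<^esub> r \<alpha>"
    and q_unit1 [simp]: "a \<in> Ob B \<Longrightarrow> q (unit1 B a) = unit1 C (p a)"
    and q_hc1 [simp]: "\<lbrakk>f \<in> Arr B; g \<in> Arr B; src B f = trg B g\<rbrakk> \<Longrightarrow>
      q (f \<star>\<^bsub>B\<^esub> g) = q f \<star>\<^bsub>C\<^esub> q g"
    and r_hc2 [simp]: "\<lbrakk>\<alpha> \<in> Cell B; \<beta> \<in> Cell B; src B (dm B \<alpha>) = trg B (dm B \<beta>)\<rbrakk> \<Longrightarrow>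
      r (\<alpha> \<Zstar>\<^bsub>B\<^esub> \<beta>) = r \<alpha> \<Zstar>\<^bsub>C\<^esub> r \<beta>"
    and r_assoc [simp]:
      "\<lbrakk>f \<in> Arr B; g \<in> Arr B; h \<in> Arr B; src B f = trg B g; src B g = trg B h\<rbrakk> \<Longrightarrow>
        r (assoc B f g h) = assoc C (q f) (q g) (q h)"
    and r_lunit [simp]: "f \<in> Arr B \<Longrightarrow> r (lunit B f) = lunit C (q f)"
    and r_runit [simp]: "f \<in> Arr B \<Longrightarrow> r (runit B f) = runit C (q f)"

sublocale strict_morphism \<subseteq> pseudofunctor B C "strict_pfun B C p q r"
proof (rule pseudofunctorI)
  show "bicategory B" "bicategory C"
    by unfold_locales
qed (simp_all add: C.hc2_id2)

lemma comp_pfun_simps [simp]: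
  "Src (comp_pfun G F) = Src F"
  "Trg (comp_pfun G F) = Trg G"
  "trim_pfun (comp_pfun G F) = comp_pfun G F"
  "a \<in> Ob (Src F) \<Longrightarrow> on0 (comp_pfun G F) a = on0 G (on0 F a)"
  "f \<in> Arr (Src F) \<Longrightarrow> on1 (comp_pfun G F) f = on1 G (on1 F f)"
  "\<alpha> \<in> Cell (Src F) \<Longrightarrow> on2 (comp_pfun G F) \<alpha> = on2 G (on2 F \<alpha>)"
  "a \<in> Ob (Src F) \<Longrightarrow>
    phi0 (comp_pfun G F) a = on2 G (phi0 F a) \<bullet>\<^bsub>Trg G\<^esub> phi0 G (on0 F a)"
  "\<lbrakk>f \<in> Arr (Src F); g \<in> Arr (Src F); src (Src F) f = trg (Src F) g\<rbrakk> \<Longrightarrow>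
    phi2 (comp_pfun G F) f g
      = on2 G (phi2 F f g) \<bullet>\<^bsub>Trg G\<^esub> phi2 G (on1 F f) (on1 F g)"
  by (simp_all add: comp_pfun_def) (simp_all add: trim_pfun_def)

text \<open>
  A composable pair of functors \<open>F : B \<rightarrow> C\<close> and
  \<open>G : C \<rightarrow> D\<close>. That the composite is a functor is the usual pasting: the constraints of
  \<open>F\<close> are carried along by \<open>G\<close>, and the constraint of \<open>G\<close> is moved past
  the images of 2-cells of \<open>C\<close> by its naturality.
\<close>

locale composable_pseudofunctors = F: pseudofunctor B C F + G: pseudofunctor C D G
  for B :: "('o, 'f, 't) bicat" and C :: "('p, 'g, 's) bicat" and D :: "('q, 'h, 'r) bicat"
    and F G
begin

sublocale comp: pseudofunctor B D "comp_pfun G F"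
proof (rule pseudofunctorI)
  show "bicategory B" "bicategory D"
    by unfold_locales
  show "on2 (comp_pfun G F) (assoc B f g h) \<bullet>\<^bsub>D\<^esub> (phi2 (comp_pfun G F) (f \<star>\<^bsub>B\<^esub> g) h
          \<bullet>\<^bsub>D\<^esub> (phi2 (comp_pfun G F) f g \<Zstar>\<^bsub>D\<^esub> id2 D (on1 (comp_pfun G F) h)))
        = phi2 (comp_pfun G F) f (g \<star>\<^bsub>B\<^esub> h)
          \<bullet>\<^bsub>D\<^esub> ((id2 D (on1 (comp_pfun G F) f) \<Zstar>\<^bsub>D\<^esub> phi2 (comp_pfun G F) g h)
          \<bullet>\<^bsub>D\<^esub> assoc D (on1 (comp_pfun G F) f) (on1 (comp_pfun G F) g) (on1 (comp_pfun G F) h))"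
    if fgh: "f \<in> Arr B" "g \<in> Arr B" "h \<in> Arr B" "src B f = trg B g" "src B g = trg B h" for f g h
  proof -
    let ?GF = "comp_pfun G F"
    let ?f = "on1 F f" and ?g = "on1 F g" and ?h = "on1 F h"
    have "phi2 ?GF (f \<star>\<^bsub>B\<^esub> g) h \<bullet>\<^bsub>D\<^esub> (phi2 ?GF f g \<Zstar>\<^bsub>D\<^esub> id2 D (on1 G ?h))
      = on2 G (phi2 F (f \<star>\<^bsub>B\<^esub> g) h) \<bullet>\<^bsub>D\<^esub> (phi2 G (on1 F (f \<star>\<^bsub>B\<^esub> g)) ?h
          \<bullet>\<^bsub>D\<^esub> (on2 G (phi2 F f g) \<Zstar>\<^bsub>D\<^esub> on2 G (id2 C ?h)))
          \<bullet>\<^bsub>D\<^esub> (phi2 G ?f ?g \<Zstar>\<^bsub>D\<^esub> id2 D (on1 G ?h))"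
      using fgh
        G.C.hc2_vc[of "on2 G (phi2 F f g)" "phi2 G ?f ?g" "id2 D (on1 G ?h)" "id2 D (on1 G ?h)"]
      by (simp add: G.C.vc_vc)
    \<comment> \<open>naturality of the constraint of \<open>G\<close>, with respect to that of \<open>F\<close>\<close>
    also have "phi2 G (on1 F (f \<star>\<^bsub>B\<^esub> g)) ?h \<bullet>\<^bsub>D\<^esub> (on2 G (phi2 F f g) \<Zstar>\<^bsub>D\<^esub> on2 G (id2 C ?h))
      = on2 G (phi2 F f g \<Zstar>\<^bsub>C\<^esub> id2 C ?h) \<bullet>\<^bsub>D\<^esub> phi2 G (?f \<star>\<^bsub>C\<^esub> ?g) ?h"
      using fgh G.phi2_naturality[of "phi2 F f g" "id2 C ?h"] by simp
    finally have "on2 G (on2 F (assoc B f g h)) \<bullet>\<^bsub>D\<^esub> (phi2 ?GF (f \<star>\<^bsub>B\<^esub> g) h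
          \<bullet>\<^bsub>D\<^esub> (phi2 ?GF f g \<Zstar>\<^bsub>D\<^esub> id2 D (on1 G ?h)))
      = on2 G (on2 F (assoc B f g h) \<bullet>\<^bsub>C\<^esub> (phi2 F (f \<star>\<^bsub>B\<^esub> g) h
          \<bullet>\<^bsub>C\<^esub> (phi2 F f g \<Zstar>\<^bsub>C\<^esub> id2 C ?h)))
        \<bullet>\<^bsub>D\<^esub> (phi2 G (?f \<star>\<^bsub>C\<^esub> ?g) ?h \<bullet>\<^bsub>D\<^esub> (phi2 G ?f ?g \<Zstar>\<^bsub>D\<^esub> id2 D (on1 G ?h)))"
      using fgh by (simp add: G.on2_vc_eq G.C.vc_vc)
    \<comment> \<open>the image under \<open>G\<close> of the associativity of \<open>F\<close>\<close>
    also have "\<dots> = on2 G (phi2 F f (g \<star>\<^bsub>B\<^esub> h)) \<bullet>\<^bsub>D\<^esub> (on2 G (id2 C ?f \<Zstar>\<^bsub>C\<^esub> phi2 F g h)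
        \<bullet>\<^bsub>D\<^esub> (on2 G (assoc C ?f ?g ?h) \<bullet>\<^bsub>D\<^esub> (phi2 G (?f \<star>\<^bsub>C\<^esub> ?g) ?h
          \<bullet>\<^bsub>D\<^esub> (phi2 G ?f ?g \<Zstar>\<^bsub>D\<^esub> id2 D (on1 G ?h)))))"
      using fgh by (simp add: F.phi2_associativity) (simp add: G.on2_vc_eq G.C.vc_vc)
    \<comment> \<open>associativity of \<open>G\<close>\<close>
    also have "\<dots> = on2 G (phi2 F f (g \<star>\<^bsub>B\<^esub> h)) \<bullet>\<^bsub>D\<^esub> ((on2 G (id2 C ?f \<Zstar>\<^bsub>C\<^esub> phi2 F g h)
        \<bullet>\<^bsub>D\<^esub> phi2 G ?f (?g \<star>\<^bsub>C\<^esub> ?h)) \<bullet>\<^bsub>D\<^esub> ((id2 D (on1 G ?f) \<Zstar>\<^bsub>D\<^esub> phi2 G ?g ?h)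
          \<bullet>\<^bsub>D\<^esub> assoc D (on1 G ?f) (on1 G ?g) (on1 G ?h)))"
      using fgh by (simp add: G.phi2_associativity) (simp add: G.C.vc_vc)
    also have "on2 G (id2 C ?f \<Zstar>\<^bsub>C\<^esub> phi2 F g h) \<bullet>\<^bsub>D\<^esub> phi2 G ?f (?g \<star>\<^bsub>C\<^esub> ?h)
      = phi2 G ?f (on1 F (g \<star>\<^bsub>B\<^esub> h)) \<bullet>\<^bsub>D\<^esub> (id2 D (on1 G ?f) \<Zstar>\<^bsub>D\<^esub> on2 G (phi2 F g h))"
      using fgh G.phi2_naturality[of "id2 C ?f" "phi2 F g h"] by simp
    also have "on2 G (phi2 F f (g \<star>\<^bsub>B\<^esub> h)) \<bullet>\<^bsub>D\<^esub>
        ((phi2 G ?f (on1 F (g \<star>\<^bsub>B\<^esub> h)) \<bullet>\<^bsub>D\<^esub> (id2 D (on1 G ?f) \<Zstar>\<^bsub>D\<^esub> on2 G (phi2 F g h)))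
        \<bullet>\<^bsub>D\<^esub> ((id2 D (on1 G ?f) \<Zstar>\<^bsub>D\<^esub> phi2 G ?g ?h)
          \<bullet>\<^bsub>D\<^esub> assoc D (on1 G ?f) (on1 G ?g) (on1 G ?h)))
      = phi2 ?GF f (g \<star>\<^bsub>B\<^esub> h) \<bullet>\<^bsub>D\<^esub> ((id2 D (on1 G ?f) \<Zstar>\<^bsub>D\<^esub> phi2 ?GF g h)
          \<bullet>\<^bsub>D\<^esub> assoc D (on1 G ?f) (on1 G ?g) (on1 G ?h))"
      using fgh
        G.C.hc2_vc[of "id2 D (on1 G ?f)" "id2 D (on1 G ?f)" "on2 G (phi2 F g h)" "phi2 G ?g ?h"]
      by (simp add: G.C.vc_vc)
    finally show ?thesis
      using fgh by simp
  qed
  show "phi2 (comp_pfun G F) (cd B \<alpha>) (cd B \<beta>)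
          \<bullet>\<^bsub>D\<^esub> (on2 (comp_pfun G F) \<alpha> \<Zstar>\<^bsub>D\<^esub> on2 (comp_pfun G F) \<beta>)
        = on2 (comp_pfun G F) (\<alpha> \<Zstar>\<^bsub>B\<^esub> \<beta>)
          \<bullet>\<^bsub>D\<^esub> phi2 (comp_pfun G F) (dm B \<alpha>) (dm B \<beta>)"
    if \<alpha>\<beta>: "\<alpha> \<in> Cell B" "\<beta> \<in> Cell B" "src B (dm B \<alpha>) = trg B (dm B \<beta>)" for \<alpha> \<beta>
  proof -
    have "on2 G (phi2 F (cd B \<alpha>) (cd B \<beta>)) \<bullet>\<^bsub>D\<^esub> (phi2 G (on1 F (cd B \<alpha>)) (on1 F (cd B \<beta>))
        \<bullet>\<^bsub>D\<^esub> (on2 G (on2 F \<alpha>) \<Zstar>\<^bsub>D\<^esub> on2 G (on2 F \<beta>)))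
      = on2 G (phi2 F (cd B \<alpha>) (cd B \<beta>) \<bullet>\<^bsub>C\<^esub> (on2 F \<alpha> \<Zstar>\<^bsub>C\<^esub> on2 F \<beta>))
        \<bullet>\<^bsub>D\<^esub> phi2 G (on1 F (dm B \<alpha>)) (on1 F (dm B \<beta>))"
      using \<alpha>\<beta> G.phi2_naturality[of "on2 F \<alpha>" "on2 F \<beta>"] by (simp add: G.on2_vc_eq G.C.vc_vc)
    then show ?thesis
      using \<alpha>\<beta> by (simp add: F.phi2_naturality) (simp add: G.on2_vc_eq G.C.vc_vc)
  qed
  show "on2 (comp_pfun G F) (lunit B f) \<bullet>\<^bsub>D\<^esub> (phi2 (comp_pfun G F) (unit1 B (trg B f)) f
          \<bullet>\<^bsub>D\<^esub> (phi0 (comp_pfun G F) (trg B f) \<Zstar>\<^bsub>D\<^esub> id2 D (on1 (comp_pfun G F) f)))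
        = lunit D (on1 (comp_pfun G F) f)" if f: "f \<in> Arr B" for f
  proof -
    let ?f = "on1 F f" and ?u = "unit1 B (trg B f)" and ?a = "on0 F (trg B f)"
      and ?p = "phi0 F (trg B f)"
    have 1: "phi2 G (on1 F ?u) ?f \<bullet>\<^bsub>D\<^esub> (on2 G ?p \<Zstar>\<^bsub>D\<^esub> on2 G (id2 C ?f))
      = on2 G (?p \<Zstar>\<^bsub>C\<^esub> id2 C ?f) \<bullet>\<^bsub>D\<^esub> phi2 G (unit1 C ?a) ?f"
      using f G.phi2_naturality[of "?p" "id2 C ?f"] by simp
    have "on2 G (on2 F (lunit B f)) \<bullet>\<^bsub>D\<^esub> ((on2 G (phi2 F ?u f) \<bullet>\<^bsub>D\<^esub> phi2 G (on1 F ?u) ?f)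
        \<bullet>\<^bsub>D\<^esub> ((on2 G ?p \<bullet>\<^bsub>D\<^esub> phi0 G ?a) \<Zstar>\<^bsub>D\<^esub> id2 D (on1 G ?f)))
      = (on2 G (on2 F (lunit B f)) \<bullet>\<^bsub>D\<^esub> on2 G (phi2 F ?u f)) \<bullet>\<^bsub>D\<^esub>
        ((phi2 G (on1 F ?u) ?f \<bullet>\<^bsub>D\<^esub> (on2 G ?p \<Zstar>\<^bsub>D\<^esub> on2 G (id2 C ?f)))
          \<bullet>\<^bsub>D\<^esub> (phi0 G ?a \<Zstar>\<^bsub>D\<^esub> id2 D (on1 G ?f)))"
      using f G.C.hc2_vc[of "on2 G ?p" "phi0 G ?a" "id2 D (on1 G ?f)" "id2 D (on1 G ?f)"]
      by (simp add: G.C.vc_vc)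
    also note 1
    also have "(on2 G (on2 F (lunit B f)) \<bullet>\<^bsub>D\<^esub> on2 G (phi2 F ?u f)) \<bullet>\<^bsub>D\<^esub>
        ((on2 G (?p \<Zstar>\<^bsub>C\<^esub> id2 C ?f) \<bullet>\<^bsub>D\<^esub> phi2 G (unit1 C ?a) ?f)
          \<bullet>\<^bsub>D\<^esub> (phi0 G ?a \<Zstar>\<^bsub>D\<^esub> id2 D (on1 G ?f)))
      = on2 G (on2 F (lunit B f) \<bullet>\<^bsub>C\<^esub> (phi2 F ?u f \<bullet>\<^bsub>C\<^esub> (?p \<Zstar>\<^bsub>C\<^esub> id2 C ?f)))
        \<bullet>\<^bsub>D\<^esub> (phi2 G (unit1 C ?a) ?f
          \<bullet>\<^bsub>D\<^esub> (phi0 G ?a \<Zstar>\<^bsub>D\<^esub> id2 D (on1 G ?f)))"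
      using f by (simp add: G.on2_vc_eq G.C.vc_vc)
    \<comment> \<open>the unit law of \<open>F\<close>, and then that of \<open>G\<close> at \<open>Ff\<close>\<close>
    also have "\<dots> = lunit D (on1 G ?f)"
      using f G.phi0_lunit[of ?f] by (simp add: F.phi0_lunit)
    finally show ?thesis
      using f by simp
  qed
  show "on2 (comp_pfun G F) (runit B f) \<bullet>\<^bsub>D\<^esub> (phi2 (comp_pfun G F) f (unit1 B (src B f))
          \<bullet>\<^bsub>D\<^esub> (id2 D (on1 (comp_pfun G F) f) \<Zstar>\<^bsub>D\<^esub> phi0 (comp_pfun G F) (src B f)))
        = runit D (on1 (comp_pfun G F) f)" if f: "f \<in> Arr B" for f
  proof -
    let ?f = "on1 F f" and ?u = "unit1 B (src B f)" and ?a = "on0 F (src B f)"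
      and ?p = "phi0 F (src B f)"
    have 1: "phi2 G ?f (on1 F ?u) \<bullet>\<^bsub>D\<^esub> (on2 G (id2 C ?f) \<Zstar>\<^bsub>D\<^esub> on2 G ?p)
      = on2 G (id2 C ?f \<Zstar>\<^bsub>C\<^esub> ?p) \<bullet>\<^bsub>D\<^esub> phi2 G ?f (unit1 C ?a)"
      using f G.phi2_naturality[of "id2 C ?f" "?p"] by simp
    have "on2 G (on2 F (runit B f)) \<bullet>\<^bsub>D\<^esub> ((on2 G (phi2 F f ?u) \<bullet>\<^bsub>D\<^esub> phi2 G ?f (on1 F ?u))
        \<bullet>\<^bsub>D\<^esub> (id2 D (on1 G ?f) \<Zstar>\<^bsub>D\<^esub> (on2 G ?p \<bullet>\<^bsub>D\<^esub> phi0 G ?a)))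
      = (on2 G (on2 F (runit B f)) \<bullet>\<^bsub>D\<^esub> on2 G (phi2 F f ?u)) \<bullet>\<^bsub>D\<^esub>
        ((phi2 G ?f (on1 F ?u) \<bullet>\<^bsub>D\<^esub> (on2 G (id2 C ?f) \<Zstar>\<^bsub>D\<^esub> on2 G ?p))
          \<bullet>\<^bsub>D\<^esub> (id2 D (on1 G ?f) \<Zstar>\<^bsub>D\<^esub> phi0 G ?a))"
      using f G.C.hc2_vc[of "id2 D (on1 G ?f)" "id2 D (on1 G ?f)" "on2 G ?p" "phi0 G ?a"]
      by (simp add: G.C.vc_vc)
    also note 1
    also have "(on2 G (on2 F (runit B f)) \<bullet>\<^bsub>D\<^esub> on2 G (phi2 F f ?u)) \<bullet>\<^bsub>D\<^esub>
        ((on2 G (id2 C ?f \<Zstar>\<^bsub>C\<^esub> ?p) \<bullet>\<^bsub>D\<^esub> phi2 G ?f (unit1 C ?a))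
          \<bullet>\<^bsub>D\<^esub> (id2 D (on1 G ?f) \<Zstar>\<^bsub>D\<^esub> phi0 G ?a))
      = on2 G (on2 F (runit B f) \<bullet>\<^bsub>C\<^esub> (phi2 F f ?u \<bullet>\<^bsub>C\<^esub> (id2 C ?f \<Zstar>\<^bsub>C\<^esub> ?p)))
        \<bullet>\<^bsub>D\<^esub> (phi2 G ?f (unit1 C ?a)
          \<bullet>\<^bsub>D\<^esub> (id2 D (on1 G ?f) \<Zstar>\<^bsub>D\<^esub> phi0 G ?a))"
      using f by (simp add: G.on2_vc_eq G.C.vc_vc)
    \<comment> \<open>the unit law of \<open>F\<close>, and then that of \<open>G\<close> at \<open>Ff\<close>\<close>
    also have "\<dots> = runit D (on1 G ?f)"
      using f G.phi0_runit[of ?f] by (simp add: F.phi0_runit)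
    finally show ?thesis
      using f by simp
  qed
qed (simp_all add: F.on2_vc_eq G.on2_vc_eq F.phi0_iso G.phi0_iso F.iso2_phi2 G.iso2_phi2
    G.iso2_on2 G.C.iso2_vc)

end


context icon
begin

lemma Dom [simp]: "Dom \<alpha> = F"
  and Cod [simp]: "Cod \<alpha> = G"
  using Dom_Cod by auto

lemma Cell_component [simp]: "f \<in> Arr B \<Longrightarrow> component \<alpha> f \<in> Cell C"
  and dm_component [simp]: "f \<in> Arr B \<Longrightarrow> dm C (component \<alpha> f) = on1 F f"
  and cd_component [simp]: "f \<in> Arr B \<Longrightarrow> cd C (component \<alpha> f) = on1 G f"
  using comp_hom by (auto simp: hom2_def)

lemma component_naturality:
  "\<sigma> \<in> Cell B \<Longrightarrow>
    component \<alpha> (cd B \<sigma>) \<bullet>\<^bsub>C\<^esub> on2 F \<sigma> = on2 G \<sigma> \<bullet>\<^bsub>C\<^esub> component \<alpha> (dm B \<sigma>)"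
  by (rule comp_natural) (auto simp: hom2_def)

lemma component_hc1:
  "\<lbrakk>f \<in> Arr B; g \<in> Arr B; src B f = trg B g\<rbrakk> \<Longrightarrow>
    component \<alpha> (f \<star>\<^bsub>B\<^esub> g) \<bullet>\<^bsub>C\<^esub> phi2 F f g
      = phi2 G f g \<bullet>\<^bsub>C\<^esub> (component \<alpha> f \<Zstar>\<^bsub>C\<^esub> component \<alpha> g)"
  by (rule comp_phi2) (auto simp: hom1_def)

end

lemma iconI:
  assumes "pseudofunctor B C F" "pseudofunctor B C G" "Dom \<alpha> = F" "Cod \<alpha> = G"
    and "\<And>a. a \<in> Ob B \<Longrightarrow> on0 F a = on0 G a"
    and "\<And>f. f \<in> Arr B \<Longrightarrow> component \<alpha> f \<in> Cell C
      \<and> dm C (component \<alpha> f) = on1 F f \<and> cd C (component \<alpha> f) = on1 G f"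
    and "\<And>\<sigma>. \<sigma> \<in> Cell B \<Longrightarrow>
      component \<alpha> (cd B \<sigma>) \<bullet>\<^bsub>C\<^esub> on2 F \<sigma> = on2 G \<sigma> \<bullet>\<^bsub>C\<^esub> component \<alpha> (dm B \<sigma>)"
    and "\<And>a. a \<in> Ob B \<Longrightarrow> component \<alpha> (unit1 B a) \<bullet>\<^bsub>C\<^esub> phi0 F a = phi0 G a"
    and "\<And>f g. \<lbrakk>f \<in> Arr B; g \<in> Arr B; src B f = trg B g\<rbrakk> \<Longrightarrow>
      component \<alpha> (f \<star>\<^bsub>B\<^esub> g) \<bullet>\<^bsub>C\<^esub> phi2 F f g
        = phi2 G f g \<bullet>\<^bsub>C\<^esub> (component \<alpha> f \<Zstar>\<^bsub>C\<^esub> component \<alpha> g)"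
  shows "icon B C F G \<alpha>"
proof -
  interpret F: pseudofunctor B C F by fact
  interpret G: pseudofunctor B C G by fact
  show ?thesis
    by unfold_locales (use assms(3-) in \<open>auto simp: hom1_def hom2_def\<close>)
qed

lemma icon_simps [simp]:
  "Dom (id_icon F) = F" "Cod (id_icon F) = F"
  "trim_icon (id_icon F) = id_icon F"
  "f \<in> Arr (Src F) \<Longrightarrow> component (id_icon F) f = id2 (Trg F) (on1 F f)"
  "Dom (vcomp_icon \<beta> \<alpha>) = Dom \<alpha>" "Cod (vcomp_icon \<beta> \<alpha>) = Cod \<beta>"
  "trim_icon (vcomp_icon \<beta> \<alpha>) = vcomp_icon \<beta> \<alpha>"
  "f \<in> Arr (Src (Dom \<alpha>)) \<Longrightarrow>
    component (vcomp_icon \<beta> \<alpha>) f = component \<beta> f \<bullet>\<^bsub>Trg (Dom \<alpha>)\<^esub> component \<alpha> f"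
  by (simp_all add: id_icon_def vcomp_icon_def) (simp_all add: trim_icon_def)

lemma hcomp_icon_simps [simp]:
  "Dom (hcomp_icon \<gamma> \<alpha>) = comp_pfun (Dom \<gamma>) (Dom \<alpha>)"
  "Cod (hcomp_icon \<gamma> \<alpha>) = comp_pfun (Cod \<gamma>) (Cod \<alpha>)"
  "trim_icon (hcomp_icon \<gamma> \<alpha>) = hcomp_icon \<gamma> \<alpha>"
  "f \<in> Arr (Src (Dom \<alpha>)) \<Longrightarrow> component (hcomp_icon \<gamma> \<alpha>) f
    = component \<gamma> (on1 (Cod \<alpha>) f) \<bullet>\<^bsub>Trg (Dom \<gamma>)\<^esub> on2 (Dom \<gamma>) (component \<alpha> f)"
  by (simp_all add: hcomp_icon_def) (simp_all add: trim_icon_def)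

lemma icon_id_icon: "pseudofunctor B C F \<Longrightarrow> icon B C F F (id_icon F)"
proof -
  assume "pseudofunctor B C F"
  then interpret pseudofunctor B C F .
  show ?thesis
    by (rule iconI) (simp_all add: \<open>pseudofunctor B C F\<close> C.hc2_id2)
qed

lemma icon_vcomp_icon:
  assumes "icon B C F G \<alpha>" "icon B C G H \<beta>"
  shows "icon B C F H (vcomp_icon \<beta> \<alpha>)"
proof -
  interpret \<alpha>: icon B C F G \<alpha> by fact
  interpret \<beta>: icon B C G H \<beta> by fact
  note \<alpha>.agree_on_objects [simp] \<beta>.agree_on_objects [simp]
  show ?thesis
  proof (rule iconI)
    show "pseudofunctor B C F" "pseudofunctor B C H"
      by unfold_locales
    fix \<sigma> assume \<sigma>: "\<sigma> \<in> Cell B"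
    have "component \<beta> (cd B \<sigma>) \<bullet>\<^bsub>C\<^esub> (component \<alpha> (cd B \<sigma>) \<bullet>\<^bsub>C\<^esub> on2 F \<sigma>)
      = (component \<beta> (cd B \<sigma>) \<bullet>\<^bsub>C\<^esub> on2 G \<sigma>) \<bullet>\<^bsub>C\<^esub> component \<alpha> (dm B \<sigma>)"
      using \<sigma> by (simp add: \<alpha>.component_naturality \<alpha>.F.C.vc_vc)
    then show "component (vcomp_icon \<beta> \<alpha>) (cd B \<sigma>) \<bullet>\<^bsub>C\<^esub> on2 F \<sigma>
      = on2 H \<sigma> \<bullet>\<^bsub>C\<^esub> component (vcomp_icon \<beta> \<alpha>) (dm B \<sigma>)"
      using \<sigma> by (simp add: \<beta>.component_naturality \<alpha>.F.C.vc_vc)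
  next
    fix f g assume fg: "f \<in> Arr B" "g \<in> Arr B" "src B f = trg B g"
    have "component \<beta> (f \<star>\<^bsub>B\<^esub> g) \<bullet>\<^bsub>C\<^esub> (component \<alpha> (f \<star>\<^bsub>B\<^esub> g) \<bullet>\<^bsub>C\<^esub> phi2 F f g)
      = (component \<beta> (f \<star>\<^bsub>B\<^esub> g) \<bullet>\<^bsub>C\<^esub> phi2 G f g)
        \<bullet>\<^bsub>C\<^esub> (component \<alpha> f \<Zstar>\<^bsub>C\<^esub> component \<alpha> g)"
      using fg by (simp add: \<alpha>.component_hc1 \<alpha>.F.C.vc_vc)
    then show "component (vcomp_icon \<beta> \<alpha>) (f \<star>\<^bsub>B\<^esub> g) \<bullet>\<^bsub>C\<^esub> phi2 F f g
      = phi2 H f g \<bullet>\<^bsub>C\<^esub> (component (vcomp_icon \<beta> \<alpha>) f \<Zstar>\<^bsub>C\<^esub> component (vcomp_icon \<beta> \<alpha>) g)"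
      using fg by (simp add: \<beta>.component_hc1 \<alpha>.F.C.vc_vc \<alpha>.F.C.hc2_vc)
  qed (simp_all add: \<alpha>.F.C.vc_vc \<alpha>.comp_phi0 \<beta>.comp_phi0)
qed

text \<open>
  In the two conditions on \<open>\<gamma> \<Zstar> \<alpha>\<close> about constraints, the condition for
  \<open>\<alpha>\<close> is applied under \<open>H\<close>, then \<open>\<gamma>\<close> is moved across by
  naturality at the constraint of \<open>G\<close>, and then the condition for \<open>\<gamma>\<close> applies. For
  composites of 1-cells, naturality of the constraint of \<open>H\<close> is needed as well.
\<close>

lemma icon_hcomp_icon:
  assumes "icon B C F G \<alpha>" "icon C D H K \<gamma>"
  shows "icon B D (comp_pfun H F) (comp_pfun K G) (hcomp_icon \<gamma> \<alpha>)"
proof -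
  interpret \<alpha>: icon B C F G \<alpha> by fact
  interpret \<gamma>: icon C D H K \<gamma> by fact
  interpret HF: composable_pseudofunctors B C D F H by unfold_locales
  interpret KG: composable_pseudofunctors B C D G K by unfold_locales
  note \<alpha>.agree_on_objects [simp] \<gamma>.agree_on_objects [simp]
  have vc: "\<lbrakk>\<rho> \<in> Cell D; \<sigma> \<in> Cell D; \<tau> \<in> Cell D; dm D \<rho> = cd D \<sigma>; dm D \<sigma> = cd D \<tau>\<rbrakk> \<Longrightarrow>
      \<rho> \<bullet>\<^bsub>D\<^esub> \<sigma> \<bullet>\<^bsub>D\<^esub> \<tau> = \<rho> \<bullet>\<^bsub>D\<^esub> (\<sigma> \<bullet>\<^bsub>D\<^esub> \<tau>)" for \<rho> \<sigma> \<tau>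
    by (rule \<gamma>.F.C.vc_vc)
  show ?thesis
  proof (rule iconI)
    show "pseudofunctor B D (comp_pfun H F)" "pseudofunctor B D (comp_pfun K G)"
      by unfold_locales
    fix \<sigma> assume \<sigma>: "\<sigma> \<in> Cell B"
    have "component \<gamma> (on1 G (cd B \<sigma>)) \<bullet>\<^bsub>D\<^esub> on2 H (component \<alpha> (cd B \<sigma>) \<bullet>\<^bsub>C\<^esub> on2 F \<sigma>)
      = (component \<gamma> (cd C (on2 G \<sigma>)) \<bullet>\<^bsub>D\<^esub> on2 H (on2 G \<sigma>))
        \<bullet>\<^bsub>D\<^esub> on2 H (component \<alpha> (dm B \<sigma>))"
      using \<sigma> by (simp add: \<alpha>.component_naturality \<gamma>.F.on2_vc_eq vc)
    also note \<gamma>.component_naturality[OF \<alpha>.G.Cell_on2[OF \<sigma>]]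
    finally show "component (hcomp_icon \<gamma> \<alpha>) (cd B \<sigma>) \<bullet>\<^bsub>D\<^esub> on2 (comp_pfun H F) \<sigma>
      = on2 (comp_pfun K G) \<sigma> \<bullet>\<^bsub>D\<^esub> component (hcomp_icon \<gamma> \<alpha>) (dm B \<sigma>)"
      using \<sigma> by (simp add: \<gamma>.F.on2_vc_eq vc)
  next
    fix a assume a: "a \<in> Ob B"
    have "component \<gamma> (on1 G (unit1 B a)) \<bullet>\<^bsub>D\<^esub>
        (on2 H (component \<alpha> (unit1 B a) \<bullet>\<^bsub>C\<^esub> phi0 F a) \<bullet>\<^bsub>D\<^esub> phi0 H (on0 G a))
      = (component \<gamma> (cd C (phi0 G a)) \<bullet>\<^bsub>D\<^esub> on2 H (phi0 G a)) \<bullet>\<^bsub>D\<^esub> phi0 H (on0 G a)"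
      using a by (simp add: \<alpha>.comp_phi0 vc)
    also have "\<dots> = on2 K (phi0 G a) \<bullet>\<^bsub>D\<^esub>
        (component \<gamma> (unit1 C (on0 G a)) \<bullet>\<^bsub>D\<^esub> phi0 H (on0 G a))"
      using a by (simp only: \<gamma>.component_naturality \<alpha>.G.Cell_phi0) (simp add: vc)
    also have "\<dots> = on2 K (phi0 G a) \<bullet>\<^bsub>D\<^esub> phi0 K (on0 G a)"
      using a by (simp add: \<gamma>.comp_phi0)
    finally show "component (hcomp_icon \<gamma> \<alpha>) (unit1 B a) \<bullet>\<^bsub>D\<^esub> phi0 (comp_pfun H F) a
      = phi0 (comp_pfun K G) a"
      using a by (simp add: \<gamma>.F.on2_vc_eq vc)
  next
    fix f g assume fg: "f \<in> Arr B" "g \<in> Arr B" "src B f = trg B g"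
    let ?\<alpha>\<alpha> = "component \<alpha> f \<Zstar>\<^bsub>C\<^esub> component \<alpha> g"
    have "component \<gamma> (on1 G (f \<star>\<^bsub>B\<^esub> g)) \<bullet>\<^bsub>D\<^esub>
        (on2 H (component \<alpha> (f \<star>\<^bsub>B\<^esub> g) \<bullet>\<^bsub>C\<^esub> phi2 F f g) \<bullet>\<^bsub>D\<^esub> phi2 H (on1 F f) (on1 F g))
      = (component \<gamma> (cd C (phi2 G f g)) \<bullet>\<^bsub>D\<^esub> on2 H (phi2 G f g)) \<bullet>\<^bsub>D\<^esub>
        (on2 H ?\<alpha>\<alpha> \<bullet>\<^bsub>D\<^esub> phi2 H (dm C (component \<alpha> f)) (dm C (component \<alpha> g)))"
      using fg by (simp add: \<alpha>.component_hc1 \<gamma>.F.on2_vc_eq vc)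
    also have "\<dots> = (on2 K (phi2 G f g) \<bullet>\<^bsub>D\<^esub> component \<gamma> (on1 G f \<star>\<^bsub>C\<^esub> on1 G g)) \<bullet>\<^bsub>D\<^esub>
        (phi2 H (on1 G f) (on1 G g)
          \<bullet>\<^bsub>D\<^esub> (on2 H (component \<alpha> f) \<Zstar>\<^bsub>D\<^esub> on2 H (component \<alpha> g)))"
      using fg \<gamma>.component_naturality[of "phi2 G f g"]
        \<gamma>.F.phi2_naturality[of "component \<alpha> f" "component \<alpha> g"] by simp
    also have "\<dots> = on2 K (phi2 G f g) \<bullet>\<^bsub>D\<^esub>
        ((component \<gamma> (on1 G f \<star>\<^bsub>C\<^esub> on1 G g) \<bullet>\<^bsub>D\<^esub> phi2 H (on1 G f) (on1 G g))
          \<bullet>\<^bsub>D\<^esub> (on2 H (component \<alpha> f) \<Zstar>\<^bsub>D\<^esub> on2 H (component \<alpha> g)))"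
      using fg by (simp add: vc)
    also have "\<dots> = on2 K (phi2 G f g) \<bullet>\<^bsub>D\<^esub> (phi2 K (on1 G f) (on1 G g) \<bullet>\<^bsub>D\<^esub>
        ((component \<gamma> (on1 G f) \<bullet>\<^bsub>D\<^esub> on2 H (component \<alpha> f))
          \<Zstar>\<^bsub>D\<^esub> (component \<gamma> (on1 G g) \<bullet>\<^bsub>D\<^esub> on2 H (component \<alpha> g))))"
      using fg by (simp add: \<gamma>.component_hc1 \<gamma>.F.C.hc2_vc vc)
    finally show "component (hcomp_icon \<gamma> \<alpha>) (f \<star>\<^bsub>B\<^esub> g) \<bullet>\<^bsub>D\<^esub> phi2 (comp_pfun H F) f g
      = phi2 (comp_pfun K G) f g
        \<bullet>\<^bsub>D\<^esub> (component (hcomp_icon \<gamma> \<alpha>) f \<Zstar>\<^bsub>D\<^esub> component (hcomp_icon \<gamma> \<alpha>) g)"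
      using fg by (simp add: \<gamma>.F.on2_vc_eq vc)
  qed simp_all
qed


lemma id_pfun_eq_strict_pfun: "id_pfun B = strict_pfun B B (\<lambda>a. a) (\<lambda>f. f) (\<lambda>\<alpha>. \<alpha>)"
  by (simp add: id_pfun_def strict_pfun_def)

lemma Src_id_pfun [simp]: "Src (id_pfun B) = B"
  and Trg_id_pfun [simp]: "Trg (id_pfun B) = B"
  by (simp_all add: id_pfun_eq_strict_pfun)

lemma id_pfun_simps [simp]:
  "trim_pfun (id_pfun B) = id_pfun B"
  "a \<in> Ob B \<Longrightarrow> on0 (id_pfun B) a = a"
  "f \<in> Arr B \<Longrightarrow> on1 (id_pfun B) f = f"
  "\<alpha> \<in> Cell B \<Longrightarrow> on2 (id_pfun B) \<alpha> = \<alpha>"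
  "a \<in> Ob B \<Longrightarrow> phi0 (id_pfun B) a = id2 B (unit1 B a)"
  "\<lbrakk>f \<in> Arr B; g \<in> Arr B; src B f = trg B g\<rbrakk> \<Longrightarrow>
    phi2 (id_pfun B) f g = id2 B (f \<star>\<^bsub>B\<^esub> g)"
  by (simp_all add: id_pfun_eq_strict_pfun)

lemma pseudofunctor_id_pfun:
  assumes "bicategory B"
  shows "pseudofunctor B B (id_pfun B)"
proof -
  interpret bicategory B by fact
  interpret strict_morphism B B "\<lambda>a. a" "\<lambda>f. f" "\<lambda>\<alpha>. \<alpha>"
    by unfold_locales simp_all
  show ?thesis
    unfolding id_pfun_eq_strict_pfun by unfold_locales
qed

lemma pseudofunctor_comp_pfun:
  assumes "pseudofunctor B C F" "pseudofunctor C D G"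
  shows "pseudofunctor B D (comp_pfun G F)"
proof -
  interpret composable_pseudofunctors B C D F G
    using assms by (simp add: composable_pseudofunctors_def)
  show ?thesis
    by unfold_locales
qed

lemma comp_pfun_assoc:
  assumes "pseudofunctor B C F" "pseudofunctor C D G" "pseudofunctor D E H"
  shows "comp_pfun (comp_pfun H G) F = comp_pfun H (comp_pfun G F)"
proof -
  interpret F: pseudofunctor B C F by fact
  interpret G: pseudofunctor C D G by fact
  interpret H: pseudofunctor D E H by fact
  show ?thesis
    by (rule pfun_eqI) (simp_all add: H.on2_vc_eq H.C.vc_vc)
qed

lemma comp_pfun_id_pfun:
  assumes "pseudofunctor B C F" "trim_pfun F = F"
  shows "comp_pfun (id_pfun C) F = F" "comp_pfun F (id_pfun B) = F"
proof -
  interpret F: pseudofunctor B C F by fact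
  show "comp_pfun (id_pfun C) F = F" "comp_pfun F (id_pfun B) = F"
    by (rule pfun_eqI; simp add: assms(2))+
qed

lemma vcomp_icon_assoc:
  assumes "icon B C F G \<alpha>" "icon B C G H \<beta>" "icon B C H K \<gamma>"
  shows "vcomp_icon (vcomp_icon \<gamma> \<beta>) \<alpha> = vcomp_icon \<gamma> (vcomp_icon \<beta> \<alpha>)"
proof -
  interpret \<alpha>: icon B C F G \<alpha> by fact
  interpret \<beta>: icon B C G H \<beta> by fact
  interpret \<gamma>: icon B C H K \<gamma> by fact
  show ?thesis
    by (rule icon_eqI) (simp_all add: \<alpha>.F.C.vc_vc)
qed

lemma vcomp_icon_id_icon:
  assumes "icon B C F G \<alpha>" "trim_icon \<alpha> = \<alpha>"
  shows "vcomp_icon (id_icon G) \<alpha> = \<alpha>" "vcomp_icon \<alpha> (id_icon F) = \<alpha>"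
proof -
  interpret icon B C F G \<alpha> by fact
  show "vcomp_icon (id_icon G) \<alpha> = \<alpha>" "vcomp_icon \<alpha> (id_icon F) = \<alpha>"
    by (rule icon_eqI; simp add: assms(2))+
qed

lemma hcomp_icon_id_icons:
  assumes "pseudofunctor B C F" "pseudofunctor C D G"
  shows "hcomp_icon (id_icon G) (id_icon F) = id_icon (comp_pfun G F)"
proof -
  interpret F: pseudofunctor B C F by fact
  interpret G: pseudofunctor C D G by fact
  show ?thesis
    by (rule icon_eqI) simp_all
qed

lemma icon_interchange:
  assumes "icon B C F F' \<alpha>" "icon B C F' F'' \<alpha>'" "icon C D G G' \<gamma>" "icon C D G' G'' \<gamma>'"
  shows "hcomp_icon (vcomp_icon \<gamma>' \<gamma>) (vcomp_icon \<alpha>' \<alpha>)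
    = vcomp_icon (hcomp_icon \<gamma>' \<alpha>') (hcomp_icon \<gamma> \<alpha>)"
proof -
  interpret \<alpha>: icon B C F F' \<alpha> by fact
  interpret \<alpha>': icon B C F' F'' \<alpha>' by fact
  interpret \<gamma>: icon C D G G' \<gamma> by fact
  interpret \<gamma>': icon C D G' G'' \<gamma>' by fact
  note \<gamma>.F.on2_vc_eq [simp] \<gamma>.F.C.vc_vc [simp]
  show ?thesis
  proof (rule icon_eqI, goal_cases)
    case (5 f)
    then have f: "f \<in> Arr B"
      by simp
    \<comment> \<open>naturality of \<open>\<gamma>\<close> at the 2-cell \<open>\<alpha>'\<^sub>f\<close> interchanges the two middle factors\<close>
    have "(component \<gamma> (on1 F'' f) \<bullet>\<^bsub>D\<^esub> on2 G (component \<alpha>' f)) \<bullet>\<^bsub>D\<^esub> on2 G (component \<alpha> f)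
      = (on2 G' (component \<alpha>' f) \<bullet>\<^bsub>D\<^esub> component \<gamma> (on1 F' f)) \<bullet>\<^bsub>D\<^esub> on2 G (component \<alpha> f)"
      using f \<gamma>.component_naturality[of "component \<alpha>' f"] by simp
    then show ?case
      using f by simp
  qed simp_all
qed

lemma hcomp_icon_assoc:
  assumes "icon B C F F' \<alpha>" "icon C D G G' \<beta>" "icon D E H H' \<gamma>"
  shows "hcomp_icon (hcomp_icon \<gamma> \<beta>) \<alpha> = hcomp_icon \<gamma> (hcomp_icon \<beta> \<alpha>)"
proof -
  interpret \<alpha>: icon B C F F' \<alpha> by fact
  interpret \<beta>: icon C D G G' \<beta> by fact
  interpret \<gamma>: icon D E H H' \<gamma> by fact
  have comps: "comp_pfun (comp_pfun H G) F = comp_pfun H (comp_pfun G F)"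
    "comp_pfun (comp_pfun H' G') F' = comp_pfun H' (comp_pfun G' F')"
    by (rule comp_pfun_assoc; unfold_locales)+
  show ?thesis
    by (rule icon_eqI) (simp_all add: comps \<gamma>.F.on2_vc_eq \<gamma>.F.C.vc_vc)
qed

lemma hcomp_icon_id_pfun:
  assumes "icon B C F G \<alpha>" "trim_icon \<alpha> = \<alpha>" "trim_pfun F = F" "trim_pfun G = G"
  shows "hcomp_icon (id_icon (id_pfun C)) \<alpha> = \<alpha>" "hcomp_icon \<alpha> (id_icon (id_pfun B)) = \<alpha>"
proof -
  interpret icon B C F G \<alpha> by fact
  have F: "comp_pfun (id_pfun C) F = F" "comp_pfun F (id_pfun B) = F"
    by (rule comp_pfun_id_pfun; unfold_locales?; fact)+
  have G: "comp_pfun (id_pfun C) G = G" "comp_pfun G (id_pfun B) = G"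
    by (rule comp_pfun_id_pfun; unfold_locales?; fact)+
  show "hcomp_icon (id_icon (id_pfun C)) \<alpha> = \<alpha>" "hcomp_icon \<alpha> (id_icon (id_pfun B)) = \<alpha>"
    by (rule icon_eqI; simp add: assms(2) F G)+
qed


section \<open>Icon is a 2-category\<close>

lemma Icon_simps [simp]:
  "Ob Icon = bicategories" "Arr Icon = functors" "Cell Icon = icons"
  "src Icon = Src" "trg Icon = Trg" "dm Icon = Dom" "cd Icon = Cod"
  "id2 Icon = id_icon" "vc Icon = vcomp_icon" "unit1 Icon = id_pfun"
  "hc1 Icon = comp_pfun" "hc2 Icon = hcomp_icon"
  by (simp_all add: Icon_def)

lemma bicategoriesD: "B \<in> bicategories \<Longrightarrow> bicategory B"
  by (simp add: bicategories_def)

lemma Src_functors [simp]: "F \<in> functors \<Longrightarrow> Src F \<in> bicategories"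
  and Trg_functors [simp]: "F \<in> functors \<Longrightarrow> Trg F \<in> bicategories"
  and trim_functors [simp]: "F \<in> functors \<Longrightarrow> trim_pfun F = F"
  and functorsD: "\<lbrakk>F \<in> functors; Src F = B; Trg F = C\<rbrakk> \<Longrightarrow> pseudofunctor B C F"
  by (auto simp: functors_def)

lemma functorsI:
  "\<lbrakk>pseudofunctor B C F; B \<in> bicategories; C \<in> bicategories; trim_pfun F = F\<rbrakk> \<Longrightarrow> F \<in> functors"
  unfolding functors_def by (auto dest: pseudofunctor.Src pseudofunctor.Trg)

lemma Dom_icons [simp]: "\<alpha> \<in> icons \<Longrightarrow> Dom \<alpha> \<in> functors"
  and Cod_icons [simp]: "\<alpha> \<in> icons \<Longrightarrow> Cod \<alpha> \<in> functors"
  and trim_icons [simp]: "\<alpha> \<in> icons \<Longrightarrow> trim_icon \<alpha> = \<alpha>"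
  and iconsD: "\<lbrakk>\<alpha> \<in> icons; Dom \<alpha> = F; Cod \<alpha> = G; Src F = B; Trg F = C\<rbrakk> \<Longrightarrow> icon B C F G \<alpha>"
  by (auto simp: icons_def)

lemma Src_Cod [simp]: "\<alpha> \<in> icons \<Longrightarrow> Src (Cod \<alpha>) = Src (Dom \<alpha>)"
  and Trg_Cod [simp]: "\<alpha> \<in> icons \<Longrightarrow> Trg (Cod \<alpha>) = Trg (Dom \<alpha>)"
  using pseudofunctor.Src_Trg[OF icon.axioms(2)[OF iconsD[OF _ refl refl refl refl]]] by auto

lemma iconsI:
  "\<lbrakk>icon B C F G \<alpha>; F \<in> functors; G \<in> functors; trim_icon \<alpha> = \<alpha>\<rbrakk> \<Longrightarrow> \<alpha> \<in> icons"
  unfolding icons_def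
  using icon.Dom_Cod[of B C F G \<alpha>] pseudofunctor.Src_Trg[OF icon.axioms(1), of B C F G \<alpha>] by auto

lemma id_pfun_functors [simp]: "B \<in> bicategories \<Longrightarrow> id_pfun B \<in> functors"
  by (rule functorsI[OF pseudofunctor_id_pfun]) (simp_all add: bicategoriesD)

lemma comp_pfun_functors [simp]:
  "\<lbrakk>G \<in> functors; F \<in> functors; Src G = Trg F\<rbrakk> \<Longrightarrow> comp_pfun G F \<in> functors"
  by (rule functorsI[OF pseudofunctor_comp_pfun[OF functorsD[OF _ refl refl] functorsD[OF _ _ refl]]]) simp_all

lemma id_icon_icons [simp]: "F \<in> functors \<Longrightarrow> id_icon F \<in> icons"
  by (rule iconsI[OF icon_id_icon[OF functorsD]]) simp_all

lemma vcomp_icon_icons [simp]: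
  "\<lbrakk>\<beta> \<in> icons; \<alpha> \<in> icons; Dom \<beta> = Cod \<alpha>\<rbrakk> \<Longrightarrow> vcomp_icon \<beta> \<alpha> \<in> icons"
  by (rule iconsI[OF icon_vcomp_icon[OF iconsD[OF _ refl refl refl refl] iconsD[OF _ _ refl]]]) simp_all

lemma hcomp_icon_icons [simp]:
  "\<lbrakk>\<gamma> \<in> icons; \<alpha> \<in> icons; Src (Dom \<gamma>) = Trg (Dom \<alpha>)\<rbrakk> \<Longrightarrow> hcomp_icon \<gamma> \<alpha> \<in> icons"
  by (rule iconsI[OF icon_hcomp_icon[OF iconsD[OF _ refl refl refl refl] iconsD[OF _ refl refl _ refl]]]) simp_all

theorem two_category_Icon: "two_category (Icon :: ('u small_bicat, 'u small_pfun, 'u small_icon) cells)"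
proof (rule two_categoryI; (unfold Icon_simps)?)
  show "hom_categories (Icon :: ('u small_bicat, 'u small_pfun, 'u small_icon) cells)"
  proof (rule hom_categoriesI; unfold Icon_simps)
    show "vcomp_icon (vcomp_icon \<gamma> \<beta>) \<alpha> = vcomp_icon \<gamma> (vcomp_icon \<beta> \<alpha>)"
      if "\<gamma> \<in> icons" "\<beta> \<in> icons" "\<alpha> \<in> icons" "Dom \<gamma> = Cod \<beta>" "Dom \<beta> = Cod \<alpha>"
      for \<gamma> \<beta> \<alpha> :: "'u small_icon"
      by (rule vcomp_icon_assoc[OF iconsD[OF _ refl refl refl refl] iconsD[OF _ _ refl] iconsD[OF _ _ refl]]) (simp_all add: that)
    show "vcomp_icon (id_icon (Cod \<alpha>)) \<alpha> = \<alpha>" "vcomp_icon \<alpha> (id_icon (Dom \<alpha>)) = \<alpha>"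
      if "\<alpha> \<in> icons" for \<alpha> :: "'u small_icon"
      by (rule vcomp_icon_id_icon[OF iconsD[OF _ refl refl refl refl]]; simp add: that)+
    show "hcomp_icon (id_icon G) (id_icon F) = id_icon (comp_pfun G F)"
      if "G \<in> functors" "F \<in> functors" "Src G = Trg F" for G F :: "'u small_pfun"
      by (rule hcomp_icon_id_icons[OF functorsD functorsD]) (simp_all add: that)
    show "hcomp_icon (vcomp_icon \<gamma>' \<gamma>) (vcomp_icon \<alpha>' \<alpha>)
        = vcomp_icon (hcomp_icon \<gamma>' \<alpha>') (hcomp_icon \<gamma> \<alpha>)"
      if "\<gamma>' \<in> icons" "\<gamma> \<in> icons" "\<alpha>' \<in> icons" "\<alpha> \<in> icons" "Dom \<gamma>' = Cod \<gamma>" "Dom \<alpha>' = Cod \<alpha>"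
        "Src (Dom \<gamma>) = Trg (Dom \<alpha>)" for \<gamma>' \<gamma> \<alpha>' \<alpha> :: "'u small_icon"
      by (rule icon_interchange[OF iconsD[OF _ refl refl refl refl] iconsD[OF _ _ refl]
        iconsD[OF _ refl refl _ refl] iconsD[OF _ _ refl]]) (simp_all add: that)
  qed simp_all
next
  show "comp_pfun (comp_pfun H G) F = comp_pfun H (comp_pfun G F)"
    if "H \<in> functors" "G \<in> functors" "F \<in> functors" "Src H = Trg G" "Src G = Trg F"
    for H G F :: "'u small_pfun"
    by (rule comp_pfun_assoc[OF functorsD functorsD functorsD]) (simp_all add: that)
  show "comp_pfun (id_pfun (Trg F)) F = F" "comp_pfun F (id_pfun (Src F)) = F"
    if "F \<in> functors" for F :: "'u small_pfun"
    by (rule comp_pfun_id_pfun[OF functorsD]; simp add: that)+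
  show "hcomp_icon (hcomp_icon \<gamma> \<beta>) \<alpha> = hcomp_icon \<gamma> (hcomp_icon \<beta> \<alpha>)"
    if "\<gamma> \<in> icons" "\<beta> \<in> icons" "\<alpha> \<in> icons" "Src (Dom \<gamma>) = Trg (Dom \<beta>)"
      "Src (Dom \<beta>) = Trg (Dom \<alpha>)" for \<gamma> \<beta> \<alpha> :: "'u small_icon"
    by (rule hcomp_icon_assoc[OF iconsD[OF _ refl refl refl refl] iconsD[OF _ refl refl _ refl]
      iconsD[OF _ refl refl _ refl]]) (simp_all add: that)
  show "hcomp_icon (id_icon (id_pfun (Trg (Dom \<alpha>)))) \<alpha> = \<alpha>"
    "hcomp_icon \<alpha> (id_icon (id_pfun (Src (Dom \<alpha>)))) = \<alpha>"
    if "\<alpha> \<in> icons" for \<alpha> :: "'u small_icon"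
    by (rule hcomp_icon_id_pfun[OF iconsD[OF _ refl refl refl refl]]; simp add: that)+
qed


section \<open>Products of 2-categories and 2-functors of several variables\<close>

lemma prod_cells_simps [simp]:
  "Ob (prod_cells A B) = Ob A \<times> Ob B"
  "Arr (prod_cells A B) = Arr A \<times> Arr B"
  "Cell (prod_cells A B) = Cell A \<times> Cell B"
  "src (prod_cells A B) fg = (src A (fst fg), src B (snd fg))"
  "trg (prod_cells A B) fg = (trg A (fst fg), trg B (snd fg))"
  "dm (prod_cells A B) \<alpha>\<beta> = (dm A (fst \<alpha>\<beta>), dm B (snd \<alpha>\<beta>))"
  "cd (prod_cells A B) \<alpha>\<beta> = (cd A (fst \<alpha>\<beta>), cd B (snd \<alpha>\<beta>))"
  "id2 (prod_cells A B) fg = (id2 A (fst fg), id2 B (snd fg))"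
  "unit1 (prod_cells A B) xy = (unit1 A (fst xy), unit1 B (snd xy))"
  "vc (prod_cells A B) \<alpha>\<beta> \<gamma>\<delta> = (vc A (fst \<alpha>\<beta>) (fst \<gamma>\<delta>), vc B (snd \<alpha>\<beta>) (snd \<gamma>\<delta>))"
  "hc1 (prod_cells A B) fg hk = (hc1 A (fst fg) (fst hk), hc1 B (snd fg) (snd hk))"
  "hc2 (prod_cells A B) \<alpha>\<beta> \<gamma>\<delta> = (hc2 A (fst \<alpha>\<beta>) (fst \<gamma>\<delta>), hc2 B (snd \<alpha>\<beta>) (snd \<gamma>\<delta>))"
  by (simp_all add: prod_cells_def map_prod_def split: prod.splits)

lemma two_category_prod_cells:
  fixes A :: "('o, 'f, 't) cells" and B :: "('p, 'g, 's) cells"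
  assumes "two_category A" "two_category B"
  shows "two_category (prod_cells A B)"
proof -
  interpret A: two_category A by fact
  interpret B: two_category B by fact
  have "hom_categories (prod_cells A B)"
    by (rule hom_categoriesI)
      (auto simp: A.vc_vc B.vc_vc A.hc2_id2 B.hc2_id2 A.hc2_vc B.hc2_vc)
  then show ?thesis
    by (rule two_categoryI) (auto simp: A.hc1_hc1 B.hc1_hc1 A.hc2_hc2 B.hc2_hc2)
qed

context two_functor
begin

declare ob_map_in [simp] cell_map_id2 [simp] arr_map_unit1 [simp]

lemma Arr_arr_map [simp]: "f \<in> Arr A \<Longrightarrow> arr_map T f \<in> Arr B"
  and src_arr_map [simp]: "f \<in> Arr A \<Longrightarrow> src B (arr_map T f) = ob_map T (src A f)"
  and trg_arr_map [simp]: "f \<in> Arr A \<Longrightarrow> trg B (arr_map T f) = ob_map T (trg A f)"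
  using arr_map_hom[of f "src A f" "trg A f"] by (auto simp: hom1_def)

lemma Cell_cell_map [simp]: "\<alpha> \<in> Cell A \<Longrightarrow> cell_map T \<alpha> \<in> Cell B"
  and dm_cell_map [simp]: "\<alpha> \<in> Cell A \<Longrightarrow> dm B (cell_map T \<alpha>) = arr_map T (dm A \<alpha>)"
  and cd_cell_map [simp]: "\<alpha> \<in> Cell A \<Longrightarrow> cd B (cell_map T \<alpha>) = arr_map T (cd A \<alpha>)"
  using cell_map_hom[of \<alpha> "dm A \<alpha>" "cd A \<alpha>"] by (auto simp: hom2_def)

lemma cell_map_vc_eq:
    "\<lbrakk>\<beta> \<in> Cell A; \<alpha> \<in> Cell A; dm A \<beta> = cd A \<alpha>\<rbrakk> \<Longrightarrow>
      cell_map T (\<beta> \<bullet>\<^bsub>A\<^esub> \<alpha>) = cell_map T \<beta> \<bullet>\<^bsub>B\<^esub> cell_map T \<alpha>"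
  and arr_map_hc1_eq:
    "\<lbrakk>f \<in> Arr A; g \<in> Arr A; src A f = trg A g\<rbrakk> \<Longrightarrow>
      arr_map T (f \<star>\<^bsub>A\<^esub> g) = arr_map T f \<star>\<^bsub>B\<^esub> arr_map T g"
  and cell_map_hc2_eq:
    "\<lbrakk>\<alpha> \<in> Cell A; \<beta> \<in> Cell A; src A (dm A \<alpha>) = trg A (dm A \<beta>)\<rbrakk> \<Longrightarrow>
      cell_map T (\<alpha> \<Zstar>\<^bsub>A\<^esub> \<beta>) = cell_map T \<alpha> \<Zstar>\<^bsub>B\<^esub> cell_map T \<beta>"
  using cell_map_vc[of \<alpha> "dm A \<alpha>" "cd A \<alpha>" \<beta> "cd A \<beta>"]
    arr_map_hc1[of f "trg A g" "trg A f" g "src A g"]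
    cell_map_hc2[of \<alpha> "dm A \<alpha>" "cd A \<alpha>" \<beta> "dm A \<beta>" "cd A \<beta>"]
  by (auto simp: hom1_def hom2_def)

end

lemma two_functorI:
  assumes "two_category A" "two_category B"
    and "\<And>x. x \<in> Ob A \<Longrightarrow> ob_map T x \<in> Ob B"
    and "\<And>f. f \<in> Arr A \<Longrightarrow> arr_map T f \<in> Arr B \<and> src B (arr_map T f) = ob_map T (src A f)
      \<and> trg B (arr_map T f) = ob_map T (trg A f)"
    and "\<And>\<alpha>. \<alpha> \<in> Cell A \<Longrightarrow> cell_map T \<alpha> \<in> Cell B \<and> dm B (cell_map T \<alpha>) = arr_map T (dm A \<alpha>)
      \<and> cd B (cell_map T \<alpha>) = arr_map T (cd A \<alpha>)"
    and "\<And>f. f \<in> Arr A \<Longrightarrow> cell_map T (id2 A f) = id2 B (arr_map T f)"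
    and "\<And>\<beta> \<alpha>. \<lbrakk>\<beta> \<in> Cell A; \<alpha> \<in> Cell A; dm A \<beta> = cd A \<alpha>\<rbrakk> \<Longrightarrow>
      cell_map T (\<beta> \<bullet>\<^bsub>A\<^esub> \<alpha>) = cell_map T \<beta> \<bullet>\<^bsub>B\<^esub> cell_map T \<alpha>"
    and "\<And>x. x \<in> Ob A \<Longrightarrow> arr_map T (unit1 A x) = unit1 B (ob_map T x)"
    and "\<And>f g. \<lbrakk>f \<in> Arr A; g \<in> Arr A; src A f = trg A g\<rbrakk> \<Longrightarrow>
      arr_map T (f \<star>\<^bsub>A\<^esub> g) = arr_map T f \<star>\<^bsub>B\<^esub> arr_map T g"
    and "\<And>\<alpha> \<beta>. \<lbrakk>\<alpha> \<in> Cell A; \<beta> \<in> Cell A; src A (dm A \<alpha>) = trg A (dm A \<beta>)\<rbrakk> \<Longrightarrow>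
      cell_map T (\<alpha> \<Zstar>\<^bsub>A\<^esub> \<beta>) = cell_map T \<alpha> \<Zstar>\<^bsub>B\<^esub> cell_map T \<beta>"
  shows "two_functor A B T"
proof -
  interpret A: two_category A by fact
  interpret B: two_category B by fact
  show ?thesis
    by unfold_locales (use assms(3-) in \<open>auto simp: hom1_def hom2_def\<close>)
qed

lemma two_functor_id_map:
  assumes "two_category A"
  shows "two_functor A A id_map"
proof -
  interpret two_category A by fact
  show ?thesis
    by (rule two_functorI) (simp_all add: assms id_map_def)
qed

text \<open>
  A 2-category with a 2-functor \<open>A \<times> A \<rightarrow> A\<close>; the functors of three variables and of one
  variable built from it are 2-functors.
\<close>

locale tensor_2category = two_functor "prod_cells A A" A T
  for A :: "('o, 'f, 't) cells" and T :: "('o, 'f, 't) tensor"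
begin

lemma two_functor_tensor_left:
  "two_functor (prod_cells (prod_cells A A) A) A (tensor_left T)"
  by (rule two_functorI)
    (auto simp: tensor_left_def two_category_prod_cells B.two_category_axioms
      simp flip: cell_map_id2 cell_map_vc_eq arr_map_unit1 arr_map_hc1_eq cell_map_hc2_eq)

lemma two_functor_tensor_right:
  "two_functor (prod_cells (prod_cells A A) A) A (tensor_right T)"
  by (rule two_functorI)
    (auto simp: tensor_right_def two_category_prod_cells B.two_category_axioms
      simp flip: cell_map_id2 cell_map_vc_eq arr_map_unit1 arr_map_hc1_eq cell_map_hc2_eq)

lemma two_functor_unit_tensor: "I \<in> Ob A \<Longrightarrow> two_functor A A (unit_tensor A T I)"
  by (rule two_functorI)
    (auto simp: unit_tensor_def B.two_category_axioms
      simp flip: cell_map_id2 cell_map_vc_eq arr_map_unit1 arr_map_hc1_eq cell_map_hc2_eq)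

lemma two_functor_tensor_unit: "I \<in> Ob A \<Longrightarrow> two_functor A A (tensor_unit A T I)"
  by (rule two_functorI)
    (auto simp: tensor_unit_def B.two_category_axioms
      simp flip: cell_map_id2 cell_map_vc_eq arr_map_unit1 arr_map_hc1_eq cell_map_hc2_eq)

end


section \<open>Products of bicategories, functors and icons\<close>

text \<open>
  The hypothesis is needed because the composability condition for \<^const>\<open>hc2\<close> reads the
  source of the domain of a 2-cell, and trimming forgets the source of anything that is not a 1-cell.
\<close>

lemma trim_bicat_idem:
  "(\<And>\<alpha>. \<alpha> \<in> Cell B \<Longrightarrow> dm B \<alpha> \<in> Arr B) \<Longrightarrow> trim_bicat (trim_bicat B) = trim_bicat B"
  by (auto simp: trim_bicat_def fun_eq_iff restrict_def)

text \<open>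
  An injective coding \<open>pr\<close> of pairs. Every cell of a product is of the form \<open>pr (x, y)\<close>,
  and on such cells all operations are computed in each factor.
\<close>

locale pairing =
  fixes pr :: "'u \<times> 'u \<Rightarrow> 'u"
  assumes inj_pr: "inj pr"
begin

lemma pr_eq [simp]: "pr x = pr y \<longleftrightarrow> x = y"
  using inj_pr by (auto dest: injD)

lemma inv_pr [simp]: "inv pr (pr x) = x"
  using inj_pr by simp

lemma pr_in [simp]: "pr x \<in> pr ` S \<longleftrightarrow> x \<in> S"
  using inj_pr by (rule inj_image_mem_iff)

lemma pair_simps [simp]:
  "pair1 pr p q (pr (x, x')) = pr (p x, q x')"
  "pair2 pr p2 q2 (pr (x, x')) (pr (y, y')) = pr (p2 x y, q2 x' y')"
  "pair3 pr p3 q3 (pr (x, x')) (pr (y, y')) (pr (z, z')) = pr (p3 x y z, q3 x' y' z')"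
  by (simp_all add: pair1_def pair2_def pair3_def)

lemma prod_bicat_simps [simp]:
  "Ob (prod_bicat pr B C) = pr ` (Ob B \<times> Ob C)"
  "Arr (prod_bicat pr B C) = pr ` (Arr B \<times> Arr C)"
  "Cell (prod_bicat pr B C) = pr ` (Cell B \<times> Cell C)"
  "\<lbrakk>f \<in> Arr B; f' \<in> Arr C\<rbrakk> \<Longrightarrow> src (prod_bicat pr B C) (pr (f, f')) = pr (src B f, src C f')"
  "\<lbrakk>f \<in> Arr B; f' \<in> Arr C\<rbrakk> \<Longrightarrow> trg (prod_bicat pr B C) (pr (f, f')) = pr (trg B f, trg C f')"
  "\<lbrakk>\<alpha> \<in> Cell B; \<alpha>' \<in> Cell C\<rbrakk> \<Longrightarrow> dm (prod_bicat pr B C) (pr (\<alpha>, \<alpha>')) = pr (dm B \<alpha>, dm C \<alpha>')"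
  "\<lbrakk>\<alpha> \<in> Cell B; \<alpha>' \<in> Cell C\<rbrakk> \<Longrightarrow> cd (prod_bicat pr B C) (pr (\<alpha>, \<alpha>')) = pr (cd B \<alpha>, cd C \<alpha>')"
  "\<lbrakk>f \<in> Arr B; f' \<in> Arr C\<rbrakk> \<Longrightarrow> id2 (prod_bicat pr B C) (pr (f, f')) = pr (id2 B f, id2 C f')"
  "\<lbrakk>\<beta> \<in> Cell B; \<alpha> \<in> Cell B; dm B \<beta> = cd B \<alpha>; \<beta>' \<in> Cell C; \<alpha>' \<in> Cell C; dm C \<beta>' = cd C \<alpha>'\<rbrakk> \<Longrightarrow>
    vc (prod_bicat pr B C) (pr (\<beta>, \<beta>')) (pr (\<alpha>, \<alpha>')) = pr (vc B \<beta> \<alpha>, vc C \<beta>' \<alpha>')"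
  "\<lbrakk>a \<in> Ob B; a' \<in> Ob C\<rbrakk> \<Longrightarrow>
    unit1 (prod_bicat pr B C) (pr (a, a')) = pr (unit1 B a, unit1 C a')"
  "\<lbrakk>f \<in> Arr B; g \<in> Arr B; src B f = trg B g; f' \<in> Arr C; g' \<in> Arr C; src C f' = trg C g'\<rbrakk> \<Longrightarrow>
    hc1 (prod_bicat pr B C) (pr (f, f')) (pr (g, g')) = pr (hc1 B f g, hc1 C f' g')"
  "\<lbrakk>\<alpha> \<in> Cell B; \<beta> \<in> Cell B; src B (dm B \<alpha>) = trg B (dm B \<beta>);
    \<alpha>' \<in> Cell C; \<beta>' \<in> Cell C; src C (dm C \<alpha>') = trg C (dm C \<beta>')\<rbrakk> \<Longrightarrow>
    hc2 (prod_bicat pr B C) (pr (\<alpha>, \<alpha>')) (pr (\<beta>, \<beta>')) = pr (hc2 B \<alpha> \<beta>, hc2 C \<alpha>' \<beta>')"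
  "\<lbrakk>f \<in> Arr B; g \<in> Arr B; h \<in> Arr B; src B f = trg B g; src B g = trg B h;
    f' \<in> Arr C; g' \<in> Arr C; h' \<in> Arr C; src C f' = trg C g'; src C g' = trg C h'\<rbrakk> \<Longrightarrow>
    assoc (prod_bicat pr B C) (pr (f, f')) (pr (g, g')) (pr (h, h'))
      = pr (assoc B f g h, assoc C f' g' h')"
  "\<lbrakk>f \<in> Arr B; f' \<in> Arr C\<rbrakk> \<Longrightarrow>
    lunit (prod_bicat pr B C) (pr (f, f')) = pr (lunit B f, lunit C f')"
  "\<lbrakk>f \<in> Arr B; f' \<in> Arr C\<rbrakk> \<Longrightarrow>
    runit (prod_bicat pr B C) (pr (f, f')) = pr (runit B f, runit C f')"
  by (simp_all add: prod_bicat_def trim_bicat_def)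

lemma prod_pfun_simps [simp]:
  "Src (prod_pfun pr F G) = prod_bicat pr (Src F) (Src G)"
  "Trg (prod_pfun pr F G) = prod_bicat pr (Trg F) (Trg G)"
  "trim_pfun (prod_pfun pr F G) = prod_pfun pr F G"
  "\<lbrakk>a \<in> Ob (Src F); a' \<in> Ob (Src G)\<rbrakk> \<Longrightarrow>
    on0 (prod_pfun pr F G) (pr (a, a')) = pr (on0 F a, on0 G a')"
  "\<lbrakk>f \<in> Arr (Src F); f' \<in> Arr (Src G)\<rbrakk> \<Longrightarrow>
    on1 (prod_pfun pr F G) (pr (f, f')) = pr (on1 F f, on1 G f')"
  "\<lbrakk>\<alpha> \<in> Cell (Src F); \<alpha>' \<in> Cell (Src G)\<rbrakk> \<Longrightarrow>
    on2 (prod_pfun pr F G) (pr (\<alpha>, \<alpha>')) = pr (on2 F \<alpha>, on2 G \<alpha>')"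
  "\<lbrakk>a \<in> Ob (Src F); a' \<in> Ob (Src G)\<rbrakk> \<Longrightarrow>
    phi0 (prod_pfun pr F G) (pr (a, a')) = pr (phi0 F a, phi0 G a')"
  "\<lbrakk>f \<in> Arr (Src F); g \<in> Arr (Src F); src (Src F) f = trg (Src F) g;
    f' \<in> Arr (Src G); g' \<in> Arr (Src G); src (Src G) f' = trg (Src G) g'\<rbrakk> \<Longrightarrow>
    phi2 (prod_pfun pr F G) (pr (f, f')) (pr (g, g')) = pr (phi2 F f g, phi2 G f' g')"
  by (simp_all add: prod_pfun_def) (simp_all add: trim_pfun_def)

lemma prod_icon_simps [simp]:
  "Dom (prod_icon pr \<alpha> \<beta>) = prod_pfun pr (Dom \<alpha>) (Dom \<beta>)"
  "Cod (prod_icon pr \<alpha> \<beta>) = prod_pfun pr (Cod \<alpha>) (Cod \<beta>)"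
  "trim_icon (prod_icon pr \<alpha> \<beta>) = prod_icon pr \<alpha> \<beta>"
  "\<lbrakk>f \<in> Arr (Src (Dom \<alpha>)); f' \<in> Arr (Src (Dom \<beta>))\<rbrakk> \<Longrightarrow>
    component (prod_icon pr \<alpha> \<beta>) (pr (f, f')) = pr (component \<alpha> f, component \<beta> f')"
  by (simp_all add: prod_icon_def) (simp_all add: trim_icon_def)

lemma hom_categories_prod_bicat:
  assumes "hom_categories B" "hom_categories C"
  shows "hom_categories (prod_bicat pr B C)"
proof -
  interpret B: hom_categories B by fact
  interpret C: hom_categories C by fact
  show ?thesis
    by (rule hom_categoriesI)
      (auto simp: B.vc_vc C.vc_vc B.hc2_id2 C.hc2_id2 B.hc2_vc C.hc2_vc)
qed

lemma trim_prod_bicat: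
  assumes "hom_categories B" "hom_categories C"
  shows "trim_bicat (prod_bicat pr B C) = prod_bicat pr B C"
proof -
  interpret B: hom_categories B by fact
  interpret C: hom_categories C by fact
  show ?thesis
    unfolding prod_bicat_def by (rule trim_bicat_idem) auto
qed

lemma iso2_prod_bicat:
  assumes "hom_categories B" "hom_categories C" "iso2 B \<alpha>" "iso2 C \<beta>"
  shows "iso2 (prod_bicat pr B C) (pr (\<alpha>, \<beta>))"
proof -
  interpret B: hom_categories B by fact
  interpret C: hom_categories C by fact
  interpret P: hom_categories "prod_bicat pr B C"
    using assms(1,2) by (rule hom_categories_prod_bicat)
  obtain \<alpha>' where \<alpha>: "\<alpha> \<in> Cell B" "\<alpha>' \<in> Cell B" "dm B \<alpha>' = cd B \<alpha>" "cd B \<alpha>' = dm B \<alpha>"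
    "\<alpha>' \<bullet>\<^bsub>B\<^esub> \<alpha> = id2 B (dm B \<alpha>)" "\<alpha> \<bullet>\<^bsub>B\<^esub> \<alpha>' = id2 B (cd B \<alpha>)"
    using assms(3) by (rule B.iso2E)
  obtain \<beta>' where \<beta>: "\<beta> \<in> Cell C" "\<beta>' \<in> Cell C" "dm C \<beta>' = cd C \<beta>" "cd C \<beta>' = dm C \<beta>"
    "\<beta>' \<bullet>\<^bsub>C\<^esub> \<beta> = id2 C (dm C \<beta>)" "\<beta> \<bullet>\<^bsub>C\<^esub> \<beta>' = id2 C (cd C \<beta>)"
    using assms(4) by (rule C.iso2E)
  show ?thesis
    by (rule P.iso2I[of _ "pr (\<alpha>', \<beta>')"]) (simp_all add: \<alpha> \<beta>)
qed

lemma bicategory_prod_bicat: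
  assumes "bicategory B" "bicategory C"
  shows "bicategory (prod_bicat pr B C)"
proof -
  interpret B: bicategory B by fact
  interpret C: bicategory C by fact
  note iso = iso2_prod_bicat[OF B.hom_categories_axioms C.hom_categories_axioms]
  have "hom_categories (prod_bicat pr B C)"
    by (rule hom_categories_prod_bicat) unfold_locales
  then show ?thesis
    by (rule bicategoryI)
      (auto simp: iso B.iso2_assoc C.iso2_assoc B.assoc_naturality C.assoc_naturality
        B.lunit_iso C.lunit_iso B.lunit_naturality C.lunit_naturality
        B.runit_iso C.runit_iso B.runit_naturality C.runit_naturality
        B.pentagon' C.pentagon' B.triangle' C.triangle')
qed

lemma pseudofunctor_prod_pfun:
  assumes "pseudofunctor B C F" "pseudofunctor B' C' F'"
  shows "pseudofunctor (prod_bicat pr B B') (prod_bicat pr C C') (prod_pfun pr F F')"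
proof -
  interpret F: pseudofunctor B C F by fact
  interpret F': pseudofunctor B' C' F' by fact
  note iso = iso2_prod_bicat[OF F.C.hom_categories_axioms F'.C.hom_categories_axioms]
  show ?thesis
  proof (rule pseudofunctorI)
    show "bicategory (prod_bicat pr B B')" "bicategory (prod_bicat pr C C')"
      by (rule bicategory_prod_bicat; unfold_locales)+
  qed (auto simp: iso F.on2_vc_eq F'.on2_vc_eq F.phi0_iso F'.phi0_iso F.iso2_phi2 F'.iso2_phi2
      F.phi2_naturality F'.phi2_naturality F.phi2_associativity F'.phi2_associativity
      F.phi0_lunit F'.phi0_lunit F.phi0_runit F'.phi0_runit)
qed

lemma icon_prod_icon:
  assumes "icon B C F G \<alpha>" "icon B' C' F' G' \<alpha>'"
  shows "icon (prod_bicat pr B B') (prod_bicat pr C C') (prod_pfun pr F F') (prod_pfun pr G G')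
    (prod_icon pr \<alpha> \<alpha>')"
proof -
  interpret \<alpha>: icon B C F G \<alpha> by fact
  interpret \<alpha>': icon B' C' F' G' \<alpha>' by fact
  note \<alpha>.agree_on_objects [simp] \<alpha>'.agree_on_objects [simp]
  show ?thesis
  proof (rule iconI)
    show "pseudofunctor (prod_bicat pr B B') (prod_bicat pr C C') (prod_pfun pr F F')"
      "pseudofunctor (prod_bicat pr B B') (prod_bicat pr C C') (prod_pfun pr G G')"
      by (rule pseudofunctor_prod_pfun; unfold_locales)+
  qed (auto simp: \<alpha>.component_naturality \<alpha>'.component_naturality \<alpha>.comp_phi0 \<alpha>'.comp_phi0
      \<alpha>.component_hc1 \<alpha>'.component_hc1)
qed

lemma prod_pfun_comp_pfun:
  assumes "pseudofunctor B C F" "pseudofunctor C D G" "pseudofunctor B' C' F'" "pseudofunctor C' D' G'"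
  shows "prod_pfun pr (comp_pfun G F) (comp_pfun G' F')
    = comp_pfun (prod_pfun pr G G') (prod_pfun pr F F')"
proof -
  interpret F: pseudofunctor B C F by fact
  interpret G: pseudofunctor C D G by fact
  interpret F': pseudofunctor B' C' F' by fact
  interpret G': pseudofunctor C' D' G' by fact
  show ?thesis
    by (rule pfun_eqI) auto
qed

lemma prod_pfun_strict_pfun:
  "prod_pfun pr (strict_pfun B C p q r) (strict_pfun B' C' p' q' r')
    = strict_pfun (prod_bicat pr B B') (prod_bicat pr C C') (pair1 pr p p') (pair1 pr q q') (pair1 pr r r')"
  if "strict_morphism B C p q r" "strict_morphism B' C' p' q' r'"
proof -
  interpret F: strict_morphism B C p q r by fact
  interpret F': strict_morphism B' C' p' q' r' by fact
  show ?thesis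
    by (rule pfun_eqI) auto
qed

lemma prod_icon_id_icon:
  assumes "pseudofunctor B C F" "pseudofunctor B' C' F'"
  shows "prod_icon pr (id_icon F) (id_icon F') = id_icon (prod_pfun pr F F')"
proof -
  interpret F: pseudofunctor B C F by fact
  interpret F': pseudofunctor B' C' F' by fact
  show ?thesis
    by (rule icon_eqI) auto
qed

lemma prod_icon_vcomp_icon:
  assumes "icon B C F G \<alpha>" "icon B C G H \<beta>" "icon B' C' F' G' \<alpha>'" "icon B' C' G' H' \<beta>'"
  shows "prod_icon pr (vcomp_icon \<beta> \<alpha>) (vcomp_icon \<beta>' \<alpha>')
    = vcomp_icon (prod_icon pr \<beta> \<beta>') (prod_icon pr \<alpha> \<alpha>')"
proof -
  interpret \<alpha>: icon B C F G \<alpha> by fact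
  interpret \<beta>: icon B C G H \<beta> by fact
  interpret \<alpha>': icon B' C' F' G' \<alpha>' by fact
  interpret \<beta>': icon B' C' G' H' \<beta>' by fact
  show ?thesis
    by (rule icon_eqI) auto
qed

lemma prod_icon_hcomp_icon:
  assumes "icon B C F G \<alpha>" "icon C D H K \<gamma>" "icon B' C' F' G' \<alpha>'" "icon C' D' H' K' \<gamma>'"
  shows "prod_icon pr (hcomp_icon \<gamma> \<alpha>) (hcomp_icon \<gamma>' \<alpha>')
    = hcomp_icon (prod_icon pr \<gamma> \<gamma>') (prod_icon pr \<alpha> \<alpha>')"
proof -
  interpret \<alpha>: icon B C F G \<alpha> by fact
  interpret \<gamma>: icon C D H K \<gamma> by fact
  interpret \<alpha>': icon B' C' F' G' \<alpha>' by fact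
  interpret \<gamma>': icon C' D' H' K' \<gamma>' by fact
  have comps: "prod_pfun pr (comp_pfun H F) (comp_pfun H' F')
      = comp_pfun (prod_pfun pr H H') (prod_pfun pr F F')"
    "prod_pfun pr (comp_pfun K G) (comp_pfun K' G')
      = comp_pfun (prod_pfun pr K K') (prod_pfun pr G G')"
    by (rule prod_pfun_comp_pfun; unfold_locales)+
  show ?thesis
    by (rule icon_eqI) (auto simp: comps)
qed

lemma cartesian_product_simps [simp]:
  "ob_map (cartesian_product pr) (B, C) = prod_bicat pr B C"
  "arr_map (cartesian_product pr) (F, G) = prod_pfun pr F G"
  "cell_map (cartesian_product pr) (\<alpha>, \<beta>) = prod_icon pr \<alpha> \<beta>"
  by (simp_all add: cartesian_product_def)

lemma prod_bicat_bicategories [simp]: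
  "\<lbrakk>B \<in> bicategories; C \<in> bicategories\<rbrakk> \<Longrightarrow> prod_bicat pr B C \<in> bicategories"
  unfolding bicategories_def by (simp add: bicategory_prod_bicat trim_prod_bicat bicategory.axioms(1))

lemma prod_pfun_functors [simp]:
  "\<lbrakk>F \<in> functors; G \<in> functors\<rbrakk> \<Longrightarrow> prod_pfun pr F G \<in> functors"
  by (rule functorsI[OF pseudofunctor_prod_pfun[OF functorsD[OF _ refl refl] functorsD[OF _ refl refl]]])
    simp_all

lemma prod_icon_icons [simp]:
  "\<lbrakk>\<alpha> \<in> icons; \<beta> \<in> icons\<rbrakk> \<Longrightarrow> prod_icon pr \<alpha> \<beta> \<in> icons"
  by (rule iconsI[OF icon_prod_icon[OF iconsD[OF _ refl refl refl refl] iconsD[OF _ refl refl refl refl]]])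
    simp_all

lemma prod_pfun_id_pfun:
  assumes "bicategory B" "bicategory C"
  shows "prod_pfun pr (id_pfun B) (id_pfun C) = id_pfun (prod_bicat pr B C)"
proof -
  interpret B: bicategory B by fact
  interpret C: bicategory C by fact
  show ?thesis
    by (rule pfun_eqI) auto
qed

theorem two_functor_cartesian_product:
  "two_functor (prod_cells Icon Icon) Icon (cartesian_product pr)"
proof (rule two_functorI)
  show "two_category (Icon :: ('u small_bicat, 'u small_pfun, 'u small_icon) cells)"
    "two_category (prod_cells Icon Icon :: ('u small_bicat \<times> 'u small_bicat, _, _) cells)"
    by (intro two_category_prod_cells two_category_Icon)+
  \<comment> \<open>these variants fix the bicategories and functors of a composable pair in terms of its factors\<close>
  note pf = functorsD[OF _ refl refl] functorsD[OF _ _ refl]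
  note ic = iconsD[OF _ refl refl refl refl] iconsD[OF _ _ refl] iconsD[OF _ refl refl _ refl]
  show "cell_map (cartesian_product pr) (\<beta> \<bullet>\<^bsub>prod_cells Icon Icon\<^esub> \<alpha>)
      = cell_map (cartesian_product pr) \<beta> \<bullet>\<^bsub>Icon\<^esub> cell_map (cartesian_product pr) \<alpha>"
    if "\<beta> \<in> Cell (prod_cells Icon Icon)" "\<alpha> \<in> Cell (prod_cells Icon Icon)"
      "dm (prod_cells Icon Icon) \<beta> = cd (prod_cells Icon Icon) \<alpha>" for \<beta> \<alpha>
    using that by (auto intro!: prod_icon_vcomp_icon[OF ic(1,2,1,2)])
  show "cell_map (cartesian_product pr) (\<gamma> \<Zstar>\<^bsub>prod_cells Icon Icon\<^esub> \<alpha>)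
      = cell_map (cartesian_product pr) \<gamma> \<Zstar>\<^bsub>Icon\<^esub> cell_map (cartesian_product pr) \<alpha>"
    if "\<gamma> \<in> Cell (prod_cells Icon Icon)" "\<alpha> \<in> Cell (prod_cells Icon Icon)"
      "src (prod_cells Icon Icon) (dm (prod_cells Icon Icon) \<gamma>)
        = trg (prod_cells Icon Icon) (dm (prod_cells Icon Icon) \<alpha>)" for \<gamma> \<alpha>
    using that by (auto intro!: prod_icon_hcomp_icon[OF ic(1,3,1,3)])
  show "arr_map (cartesian_product pr) (G \<star>\<^bsub>prod_cells Icon Icon\<^esub> F)
      = arr_map (cartesian_product pr) G \<star>\<^bsub>Icon\<^esub> arr_map (cartesian_product pr) F"
    if "G \<in> Arr (prod_cells Icon Icon)" "F \<in> Arr (prod_cells Icon Icon)"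
      "src (prod_cells Icon Icon) G = trg (prod_cells Icon Icon) F" for G F
    using that by (auto intro!: prod_pfun_comp_pfun[OF pf(1,2,1,2)])
qed (auto intro!: prod_icon_id_icon[OF functorsD[OF _ refl refl] functorsD[OF _ refl refl]]
    prod_pfun_id_pfun bicategoriesD)

end


section \<open>Strict functors\<close>

lemma strict_pfun_eqI:
  assumes "\<And>a. a \<in> Ob B \<Longrightarrow> p a = p' a" "\<And>f. f \<in> Arr B \<Longrightarrow> q f = q' f"
    "\<And>\<alpha>. \<alpha> \<in> Cell B \<Longrightarrow> r \<alpha> = r' \<alpha>"
  shows "strict_pfun B C p q r = strict_pfun B C p' q' r'"
  by (rule pfun_eqI) (simp_all add: assms)

lemma strict_morphism_id: "bicategory B \<Longrightarrow> strict_morphism B B (\<lambda>a. a) (\<lambda>f. f) (\<lambda>\<alpha>. \<alpha>)"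
proof -
  assume "bicategory B"
  then interpret bicategory B .
  show ?thesis
    by unfold_locales simp_all
qed

lemma strict_morphism_comp:
  assumes "strict_morphism B C p q r" "strict_morphism C D p' q' r'"
  shows "strict_morphism B D (p' \<circ> p) (q' \<circ> q) (r' \<circ> r)"
proof -
  interpret S: strict_morphism B C p q r by fact
  interpret T: strict_morphism C D p' q' r' by fact
  show ?thesis
    by unfold_locales simp_all
qed

lemma comp_pfun_strict_pfun:
  assumes "strict_morphism B C p q r" "strict_morphism C D p' q' r'"
  shows "comp_pfun (strict_pfun C D p' q' r') (strict_pfun B C p q r)
    = strict_pfun B D (p' \<circ> p) (q' \<circ> q) (r' \<circ> r)"
proof -
  interpret S: strict_morphism B C p q r by fact
  interpret T: strict_morphism C D p' q' r' by fact
  show ?thesis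
    by (rule pfun_eqI) simp_all
qed

lemma strict_pfun_functors:
  assumes "B \<in> bicategories" "C \<in> bicategories" "strict_morphism B C p q r"
  shows "strict_pfun B C p q r \<in> functors"
proof -
  interpret strict_morphism B C p q r by fact
  show ?thesis
    by (rule functorsI[OF pseudofunctor_axioms]) (simp_all add: assms)
qed

lemma iso1_strict_pfun:
  assumes "B \<in> bicategories" "C \<in> bicategories"
    and "strict_morphism B C p q r" "strict_morphism C B p' q' r'"
    and "\<And>a. a \<in> Ob B \<Longrightarrow> p' (p a) = a" "\<And>f. f \<in> Arr B \<Longrightarrow> q' (q f) = f"
      "\<And>\<alpha>. \<alpha> \<in> Cell B \<Longrightarrow> r' (r \<alpha>) = \<alpha>"
    and "\<And>a. a \<in> Ob C \<Longrightarrow> p (p' a) = a" "\<And>f. f \<in> Arr C \<Longrightarrow> q (q' f) = f"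
      "\<And>\<alpha>. \<alpha> \<in> Cell C \<Longrightarrow> r (r' \<alpha>) = \<alpha>"
  shows "iso1 Icon (strict_pfun B C p q r)"
proof -
  have "comp_pfun (strict_pfun C B p' q' r') (strict_pfun B C p q r) = id_pfun B"
    "comp_pfun (strict_pfun B C p q r) (strict_pfun C B p' q' r') = id_pfun C"
    using assms(3-)
    by (auto simp: comp_pfun_strict_pfun id_pfun_eq_strict_pfun intro: strict_pfun_eqI)
  moreover have "strict_pfun B C p q r \<in> functors" "strict_pfun C B p' q' r' \<in> functors"
    by (rule strict_pfun_functors; fact)+
  ultimately show ?thesis
    unfolding iso1_def by (auto simp: hom1_def intro!: exI[of _ "strict_pfun C B p' q' r'"])
qed

text \<open>
  Since the constraints of a strict functor are identities, a square with two strict sides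
  commutes as soon as the cell maps and the constraints of the other two sides correspond.
\<close>

lemma strict_pfun_natural:
  assumes "pseudofunctor B C F" "pseudofunctor B' C' F'"
    and "strict_morphism B B' p q r" "strict_morphism C C' p' q' r'"
    and "\<And>a. a \<in> Ob B \<Longrightarrow> on0 F' (p a) = p' (on0 F a)"
    and "\<And>f. f \<in> Arr B \<Longrightarrow> on1 F' (q f) = q' (on1 F f)"
    and "\<And>\<alpha>. \<alpha> \<in> Cell B \<Longrightarrow> on2 F' (r \<alpha>) = r' (on2 F \<alpha>)"
    and "\<And>a. a \<in> Ob B \<Longrightarrow> phi0 F' (p a) = r' (phi0 F a)"
    and "\<And>f g. \<lbrakk>f \<in> Arr B; g \<in> Arr B; src B f = trg B g\<rbrakk> \<Longrightarrow>
      phi2 F' (q f) (q g) = r' (phi2 F f g)"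
  shows "comp_pfun F' (strict_pfun B B' p q r) = comp_pfun (strict_pfun C C' p' q' r') F"
proof -
  interpret F: pseudofunctor B C F by fact
  interpret F': pseudofunctor B' C' F' by fact
  interpret S: strict_morphism B B' p q r by fact
  interpret T: strict_morphism C C' p' q' r' by fact
  have "on1 F' (unit1 B' (p a)) = q' (on1 F (unit1 B a))" if "a \<in> Ob B" for a
    using assms(6)[of "unit1 B a"] that by simp
  moreover have "on1 F' (q f \<star>\<^bsub>B'\<^esub> q g) = q' (on1 F (f \<star>\<^bsub>B\<^esub> g))"
    if "f \<in> Arr B" "g \<in> Arr B" "src B f = trg B g" for f g
    using assms(6)[of "f \<star>\<^bsub>B\<^esub> g"] that by simp
  ultimately show ?thesis
    by - (rule pfun_eqI, simp_all add: assms(5-))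
qed

text \<open>
  The 2-dimensional counterpart: both sides whisker an icon with a strict functor, and such a
  whiskering only relabels components.
\<close>

lemma strict_icon_natural:
  assumes "icon B C F G \<alpha>" "icon B' C' F' G' \<alpha>'"
    and "strict_morphism B B' p q r" "strict_morphism C C' p' q' r'"
    and "comp_pfun F' (strict_pfun B B' p q r) = comp_pfun (strict_pfun C C' p' q' r') F"
    and "comp_pfun G' (strict_pfun B B' p q r) = comp_pfun (strict_pfun C C' p' q' r') G"
    and "\<And>f. f \<in> Arr B \<Longrightarrow> component \<alpha>' (q f) = r' (component \<alpha> f)"
  shows "hcomp_icon \<alpha>' (id_icon (strict_pfun B B' p q r))
    = hcomp_icon (id_icon (strict_pfun C C' p' q' r')) \<alpha>"
proof -
  interpret \<alpha>: icon B C F G \<alpha> by fact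
  interpret \<alpha>': icon B' C' F' G' \<alpha>' by fact
  interpret S: strict_morphism B B' p q r by fact
  interpret T: strict_morphism C C' p' q' r' by fact
  show ?thesis
  proof (rule icon_eqI, goal_cases)
    case (5 f)
    then have f: "f \<in> Arr B"
      by simp
    then have "component \<alpha>' (q f) \<bullet>\<^bsub>C'\<^esub> id2 C' (on1 F' (q f)) = component \<alpha>' (q f)"
      by simp
    moreover have "id2 C' (q' (on1 G f)) \<bullet>\<^bsub>C'\<^esub> r' (component \<alpha> f) = r' (component \<alpha> f)"
      using f by simp
    ultimately show ?case
      using f by (simp add: assms(7))
  qed (simp_all add: assms(5,6))
qed

context pairing
begin

lemma strict_morphism_pair1:
  assumes "strict_morphism B C p q r" "strict_morphism B' C' p' q' r'"
  shows "strict_morphism (prod_bicat pr B B') (prod_bicat pr C C')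
    (pair1 pr p p') (pair1 pr q q') (pair1 pr r r')"
proof -
  interpret S: strict_morphism B C p q r by fact
  interpret T: strict_morphism B' C' p' q' r' by fact
  show ?thesis
  proof (intro strict_morphism.intro strict_morphism_axioms.intro)
    show "bicategory (prod_bicat pr B B')" "bicategory (prod_bicat pr C C')"
      by (rule bicategory_prod_bicat; unfold_locales)+
  qed auto
qed

end


section \<open>The coherence isomorphisms\<close>

text \<open>
  On codes of tuples, the rebracketing \<open>((x, y), z) \<mapsto> (x, (y, z))\<close> and its inverse. The
  same map is used on objects, 1-cells and 2-cells. The values on other elements are irrelevant.
\<close>

definition assoc_map :: "('u \<times> 'u \<Rightarrow> 'u) \<Rightarrow> 'u \<Rightarrow> 'u" where
  "assoc_map pr u = (case inv pr u of (xy, z) \<Rightarrow> case inv pr xy of (x, y) \<Rightarrow> pr (x, pr (y, z)))"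

definition assoc_map_inv :: "('u \<times> 'u \<Rightarrow> 'u) \<Rightarrow> 'u \<Rightarrow> 'u" where
  "assoc_map_inv pr u = (case inv pr u of (x, yz) \<Rightarrow> case inv pr yz of (y, z) \<Rightarrow> pr (pr (x, y), z))"

text \<open>
  The coherence 1-cells: rebracketing, and the projections that drop the factor in the terminal
  bicategory.
\<close>

definition associator ::
  "('u \<times> 'u \<Rightarrow> 'u) \<Rightarrow> 'u small_bicat \<Rightarrow> 'u small_bicat \<Rightarrow> 'u small_bicat \<Rightarrow> 'u small_pfun" where
  "associator pr B C D =
    strict_pfun (prod_bicat pr (prod_bicat pr B C) D) (prod_bicat pr B (prod_bicat pr C D))
      (assoc_map pr) (assoc_map pr) (assoc_map pr)"

definition left_unitor :: "('u \<times> 'u \<Rightarrow> 'u) \<Rightarrow> 'u \<Rightarrow> 'u small_bicat \<Rightarrow> 'u small_pfun" where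
  "left_unitor pr pt B = strict_pfun (prod_bicat pr (terminal_bicat pt) B) B
    (snd \<circ> inv pr) (snd \<circ> inv pr) (snd \<circ> inv pr)"

definition right_unitor :: "('u \<times> 'u \<Rightarrow> 'u) \<Rightarrow> 'u \<Rightarrow> 'u small_bicat \<Rightarrow> 'u small_pfun" where
  "right_unitor pr pt B = strict_pfun (prod_bicat pr B (terminal_bicat pt)) B
    (fst \<circ> inv pr) (fst \<circ> inv pr) (fst \<circ> inv pr)"

lemma coherence_pfun_simps [simp]:
  "Src (associator pr B C D) = prod_bicat pr (prod_bicat pr B C) D"
  "Trg (associator pr B C D) = prod_bicat pr B (prod_bicat pr C D)"
  "Src (left_unitor pr pt B) = prod_bicat pr (terminal_bicat pt) B" "Trg (left_unitor pr pt B) = B"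
  "Src (right_unitor pr pt B) = prod_bicat pr B (terminal_bicat pt)" "Trg (right_unitor pr pt B) = B"
  by (simp_all add: associator_def left_unitor_def right_unitor_def)

lemma terminal_bicat_simps [simp]:
  "Ob (terminal_bicat pt) = {pt}" "Arr (terminal_bicat pt) = {pt}" "Cell (terminal_bicat pt) = {pt}"
  "src (terminal_bicat pt) pt = pt" "trg (terminal_bicat pt) pt = pt"
  "dm (terminal_bicat pt) pt = pt" "cd (terminal_bicat pt) pt = pt"
  "id2 (terminal_bicat pt) pt = pt" "vc (terminal_bicat pt) pt pt = pt"
  "unit1 (terminal_bicat pt) pt = pt"
  "hc1 (terminal_bicat pt) pt pt = pt" "hc2 (terminal_bicat pt) pt pt = pt"
  "assoc (terminal_bicat pt) pt pt pt = pt"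
  "lunit (terminal_bicat pt) pt = pt" "runit (terminal_bicat pt) pt = pt"
  by (simp_all add: terminal_bicat_def trim_bicat_def)

lemma bicategory_terminal_bicat: "bicategory (terminal_bicat pt)"
proof (rule bicategoryI)
  show "hom_categories (terminal_bicat pt)"
    by (rule hom_categoriesI) simp_all
qed (simp_all add: iso2_def hom2_def)

lemma terminal_bicat_bicategories [simp]: "terminal_bicat pt \<in> bicategories"
  unfolding bicategories_def
  by (simp add: bicategory_terminal_bicat) (simp add: terminal_bicat_def trim_bicat_idem)

context pairing
begin

lemma assoc_map_pr [simp]: "assoc_map pr (pr (pr (x, y), z)) = pr (x, pr (y, z))"
  and assoc_map_inv_pr [simp]: "assoc_map_inv pr (pr (x, pr (y, z))) = pr (pr (x, y), z)"
  by (simp_all add: assoc_map_def assoc_map_inv_def)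

lemma strict_morphism_assoc_map:
  assumes "bicategory B" "bicategory C" "bicategory D"
  shows "strict_morphism (prod_bicat pr (prod_bicat pr B C) D) (prod_bicat pr B (prod_bicat pr C D))
      (assoc_map pr) (assoc_map pr) (assoc_map pr)" (is ?fwd)
    and "strict_morphism (prod_bicat pr B (prod_bicat pr C D)) (prod_bicat pr (prod_bicat pr B C) D)
      (assoc_map_inv pr) (assoc_map_inv pr) (assoc_map_inv pr)" (is ?bwd)
proof -
  interpret B: bicategory B by fact
  interpret C: bicategory C by fact
  interpret D: bicategory D by fact
  have prods: "bicategory (prod_bicat pr (prod_bicat pr B C) D)"
    "bicategory (prod_bicat pr B (prod_bicat pr C D))"
    by (simp_all add: assms bicategory_prod_bicat)
  show ?fwd
    by (intro strict_morphism.intro strict_morphism_axioms.intro prods) auto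
  show ?bwd
    by (intro strict_morphism.intro strict_morphism_axioms.intro prods) auto
qed

lemma strict_morphism_projections:
  assumes "bicategory B" "bicategory C"
  shows "strict_morphism (prod_bicat pr B C) B (fst \<circ> inv pr) (fst \<circ> inv pr) (fst \<circ> inv pr)" (is ?fst)
    and "strict_morphism (prod_bicat pr B C) C (snd \<circ> inv pr) (snd \<circ> inv pr) (snd \<circ> inv pr)" (is ?snd)
proof -
  interpret B: bicategory B by fact
  interpret C: bicategory C by fact
  have prod: "bicategory (prod_bicat pr B C)"
    using assms by (rule bicategory_prod_bicat)
  show ?fst
    by (intro strict_morphism.intro strict_morphism_axioms.intro prod assms) auto
  show ?snd
    by (intro strict_morphism.intro strict_morphism_axioms.intro prod assms) auto
qed

text \<open>
  The inverses of the unitors.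
\<close>

lemma strict_morphism_insert_point:
  assumes "bicategory B"
  shows "strict_morphism B (prod_bicat pr (terminal_bicat pt) B)
      (\<lambda>a. pr (pt, a)) (\<lambda>f. pr (pt, f)) (\<lambda>\<alpha>. pr (pt, \<alpha>))" (is ?left)
    and "strict_morphism B (prod_bicat pr B (terminal_bicat pt))
      (\<lambda>a. pr (a, pt)) (\<lambda>f. pr (f, pt)) (\<lambda>\<alpha>. pr (\<alpha>, pt))" (is ?right)
proof -
  interpret B: bicategory B by fact
  have prods: "bicategory (prod_bicat pr (terminal_bicat pt) B)"
    "bicategory (prod_bicat pr B (terminal_bicat pt))"
    by (simp_all add: assms bicategory_prod_bicat bicategory_terminal_bicat)
  show ?left
    by (intro strict_morphism.intro strict_morphism_axioms.intro prods assms) auto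
  show ?right
    by (intro strict_morphism.intro strict_morphism_axioms.intro prods assms) auto
qed

end

lemma two_natural_isoI:
  assumes "two_functor A B S" "two_functor A B T"
    and "\<And>x. x \<in> Ob A \<Longrightarrow> src B (\<theta> x) = ob_map S x \<and> trg B (\<theta> x) = ob_map T x \<and> iso1 B (\<theta> x)"
    and "\<And>f. f \<in> Arr A \<Longrightarrow>
      arr_map T f \<star>\<^bsub>B\<^esub> \<theta> (src A f) = \<theta> (trg A f) \<star>\<^bsub>B\<^esub> arr_map S f"
    and "\<And>\<alpha>. \<alpha> \<in> Cell A \<Longrightarrow> cell_map T \<alpha> \<Zstar>\<^bsub>B\<^esub> id2 B (\<theta> (src A (dm A \<alpha>)))
      = id2 B (\<theta> (trg A (dm A \<alpha>))) \<Zstar>\<^bsub>B\<^esub> cell_map S \<alpha>"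
  shows "two_natural_iso A B S T \<theta>"
proof -
  interpret S: two_functor A B S by fact
  interpret T: two_functor A B T by fact
  have "x \<in> Ob A \<Longrightarrow> \<theta> x \<in> Arr B" for x
    using assms(3) by (auto simp: iso1_def)
  then show ?thesis
    by unfold_locales (use assms(3-) in \<open>auto simp: hom1_def hom2_def\<close>)
qed

context pairing
begin

sublocale cartesian: tensor_2category Icon "cartesian_product pr"
  by (intro tensor_2category.intro two_functor_cartesian_product)

lemma associator_natural:
  assumes "pseudofunctor A A' F" "pseudofunctor B B' G" "pseudofunctor C C' H"
  shows "comp_pfun (prod_pfun pr F (prod_pfun pr G H)) (associator pr A B C)
    = comp_pfun (associator pr A' B' C') (prod_pfun pr (prod_pfun pr F G) H)"
proof -
  interpret F: pseudofunctor A A' F by fact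
  interpret G: pseudofunctor B B' G by fact
  interpret H: pseudofunctor C C' H by fact
  show ?thesis
    unfolding associator_def
    by (rule strict_pfun_natural)
      (auto intro!: pseudofunctor_prod_pfun assms strict_morphism_assoc_map
        F.B.bicategory_axioms G.B.bicategory_axioms H.B.bicategory_axioms
        F.C.bicategory_axioms G.C.bicategory_axioms H.C.bicategory_axioms)
qed

lemma associator_icon_natural:
  assumes "icon A A' F F' \<alpha>" "icon B B' G G' \<beta>" "icon C C' H H' \<gamma>"
  shows "hcomp_icon (prod_icon pr \<alpha> (prod_icon pr \<beta> \<gamma>)) (id_icon (associator pr A B C))
    = hcomp_icon (id_icon (associator pr A' B' C')) (prod_icon pr (prod_icon pr \<alpha> \<beta>) \<gamma>)"
proof -
  interpret \<alpha>: icon A A' F F' \<alpha> by fact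
  interpret \<beta>: icon B B' G G' \<beta> by fact
  interpret \<gamma>: icon C C' H H' \<gamma> by fact
  have "comp_pfun (prod_pfun pr F (prod_pfun pr G H)) (associator pr A B C)
      = comp_pfun (associator pr A' B' C') (prod_pfun pr (prod_pfun pr F G) H)"
    "comp_pfun (prod_pfun pr F' (prod_pfun pr G' H')) (associator pr A B C)
      = comp_pfun (associator pr A' B' C') (prod_pfun pr (prod_pfun pr F' G') H')"
    by (rule associator_natural; unfold_locales)+
  then show ?thesis
    unfolding associator_def
    by (rule strict_icon_natural[rotated 4])
      (auto intro!: icon_prod_icon assms strict_morphism_assoc_map
        \<alpha>.F.B.bicategory_axioms \<beta>.F.B.bicategory_axioms \<gamma>.F.B.bicategory_axioms
        \<alpha>.F.C.bicategory_axioms \<beta>.F.C.bicategory_axioms \<gamma>.F.C.bicategory_axioms)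
qed

lemma iso1_associator:
  assumes "B \<in> bicategories" "C \<in> bicategories" "D \<in> bicategories"
  shows "iso1 Icon (associator pr B C D)"
  unfolding associator_def using assms
  by (intro iso1_strict_pfun[where p' = "assoc_map_inv pr" and q' = "assoc_map_inv pr"
        and r' = "assoc_map_inv pr"] strict_morphism_assoc_map)
    (auto simp: bicategoriesD)

theorem two_natural_iso_associator:
  "two_natural_iso (prod_cells (prod_cells Icon Icon) Icon) Icon
    (tensor_left (cartesian_product pr)) (tensor_right (cartesian_product pr))
    (\<lambda>((B, C), D). associator pr B C D)"
  by (rule two_natural_isoI[OF cartesian.two_functor_tensor_left cartesian.two_functor_tensor_right])
    (auto simp: tensor_left_def tensor_right_def iso1_associator
      intro!: associator_natural associator_icon_natural functorsD iconsD)

lemma left_unitor_natural: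
  assumes "pseudofunctor B C F"
  shows "comp_pfun F (left_unitor pr pt B)
    = comp_pfun (left_unitor pr pt C) (prod_pfun pr (id_pfun (terminal_bicat pt)) F)"
proof -
  interpret F: pseudofunctor B C F by fact
  show ?thesis
    unfolding left_unitor_def
    by (rule strict_pfun_natural)
      (auto intro!: pseudofunctor_prod_pfun assms strict_morphism_projections
        pseudofunctor_id_pfun bicategory_terminal_bicat F.B.bicategory_axioms F.C.bicategory_axioms)
qed

lemma right_unitor_natural:
  assumes "pseudofunctor B C F"
  shows "comp_pfun F (right_unitor pr pt B)
    = comp_pfun (right_unitor pr pt C) (prod_pfun pr F (id_pfun (terminal_bicat pt)))"
proof -
  interpret F: pseudofunctor B C F by fact
  show ?thesis
    unfolding right_unitor_def
    by (rule strict_pfun_natural)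
      (auto intro!: pseudofunctor_prod_pfun assms strict_morphism_projections
        pseudofunctor_id_pfun bicategory_terminal_bicat F.B.bicategory_axioms F.C.bicategory_axioms)
qed

lemma left_unitor_icon_natural:
  assumes "icon B C F G \<alpha>"
  shows "hcomp_icon \<alpha> (id_icon (left_unitor pr pt B))
    = hcomp_icon (id_icon (left_unitor pr pt C))
        (prod_icon pr (id_icon (id_pfun (terminal_bicat pt))) \<alpha>)"
proof -
  interpret icon B C F G \<alpha> by fact
  note natural = left_unitor_natural[OF F.pseudofunctor_axioms]
    left_unitor_natural[OF G.pseudofunctor_axioms]
  show ?thesis
    unfolding left_unitor_def
    by (rule strict_icon_natural[OF _ _ _ _ natural[unfolded left_unitor_def]])
      (auto intro!: icon_prod_icon icon_id_icon assms strict_morphism_projections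
        pseudofunctor_id_pfun bicategory_terminal_bicat F.B.bicategory_axioms F.C.bicategory_axioms)
qed

lemma right_unitor_icon_natural:
  assumes "icon B C F G \<alpha>"
  shows "hcomp_icon \<alpha> (id_icon (right_unitor pr pt B))
    = hcomp_icon (id_icon (right_unitor pr pt C))
        (prod_icon pr \<alpha> (id_icon (id_pfun (terminal_bicat pt))))"
proof -
  interpret icon B C F G \<alpha> by fact
  note natural = right_unitor_natural[OF F.pseudofunctor_axioms]
    right_unitor_natural[OF G.pseudofunctor_axioms]
  show ?thesis
    unfolding right_unitor_def
    by (rule strict_icon_natural[OF _ _ _ _ natural[unfolded right_unitor_def]])
      (auto intro!: icon_prod_icon icon_id_icon assms strict_morphism_projections
        pseudofunctor_id_pfun bicategory_terminal_bicat F.B.bicategory_axioms F.C.bicategory_axioms)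
qed

lemma iso1_unitors:
  assumes "B \<in> bicategories"
  shows "iso1 Icon (left_unitor pr pt B)" "iso1 Icon (right_unitor pr pt B)"
  unfolding left_unitor_def right_unitor_def using assms
  by (intro iso1_strict_pfun[OF _ _ _ strict_morphism_insert_point(1)]
      iso1_strict_pfun[OF _ _ _ strict_morphism_insert_point(2)] strict_morphism_projections;
    auto simp: bicategoriesD bicategory_terminal_bicat)+

theorem two_natural_iso_left_unitor:
  "two_natural_iso Icon Icon (unit_tensor Icon (cartesian_product pr) (terminal_bicat pt)) id_map
    (left_unitor pr pt)"
  by (rule two_natural_isoI[OF cartesian.two_functor_unit_tensor two_functor_id_map])
    (auto simp: unit_tensor_def id_map_def iso1_unitors two_category_Icon
      intro!: left_unitor_natural left_unitor_icon_natural functorsD iconsD)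

theorem two_natural_iso_right_unitor:
  "two_natural_iso Icon Icon (tensor_unit Icon (cartesian_product pr) (terminal_bicat pt)) id_map
    (right_unitor pr pt)"
  by (rule two_natural_isoI[OF cartesian.two_functor_tensor_unit two_functor_id_map])
    (auto simp: tensor_unit_def id_map_def iso1_unitors two_category_Icon
      intro!: right_unitor_natural right_unitor_icon_natural functorsD iconsD)

lemma associator_pentagon:
  assumes "bicategory W" "bicategory X" "bicategory Y" "bicategory Z"
  shows "comp_pfun (comp_pfun (prod_pfun pr (id_pfun W) (associator pr X Y Z))
      (associator pr W (prod_bicat pr X Y) Z)) (prod_pfun pr (associator pr W X Y) (id_pfun Z))
    = comp_pfun (associator pr W X (prod_bicat pr Y Z)) (associator pr (prod_bicat pr W X) Y Z)"
proof -
  note strict = prod_pfun_strict_pfun comp_pfun_strict_pfun strict_morphism_pair1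
    strict_morphism_id strict_morphism_assoc_map bicategory_prod_bicat
    strict_morphism_comp[OF strict_morphism_assoc_map(1)
      strict_morphism_pair1[OF strict_morphism_id strict_morphism_assoc_map(1)]]
  show ?thesis
    unfolding associator_def id_pfun_eq_strict_pfun
    by (simp add: strict assms) (rule strict_pfun_eqI; auto)
qed

lemma unitor_triangle:
  assumes "bicategory X" "bicategory Y"
  shows "comp_pfun (prod_pfun pr (id_pfun X) (left_unitor pr pt Y)) (associator pr X (terminal_bicat pt) Y)
    = prod_pfun pr (right_unitor pr pt X) (id_pfun Y)"
proof -
  note strict = prod_pfun_strict_pfun comp_pfun_strict_pfun strict_morphism_pair1
    strict_morphism_id strict_morphism_assoc_map strict_morphism_projections
    bicategory_prod_bicat bicategory_terminal_bicat
  show ?thesis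
    unfolding associator_def left_unitor_def right_unitor_def id_pfun_eq_strict_pfun
    by (simp add: strict assms) (rule strict_pfun_eqI; auto)
qed

theorem strongly_monoidal_2category_Icon:
  "strongly_monoidal_2category Icon (cartesian_product pr) (terminal_bicat pt)
    (associator pr) (left_unitor pr pt) (right_unitor pr pt)"
  by (intro strongly_monoidal_2category.intro strongly_monoidal_2category_axioms.intro
      two_category_Icon two_functor_cartesian_product two_natural_iso_associator
      two_natural_iso_left_unitor two_natural_iso_right_unitor)
    (simp_all add: associator_pentagon unitor_triangle bicategoriesD)

end

theorem corollary3p5:
  fixes pr :: "'u \<times> 'u \<Rightarrow> 'u" and pt :: 'u
  assumes "inj pr"
  shows "\<exists>a l r. strongly_monoidal_2category
    (Icon :: ('u small_bicat, 'u small_pfun, 'u small_icon) cells)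
    (cartesian_product pr) (terminal_bicat pt) a l r"
proof -
  interpret pairing pr
    by unfold_locales (fact assms)
  show ?thesis
    using strongly_monoidal_2category_Icon by blast
qed

end
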